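(* Let $\Omega\subset\mathbb{R}^d$ be convex and compact, let $m>d/2$, and let $\Phi$ be the Matérn kernel with smoothness parameter $\nu=m-d/2$ and scale parameter $\phi>0$. Let $f\in\mathcal{N}_\Phi(\Omega)$ and let $f_e\in\mathcal{N}_\Phi(\mathbb{R}^d)$ denote its canonical extension. Then the integral equation $$f(x)=\int_\Omega \Phi(x-t)\,v(t)\,dt,\qquad x\in\Omega,$$ has a solution $v\in L_2(\Omega)$ if and only if $f_e\in H^{2m}(\mathbb{R}^d)$.
   Context: The Matérn kernel is $\Phi(x;\nu,\phi)=\frac{1}{\Gamma(\nu)2^{\nu-1}}(2\sqrt{\nu}\phi|x|)^\nu K_\nu(2\sqrt{\nu}\phi|x|)$ for $x\in\mathbb{R}^d$, where $K_\nu$ is the modified Bessel function of the second kind. For $D\subseteq\mathbb{R}^d$, the reproducing kernel Hilbert space $\mathcal{N}_\Phi(D)$ is the completion of $F_\Phi(D)=\{\sum_{i=1}^n\beta_i\Phi(\cdot-x_i):\beta_i\in\mathbb{R},x_i\in D,n\in\mathbb{N}\}$ (functions on $D$) under the inner product $\langle\sum_i\beta_i\Phi(\cdot-x_i),\sum_j\gamma_j\Phi(\cdot-x'_j)\rangle=\sum_{i,j}\beta_i\gamma_j\Phi(x_i-x'_j)$. The canonical extension: the map sending $\sum_i\beta_i\Phi(x-x_i)$, $x\in\Omega$, to the same expression for $x\in\mathbb{R}^d$ is an inner-product-preserving map $F_\Phi(\Omega)\to F_\Phi(\mathbb{R}^d)$; it extends by continuity to an isometry $\mathcal{N}_\Phi(\Omega)\to\mathcal{N}_\Phi(\mathbb{R}^d)$,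 $h\mapsto h_e$, with $h_e|_\Omega=h$. $H^{2m}(\mathbb{R}^d)$ is the (fractional) Sobolev space. *)

theory Defs
  imports "HOL-Analysis.Analysis"
begin

text \<open>Modified Bessel function of the second kind, via the standard integral
  representation K_nu(z) = int_0^infty exp(-z cosh t) cosh(nu t) dt, for z > 0.\<close>
definition besselK :: "real \<Rightarrow> real \<Rightarrow> real" where
  "besselK \<nu> z = (LBINT t=0..\<infinity>. exp (- z * cosh t) * cosh (\<nu> * t))"

text \<open>Matern kernel with smoothness nu and scale phi; value 1 at the origin
  (the continuous extension of the formula).\<close>
definition matern :: "real \<Rightarrow> real \<Rightarrow> 'a::real_normed_vector \<Rightarrow> real" where
  "matern \<nu> \<phi> x =
     (if x = 0 then 1
      else (let r = 2 * sqrt \<nu> * \<phi> * norm x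
            in r powr \<nu> * besselK \<nu> r / (Gamma \<nu> * 2 powr (\<nu> - 1))))"

definition kexp :: "('a::ab_group_add \<Rightarrow> real) \<Rightarrow> (real \<times> 'a) list \<Rightarrow> 'a \<Rightarrow> real" where
  "kexp K c x = (\<Sum>(b, y)\<leftarrow>c. b * K (x - y))"

definition kinner :: "('a::ab_group_add \<Rightarrow> real) \<Rightarrow> (real \<times> 'a) list \<Rightarrow> (real \<times> 'a) list \<Rightarrow> real" where
  "kinner K c c' = (\<Sum>(b, y)\<leftarrow>c. \<Sum>(g, z)\<leftarrow>c'. b * g * K (y - z))"

definition kdist2 :: "('a::ab_group_add \<Rightarrow> real) \<Rightarrow> (real \<times> 'a) list \<Rightarrow> (real \<times> 'a) list \<Rightarrow> real" where
  "kdist2 K c c' = (let d = c @ map (\<lambda>(b, y). (- b, y)) c' in kinner K d d)"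

definition kcauchy :: "('a::ab_group_add \<Rightarrow> real) \<Rightarrow> (nat \<Rightarrow> (real \<times> 'a) list) \<Rightarrow> bool" where
  "kcauchy K s = (\<forall>e>0. \<exists>N. \<forall>m\<ge>N. \<forall>n\<ge>N. kdist2 K (s m) (s n) < e)"

text \<open>Sequences in F_Phi(D) that are Cauchy in the native norm and converge
  pointwise on D to f; the native space N_Phi(D) (the completion of F_Phi(D),
  realised as functions on D) consists of all such pointwise limits.\<close>
definition approx_seq :: "('a::ab_group_add \<Rightarrow> real) \<Rightarrow> 'a set \<Rightarrow> ('a \<Rightarrow> real) \<Rightarrow> (nat \<Rightarrow> (real \<times> 'a) list) \<Rightarrow> bool" where
  "approx_seq K D f s \<longleftrightarrow>
     (\<forall>n. snd ` set (s n) \<subseteq> D) \<and> kcauchy K s \<and>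
     (\<forall>x\<in>D. (\<lambda>n. kexp K (s n) x) \<longlonglongrightarrow> f x)"

definition native_space :: "('a::ab_group_add \<Rightarrow> real) \<Rightarrow> 'a set \<Rightarrow> ('a \<Rightarrow> real) set" where
  "native_space K D = {f. \<exists>s. approx_seq K D f s}"

definition canon_ext :: "('a::ab_group_add \<Rightarrow> real) \<Rightarrow> 'a set \<Rightarrow> ('a \<Rightarrow> real) \<Rightarrow> 'a \<Rightarrow> real" where
  "canon_ext K D f = (let s = (SOME s. approx_seq K D f s) in (\<lambda>x. lim (\<lambda>n. kexp K (s n) x)))"

text \<open>Truncated Fourier integral; the L2 Fourier transform (Plancherel) is the
  L2-limit of these as R tends to infinity.\<close>
definition ft_trunc :: "('a::euclidean_space \<Rightarrow> real) \<Rightarrow> real \<Rightarrow> 'a \<Rightarrow> complex" where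
  "ft_trunc f R \<omega> = (LINT x:ball 0 R|lebesgue. f x *\<^sub>R cis (- (\<omega> \<bullet> x)))"

definition sobolev_space :: "real \<Rightarrow> ('a::euclidean_space \<Rightarrow> real) set" where
  "sobolev_space s = {f. f \<in> borel_measurable lebesgue \<and>
      (\<integral>\<^sup>+ x. ennreal ((f x)\<^sup>2) \<partial>lebesgue) < \<infinity> \<and>
      (\<exists>g :: 'a \<Rightarrow> complex. g \<in> borel_measurable lebesgue \<and>
        (\<integral>\<^sup>+ \<omega>. ennreal ((1 + (norm \<omega>)\<^sup>2) powr s * (cmod (g \<omega>))\<^sup>2) \<partial>lebesgue) < \<infinity> \<and>
        (\<lambda>n. \<integral>\<^sup>+ \<omega>. ennreal ((cmod (g \<omega> - ft_trunc f (real n) \<omega>))\<^sup>2) \<partial>lebesgue)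
          \<longlonglongrightarrow> 0)}"

end

theory Submission
  imports Defs "HOL-Probability.Probability"
begin

text \<open>
  The Matern kernel is a mixture of Gaussians over a Gamma distribution, so its Fourier transform is
  a constant multiple of a function \<open>S\<close> that is comparable to \<open>(1 + |\<omega>|\<^sup>2) powr (- m)\<close>. Hence the native
  space is isometric to a closed subspace of \<open>L\<^sup>2\<close>: the expansion with coefficients \<open>b\<close> and nodes
  \<open>y\<close> corresponds to \<open>sqrt S\<close> times the trigonometric polynomial \<open>\<Sum> b cis (- (\<omega> \<bullet> y))\<close>, and \<open>f\<^sub>e\<close> is the
  inverse Fourier transform of \<open>sqrt S * q\<close> for the \<open>L\<^sup>2\<close>-limit \<open>q\<close>.

  If \<open>f\<close> agrees on \<open>\<Omega>\<close> with the convolution of the kernel and some \<open>v\<close> supported in \<open>\<Omega>\<close>, then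
  \<open>q - sqrt S * v^\<close> is orthogonal to everything that is generated by \<open>\<Omega>\<close>, in particular to itself.
  So \<open>f\<^sub>e\<close> is that convolution, and its transform is \<open>S * v^\<close> up to a constant.

  Conversely, \<open>f\<^sub>e \<in> H\<^bsup>2m\<^esup>\<close> means that \<open>q / sqrt S\<close> is square-integrable, hence the transform of some
  \<open>L\<^sup>2\<close> function. That function vanishes outside \<open>\<Omega>\<close>, because its pairing with a test function in the
  native space is the limit of pairings of trigonometric polynomials with nodes in \<open>\<Omega>\<close>, and these
  only evaluate the test function on \<open>\<Omega>\<close>.
\<close>

section \<open>Square-integrable functions\<close>

text \<open>The obstacle is that the synthesis of \<open>f\<^sub>e\<close> from \<open>q\<close>
  only shows it to be bounded, so that its transform is accessible only through truncations, and
  that \<open>q / sqrt S\<close> need not be integrable. Two facts about integrable functions carry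
  the Fourier analysis: the multiplication formula \<open>ft_duality\<close>, which moves
  \<open>ft\<close> from one factor of an integral to the other, and the inequality half of
  Plancherel, which lets L2 limits pass through \<open>ft\<close>. Elements of L2 are then
  identified by their pairings with test functions. The square root enters because the native norm
  of an expansion is an integral of \<open>S\<close> times the squared modulus of a trigonometric
  polynomial; with \<open>sqrt S\<close> moved into the function the norm is unweighted and
  completeness of L2 applies directly. The order 2m has the same origin: the transform of
  \<open>f\<^sub>e\<close> is a multiple of \<open>sqrt S * q\<close>, the Sobolev weight is
  comparable to the inverse square of \<open>S\<close>, and so the weighted square is comparable to
  \<open>|q|\<^sup>2 / S\<close>.\<close>

definition sq_integrable :: "'a measure \<Rightarrow> ('a \<Rightarrow> complex) \<Rightarrow> bool" where
  "sq_integrable M f \<longleftrightarrow> f \<in> borel_measurable M \<and> integrable M (\<lambda>x. (cmod (f x))\<^sup>2)"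

lemma sq_integrable_measurable [measurable_dest]:
  "sq_integrable M f \<Longrightarrow> f \<in> borel_measurable M"
  by (simp add: sq_integrable_def)

lemma sq_integrable_norm2: "sq_integrable M f \<Longrightarrow> integrable M (\<lambda>x. (cmod (f x))\<^sup>2)"
  by (simp add: sq_integrable_def)

lemma sq_integrable_bound:
  assumes f: "sq_integrable M f" and [measurable]: "g \<in> borel_measurable M"
    and b: "AE x in M. cmod (g x) \<le> C * cmod (f x)"
  shows "sq_integrable M g"
proof -
  have "integrable M (\<lambda>x. (cmod (g x))\<^sup>2)"
  proof (rule Bochner_Integration.integrable_bound)
    show "integrable M (\<lambda>x. C\<^sup>2 * (cmod (f x))\<^sup>2)"
      using sq_integrable_norm2[OF f] by simp
    show "AE x in M. norm ((cmod (g x))\<^sup>2) \<le> norm (C\<^sup>2 * (cmod (f x))\<^sup>2)"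
      using b
    proof eventually_elim
      case (elim x)
      have "(cmod (g x))\<^sup>2 \<le> (C * cmod (f x))\<^sup>2"
        using elim by (intro power_mono) auto
      thus ?case by (simp add: power_mult_distrib)
    qed
  qed simp
  thus ?thesis by (simp add: sq_integrable_def)
qed

lemma sq_integrable_scale: "sq_integrable M f \<Longrightarrow> sq_integrable M (\<lambda>x. c * f x)"
  by (rule sq_integrable_bound[where C = "cmod c"]) (auto simp: norm_mult)

lemma borel_measurable_cnj [measurable]: "cnj \<in> borel_measurable borel"
  by (intro borel_measurable_continuous_onI continuous_intros)

lemma sq_integrable_cnj: "sq_integrable M f \<Longrightarrow> sq_integrable M (\<lambda>x. cnj (f x))"
  by (rule sq_integrable_bound[where C = 1 and f = f]) auto

lemma sq_integrable_add:
  assumes f: "sq_integrable M f" and g: "sq_integrable M g"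
  shows "sq_integrable M (\<lambda>x. f x + g x)"
proof -
  note [measurable] = sq_integrable_measurable[OF f] sq_integrable_measurable[OF g]
  have "integrable M (\<lambda>x. (cmod (f x + g x))\<^sup>2)"
  proof (rule Bochner_Integration.integrable_bound)
    show "integrable M (\<lambda>x. 2 * (cmod (f x))\<^sup>2 + 2 * (cmod (g x))\<^sup>2)"
      using sq_integrable_norm2[OF f] sq_integrable_norm2[OF g] by simp
    show "AE x in M. norm ((cmod (f x + g x))\<^sup>2) \<le> norm (2 * (cmod (f x))\<^sup>2 + 2 * (cmod (g x))\<^sup>2)"
    proof (rule AE_I2)
      fix x
      have "(cmod (f x + g x))\<^sup>2 \<le> (cmod (f x) + cmod (g x))\<^sup>2"
        by (intro power_mono norm_triangle_ineq) auto
      also have "\<dots> \<le> 2 * (cmod (f x))\<^sup>2 + 2 * (cmod (g x))\<^sup>2"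
        using sum_squares_bound[of "cmod (f x)" "cmod (g x)"] by (simp add: power2_sum)
      finally show "norm ((cmod (f x + g x))\<^sup>2) \<le> norm (2 * (cmod (f x))\<^sup>2 + 2 * (cmod (g x))\<^sup>2)"
        by simp
    qed
  qed simp
  thus ?thesis by (simp add: sq_integrable_def)
qed

lemma sq_integrable_diff:
  assumes "sq_integrable M f" and "sq_integrable M g"
  shows "sq_integrable M (\<lambda>x. f x - g x)"
  using sq_integrable_add[OF assms(1) sq_integrable_scale[OF assms(2), of "-1"]] by simp

lemma sq_integrable_if_bounded:
  assumes f: "integrable M f" and b: "\<And>x. cmod (f x) \<le> B"
  shows "sq_integrable M f"
proof -
  note [measurable] = borel_measurable_integrable[OF f]
  have "integrable M (\<lambda>x. (cmod (f x))\<^sup>2)"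
  proof (rule Bochner_Integration.integrable_bound)
    show "integrable M (\<lambda>x. B * cmod (f x))"
      using f by simp
    show "AE x in M. norm ((cmod (f x))\<^sup>2) \<le> norm (B * cmod (f x))"
    proof (rule AE_I2)
      fix x
      have "0 \<le> B" using b[of x] norm_ge_zero order_trans by blast
      thus "norm ((cmod (f x))\<^sup>2) \<le> norm (B * cmod (f x))"
        using mult_right_mono[OF b[of x], of "cmod (f x)"] by (simp add: power2_eq_square)
    qed
  qed simp
  thus ?thesis by (simp add: sq_integrable_def)
qed

lemma sq_integrable_mult_integrable:
  assumes f: "sq_integrable M f" and g: "sq_integrable M g"
  shows "integrable M (\<lambda>x. f x * g x)"
proof (rule Bochner_Integration.integrable_bound)
  show "integrable M (\<lambda>x. (cmod (f x))\<^sup>2 + (cmod (g x))\<^sup>2)"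
    using sq_integrable_norm2[OF f] sq_integrable_norm2[OF g] by simp
  show "(\<lambda>x. f x * g x) \<in> borel_measurable M"
    using f g by measurable
  show "AE x in M. norm (f x * g x) \<le> norm ((cmod (f x))\<^sup>2 + (cmod (g x))\<^sup>2)"
  proof (rule AE_I2)
    fix x
    have "2 * cmod (f x) * cmod (g x) \<le> (cmod (f x))\<^sup>2 + (cmod (g x))\<^sup>2"
      by (rule sum_squares_bound)
    moreover have "0 \<le> cmod (f x) * cmod (g x)" by simp
    ultimately have "cmod (f x) * cmod (g x) \<le> (cmod (f x))\<^sup>2 + (cmod (g x))\<^sup>2"
      by linarith
    thus "norm (f x * g x) \<le> norm ((cmod (f x))\<^sup>2 + (cmod (g x))\<^sup>2)"
      by (simp add: norm_mult)
  qed
qed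

text \<open>The pairing is bilinear, without conjugation, because the multiplication formula for
  \<open>ft\<close> is bilinear too; conjugates are inserted explicitly where orthogonality needs
  them. The bound comes from the nonnegative quadratic in \<open>l\<close> given by the integral of
  \<open>(l * cmod (f x) - cmod (g x))\<^sup>2\<close>.\<close>

lemma sq_integrable_Cauchy_Schwarz:
  assumes f: "sq_integrable M f" and g: "sq_integrable M g"
  shows "(cmod (\<integral>x. f x * g x \<partial>M))\<^sup>2 \<le> (\<integral>x. (cmod (f x))\<^sup>2 \<partial>M) * (\<integral>x. (cmod (g x))\<^sup>2 \<partial>M)"
proof -
  note if2 = sq_integrable_norm2[OF f] and ig2 = sq_integrable_norm2[OF g]
  note [measurable] = sq_integrable_measurable[OF f] sq_integrable_measurable[OF g]
  have ifg: "integrable M (\<lambda>x. cmod (f x) * cmod (g x))"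
    using integrable_norm[OF sq_integrable_mult_integrable[OF f g]] by (simp add: norm_mult)
  define A B C where "A = (\<integral>x. (cmod (f x))\<^sup>2 \<partial>M)" and "B = (\<integral>x. (cmod (g x))\<^sup>2 \<partial>M)"
    and "C = (\<integral>x. cmod (f x) * cmod (g x) \<partial>M)"
  have quad: "0 \<le> l\<^sup>2 * A - 2 * l * C + B" for l
  proof -
    have "0 \<le> (\<integral>x. (l * cmod (f x) - cmod (g x))\<^sup>2 \<partial>M)"
      by simp
    also have "\<dots> = (\<integral>x. l\<^sup>2 * (cmod (f x))\<^sup>2 - 2 * l * (cmod (f x) * cmod (g x)) + (cmod (g x))\<^sup>2 \<partial>M)"
      by (intro Bochner_Integration.integral_cong) (auto simp: power2_diff power_mult_distrib)
    also have "\<dots> = l\<^sup>2 * A - 2 * l * C + B"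
      using if2 ig2 ifg by (simp add: A_def B_def C_def)
    finally show ?thesis .
  qed
  have "A \<ge> 0" "C \<ge> 0" by (auto simp: A_def C_def)
  have "C\<^sup>2 \<le> A * B"
  proof (cases "A = 0")
    case True
    have "AE x in M. (cmod (f x))\<^sup>2 = 0"
      using True if2 unfolding A_def by (subst (asm) integral_nonneg_eq_0_iff_AE) auto
    hence "C = 0"
      unfolding C_def by (intro integral_eq_zero_AE) auto
    thus ?thesis using True by simp
  next
    case False
    hence "A > 0" using \<open>A \<ge> 0\<close> by simp
    \<comment> \<open>\<open>l = C / A\<close> minimises the quadratic.\<close>
    have "0 \<le> (C / A)\<^sup>2 * A - 2 * (C / A) * C + B" by (rule quad)
    also have "\<dots> = B - C\<^sup>2 / A"
      using \<open>A > 0\<close> by (simp add: field_simps power2_eq_square)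
    finally show ?thesis using \<open>A > 0\<close> by (simp add: field_simps)
  qed
  moreover have "cmod (\<integral>x. f x * g x \<partial>M) \<le> C"
    unfolding C_def using integral_norm_bound[of M "\<lambda>x. f x * g x"] by (simp add: norm_mult)
  ultimately show ?thesis
    unfolding A_def B_def by (meson norm_ge_zero order_trans power_mono)
qed

text \<open>Continuity of the L2 pairing: the device by which statements about
  \<open>rootS * trig\<close> and about truncations are carried over to their L2 limits.\<close>

lemma tendsto_integral_L2:
  assumes u: "\<And>n. sq_integrable M (u n)" and v: "sq_integrable M v" and g: "sq_integrable M g"
    and lim: "(\<lambda>n. \<integral>x. (cmod (u n x - v x))\<^sup>2 \<partial>M) \<longlonglongrightarrow> 0"
  shows "(\<lambda>n. \<integral>x. u n x * g x \<partial>M) \<longlonglongrightarrow> (\<integral>x. v x * g x \<partial>M)"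
proof -
  let ?G = "\<integral>x. (cmod (g x))\<^sup>2 \<partial>M"
  have bd: "cmod ((\<integral>x. u n x * g x \<partial>M) - (\<integral>x. v x * g x \<partial>M))
      \<le> sqrt ((\<integral>x. (cmod (u n x - v x))\<^sup>2 \<partial>M) * ?G)" for n
  proof -
    have "(\<integral>x. u n x * g x \<partial>M) - (\<integral>x. v x * g x \<partial>M) = (\<integral>x. (u n x - v x) * g x \<partial>M)"
      using sq_integrable_mult_integrable[OF u[of n] g] sq_integrable_mult_integrable[OF v g]
      by (simp add: left_diff_distrib)
    thus ?thesis
      using sq_integrable_Cauchy_Schwarz[OF sq_integrable_diff[OF u[of n] v] g]
      by (simp add: real_le_rsqrt)
  qed
  have "(\<lambda>n. sqrt ((\<integral>x. (cmod (u n x - v x))\<^sup>2 \<partial>M) * ?G)) \<longlonglongrightarrow> sqrt (0 * ?G)"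
    by (intro tendsto_intros lim)
  hence "(\<lambda>n. sqrt ((\<integral>x. (cmod (u n x - v x))\<^sup>2 \<partial>M) * ?G)) \<longlonglongrightarrow> 0" by simp
  hence "(\<lambda>n. (\<integral>x. u n x * g x \<partial>M) - (\<integral>x. v x * g x \<partial>M)) \<longlonglongrightarrow> 0"
    by (rule Lim_null_comparison[rotated]) (use bd in auto)
  thus ?thesis by (rule LIM_zero_cancel)
qed

text \<open>Riesz-Fischer. The squared increments along a fast subsequence are summed with weights
  \<open>2^k\<close>, so that only integrals of nonnegative series occur. Fatou's lemma then turns
  almost everywhere convergence of the subsequence into norm convergence of the whole
  sequence.\<close>

lemma L2_complete:
  fixes u :: "nat \<Rightarrow> 'a \<Rightarrow> complex"
  assumes u: "\<And>n. sq_integrable M (u n)"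
    and cauchy: "\<And>e. e > 0 \<Longrightarrow> \<exists>N. \<forall>m\<ge>N. \<forall>n\<ge>N. (\<integral>x. (cmod (u m x - u n x))\<^sup>2 \<partial>M) < e"
  obtains v where "sq_integrable M v" "(\<lambda>n. \<integral>x. (cmod (u n x - v x))\<^sup>2 \<partial>M) \<longlonglongrightarrow> 0"
proof -
  note [measurable] = sq_integrable_measurable[OF u]
  have nnD: "(\<integral>\<^sup>+x. ennreal ((cmod (u m x - u n x))\<^sup>2) \<partial>M) = ennreal (\<integral>x. (cmod (u m x - u n x))\<^sup>2 \<partial>M)" for m n
    by (intro nn_integral_eq_integral sq_integrable_norm2[OF sq_integrable_diff[OF u u]]) auto
  have "\<forall>k. \<exists>N. \<forall>m\<ge>N. \<forall>n\<ge>N. (\<integral>x. (cmod (u m x - u n x))\<^sup>2 \<partial>M) < (1/4)^k"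
    using cauchy by simp
  then obtain N where N: "\<And>k m n. m \<ge> N k \<Longrightarrow> n \<ge> N k \<Longrightarrow> (\<integral>x. (cmod (u m x - u n x))\<^sup>2 \<partial>M) < (1/4)^k"
    by metis
  \<comment> \<open>Adding all earlier thresholds gives \<open>r k \<ge> N k\<close>,
    \<open>r (Suc k) \<ge> N k\<close> and \<open>r k \<ge> k\<close> at once.\<close>
  define r where "r k = k + (\<Sum>i\<le>k. N i)" for k :: nat
  have rN: "r k \<ge> N k" for k
    unfolding r_def using member_le_sum[of k "{..k}" N] by auto
  have rS: "r (Suc k) \<ge> N k" for k
    using rN[of k] unfolding r_def by simp
  have rk: "r k \<ge> k" for k by (simp add: r_def)
  define d where "d k x = cmod (u (r (Suc k)) x - u (r k) x)" for k x
  have [measurable]: "d k \<in> borel_measurable M" for k unfolding d_def by measurable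
  have "(\<integral>\<^sup>+x. (\<Sum>k. ennreal (2^k * (d k x)\<^sup>2)) \<partial>M) = (\<Sum>k. \<integral>\<^sup>+x. ennreal (2^k * (d k x)\<^sup>2) \<partial>M)"
    by (intro nn_integral_suminf) simp
  also have "\<dots> \<le> (\<Sum>k. ennreal ((1/2)^k))"
  proof (intro suminf_le allI)
    fix k
    have "(\<integral>\<^sup>+x. ennreal (2^k * (d k x)\<^sup>2) \<partial>M) = ennreal (2^k) * (\<integral>\<^sup>+x. ennreal ((d k x)\<^sup>2) \<partial>M)"
      by (simp add: ennreal_mult nn_integral_cmult)
    also have "\<dots> \<le> ennreal (2^k) * ennreal ((1/4)^k)"
      using N[OF rS rN, of k] unfolding d_def nnD by (intro mult_left_mono ennreal_leI) auto
    also have "\<dots> = ennreal ((1/2)^k)"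
      by (simp add: ennreal_mult[symmetric] power_mult_distrib[symmetric])
    finally show "(\<integral>\<^sup>+x. ennreal (2^k * (d k x)\<^sup>2) \<partial>M) \<le> ennreal ((1/2)^k)" .
  qed auto
  also have "\<dots> = ennreal (\<Sum>k. (1/2)^k)"
    by (intro suminf_ennreal2) (auto intro: summable_geometric)
  also have "\<dots> < \<infinity>" by simp
  finally have fin: "(\<integral>\<^sup>+x. (\<Sum>k. ennreal (2^k * (d k x)\<^sup>2)) \<partial>M) < \<infinity>" .
  have "AE x in M. (\<Sum>k. ennreal (2^k * (d k x)\<^sup>2)) \<noteq> \<infinity>"
    using fin by (intro nn_integral_PInf_AE) (auto simp: less_top)
  hence conv: "AE x in M. convergent (\<lambda>k. u (r k) x)"
  proof eventually_elim
    case (elim x)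
    have s1: "summable (\<lambda>k. 2^k * (d k x)\<^sup>2)"
      using elim by (intro summable_suminf_not_top) auto
    have "summable (\<lambda>k. (1/2)^k + 2^k * (d k x)\<^sup>2)"
      by (intro summable_add s1 summable_geometric) auto
    hence "summable (\<lambda>k. d k x)"
    proof (rule summable_comparison_test[rotated], intro exI allI impI)
      fix k :: nat
      have d0: "d k x \<ge> 0" by (simp add: d_def)
      \<comment> \<open>The arithmetic-geometric inequality, divided by \<open>2^k\<close>, bounds
        the unsquared increment by a summable sequence.\<close>
      have "2 * 1 * (2^k * d k x) \<le> 1\<^sup>2 + (2^k * d k x)\<^sup>2" by (rule sum_squares_bound)
      hence "2^k * (2 * d k x) \<le> 2^k * ((1/2)^k + 2^k * (d k x)\<^sup>2)"
        by (simp add: algebra_simps power_mult_distrib power2_eq_square power_one_over)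
      hence "2 * d k x \<le> (1/2)^k + 2^k * (d k x)\<^sup>2"
        by (subst (asm) mult_le_cancel_left_pos) auto
      thus "norm (d k x) \<le> (1/2)^k + 2^k * (d k x)\<^sup>2" using d0 by simp
    qed
    hence "summable (\<lambda>k. u (r (Suc k)) x - u (r k) x)"
      unfolding d_def by (rule summable_norm_cancel)
    hence "convergent (\<lambda>n. \<Sum>k<n. u (r (Suc k)) x - u (r k) x)"
      by (simp add: summable_iff_convergent)
    hence "convergent (\<lambda>n. u (r n) x - u (r 0) x)"
      by (simp only: sum_lessThan_telescope[of "\<lambda>k. u (r k) x"])
    hence "convergent (\<lambda>n. (u (r n) x - u (r 0) x) + u (r 0) x)"
      by (intro convergent_add convergent_const)
    thus ?case by simp
  qed
  define v where "v x = lim (\<lambda>k. u (r k) x)" for x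
  have [measurable]: "v \<in> borel_measurable M"
    unfolding v_def by (rule borel_measurable_lim_metric) simp
  have lim: "AE x in M. (\<lambda>k. u (r k) x) \<longlonglongrightarrow> v x"
    using conv by eventually_elim (auto simp: v_def convergent_LIMSEQ_iff)
  \<comment> \<open>Fatou along the subsequence \<open>r\<close>: a bound on the distance from
    \<open>u n\<close> to all late \<open>u m\<close> survives for the limit.\<close>
  have key: "(\<integral>\<^sup>+x. ennreal ((cmod (u n x - v x))\<^sup>2) \<partial>M) \<le> ennreal e"
    if "\<And>m. m \<ge> n0 \<Longrightarrow> (\<integral>x. (cmod (u n x - u m x))\<^sup>2 \<partial>M) \<le> e" for n n0 e
  proof -
    have "(\<integral>\<^sup>+x. ennreal ((cmod (u n x - v x))\<^sup>2) \<partial>M)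
        = (\<integral>\<^sup>+x. liminf (\<lambda>k. ennreal ((cmod (u n x - u (r k) x))\<^sup>2)) \<partial>M)"
    proof (rule nn_integral_cong_AE)
      show "AE x in M. ennreal ((cmod (u n x - v x))\<^sup>2) = liminf (\<lambda>k. ennreal ((cmod (u n x - u (r k) x))\<^sup>2))"
        using lim
      proof eventually_elim
        case (elim x)
        have "(\<lambda>k. ennreal ((cmod (u n x - u (r k) x))\<^sup>2)) \<longlonglongrightarrow> ennreal ((cmod (u n x - v x))\<^sup>2)"
          by (intro tendsto_intros elim)
        from lim_imp_Liminf[OF _ this] show ?case by simp
      qed
    qed
    also have "\<dots> \<le> liminf (\<lambda>k. \<integral>\<^sup>+x. ennreal ((cmod (u n x - u (r k) x))\<^sup>2) \<partial>M)"
      by (rule nn_integral_liminf) simp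
    also have "\<dots> \<le> liminf (\<lambda>k. ennreal e)"
    proof (rule Liminf_mono)
      show "\<forall>\<^sub>F k in sequentially. (\<integral>\<^sup>+x. ennreal ((cmod (u n x - u (r k) x))\<^sup>2) \<partial>M) \<le> ennreal e"
        using eventually_ge_at_top[of n0]
      proof eventually_elim
        case (elim k)
        have "r k \<ge> n0" using rk[of k] elim by linarith
        thus ?case unfolding nnD by (intro ennreal_leI that)
      qed
    qed
    also have "\<dots> = ennreal e" by (simp add: Liminf_const)
    finally show ?thesis .
  qed
  have sq: "sq_integrable M (\<lambda>x. u n x - v x)" and le: "(\<integral>x. (cmod (u n x - v x))\<^sup>2 \<partial>M) \<le> e"
    if H: "\<And>m. m \<ge> n0 \<Longrightarrow> (\<integral>x. (cmod (u n x - u m x))\<^sup>2 \<partial>M) \<le> e" for n n0 e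
  proof -
    have k: "(\<integral>\<^sup>+x. ennreal ((cmod (u n x - v x))\<^sup>2) \<partial>M) \<le> ennreal e" by (rule key[OF H])
    have "0 \<le> (\<integral>x. (cmod (u n x - u n0 x))\<^sup>2 \<partial>M)" by simp
    hence e0: "e \<ge> 0" using H[of n0] by linarith
    have i: "integrable M (\<lambda>x. (cmod (u n x - v x))\<^sup>2)"
      using k by (intro integrableI_bounded) (auto intro: le_less_trans)
    thus "sq_integrable M (\<lambda>x. u n x - v x)" by (simp add: sq_integrable_def)
    have "ennreal (\<integral>x. (cmod (u n x - v x))\<^sup>2 \<partial>M) \<le> ennreal e"
      using k by (subst (asm) nn_integral_eq_integral[OF i]) auto
    thus "(\<integral>x. (cmod (u n x - v x))\<^sup>2 \<partial>M) \<le> e" using e0 by simp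
  qed
  obtain N1 where N1: "\<And>m n. m \<ge> N1 \<Longrightarrow> n \<ge> N1 \<Longrightarrow> (\<integral>x. (cmod (u m x - u n x))\<^sup>2 \<partial>M) < 1"
    using cauchy[of 1] by auto
  have "sq_integrable M (\<lambda>x. u N1 x - v x)"
    using sq[of N1 N1 1] N1 by (auto simp: less_imp_le)
  from sq_integrable_diff[OF u[of N1] this] have "sq_integrable M v" by simp
  moreover have "(\<lambda>n. \<integral>x. (cmod (u n x - v x))\<^sup>2 \<partial>M) \<longlonglongrightarrow> 0"
  proof (rule LIMSEQ_I)
    fix e :: real assume "e > 0"
    then obtain N where N: "\<And>m n. m \<ge> N \<Longrightarrow> n \<ge> N \<Longrightarrow> (\<integral>x. (cmod (u m x - u n x))\<^sup>2 \<partial>M) < e / 2"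
      using cauchy[of "e/2"] by auto
    have "(\<integral>x. (cmod (u n x - v x))\<^sup>2 \<partial>M) \<le> e / 2" if "n \<ge> N" for n
      using le[of N n "e/2"] N[OF that] by (auto simp: less_imp_le)
    thus "\<exists>N. \<forall>n\<ge>N. norm ((\<integral>x. (cmod (u n x - v x))\<^sup>2 \<partial>M) - 0) < e"
      using \<open>e > 0\<close> by (intro exI[of _ N]) (force intro: le_less_trans)
  qed
  ultimately show ?thesis by (rule that)
qed

section \<open>Changes of variables and Gaussian integrals\<close>

lemma borel_measurable_cis [measurable]: "cis \<in> borel_measurable borel"
  by (intro borel_measurable_continuous_onI continuous_intros)

lemma integrable_mult_cis:
  assumes u: "integrable M u" and [measurable]: "f \<in> borel_measurable M"
  shows "integrable M (\<lambda>x. u x * cis (f x))"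
proof -
  note [measurable] = borel_measurable_integrable[OF u]
  show ?thesis
    by (rule Bochner_Integration.integrable_bound[OF u]) (auto simp: norm_mult)
qed

lemma lborel_integral_affine:
  fixes f :: "'a::euclidean_space \<Rightarrow> 'b::{banach, second_countable_topology}"
  assumes c: "c \<noteq> 0" and [measurable]: "f \<in> borel_measurable borel"
  shows "integrable lborel f \<longleftrightarrow> integrable lborel (\<lambda>x. f (t + c *\<^sub>R x))"
    and "(LBINT x. f x) = \<bar>c\<bar> ^ DIM('a) *\<^sub>R (LBINT x. f (t + c *\<^sub>R x))"
proof -
  have "integrable lborel f \<longleftrightarrow> integrable lborel (\<lambda>x. \<bar>c\<bar> ^ DIM('a) *\<^sub>R f (t + c *\<^sub>R x))"
    by (subst lborel_affine[OF c, of t]) (simp add: integrable_density integrable_distr_eq)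
  also have "\<dots> \<longleftrightarrow> integrable lborel (\<lambda>x. f (t + c *\<^sub>R x))"
  proof
    assume "integrable lborel (\<lambda>x. \<bar>c\<bar> ^ DIM('a) *\<^sub>R f (t + c *\<^sub>R x))"
    hence "integrable lborel (\<lambda>x. inverse (\<bar>c\<bar> ^ DIM('a)) *\<^sub>R \<bar>c\<bar> ^ DIM('a) *\<^sub>R f (t + c *\<^sub>R x))"
      by (rule integrable_scaleR_right)
    thus "integrable lborel (\<lambda>x. f (t + c *\<^sub>R x))" using c by simp
  qed (rule integrable_scaleR_right)
  finally show "integrable lborel f \<longleftrightarrow> integrable lborel (\<lambda>x. f (t + c *\<^sub>R x))" .
  show "(LBINT x. f x) = \<bar>c\<bar> ^ DIM('a) *\<^sub>R (LBINT x. f (t + c *\<^sub>R x))"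
    by (subst lborel_affine[OF c, of t]) (simp add: integral_density integral_distr)
qed

lemma lborel_integral_reflect:
  fixes f :: "'a::euclidean_space \<Rightarrow> 'b::{banach, second_countable_topology}"
  assumes [measurable]: "f \<in> borel_measurable borel"
  shows "integrable lborel (\<lambda>x. f (t - x)) \<longleftrightarrow> integrable lborel f"
    and "(LBINT x. f (t - x)) = (LBINT x. f x)"
  using lborel_integral_affine[of "-1" f t] by auto

lemma lborel_integral_translate:
  fixes f :: "'a::euclidean_space \<Rightarrow> 'b::{banach, second_countable_topology}"
  assumes [measurable]: "f \<in> borel_measurable borel"
  shows "integrable lborel (\<lambda>x. f (t + x)) \<longleftrightarrow> integrable lborel f"
    and "(LBINT x. f (t + x)) = (LBINT x. f x)"
  using lborel_integral_affine[of 1 f t] by auto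

text \<open>Fubini over the coordinates: \<open>lborel\<close> is the image of a product of
  one-dimensional Lebesgue measures. Gaussians and box kernels both have this product form, so their
  transforms reduce to one dimension.\<close>

lemma lborel_integral_prod:
  fixes f :: "'a::euclidean_space \<Rightarrow> real \<Rightarrow> complex"
  assumes f: "\<And>b. b \<in> Basis \<Longrightarrow> integrable lborel (f b)"
  shows "integrable lborel (\<lambda>x::'a. \<Prod>b\<in>Basis. f b (x \<bullet> b))"
    and "(LBINT x. (\<Prod>b\<in>Basis. f b ((x::'a) \<bullet> b))) = (\<Prod>b\<in>Basis. \<integral>t. f b t \<partial>lborel)"
proof -
  interpret P: product_sigma_finite "\<lambda>_::'a. lborel :: real measure" ..
  have [measurable]: "f b \<in> borel_measurable borel" if "b \<in> Basis" for b
    using borel_measurable_integrable[OF f[OF that]] by simp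
  have m [measurable]: "(\<lambda>x::'a. \<Prod>b\<in>Basis. f b (x \<bullet> b)) \<in> borel_measurable borel"
    by measurable
  have eq: "(\<Prod>b\<in>Basis. f b ((\<Sum>c\<in>Basis. g c *\<^sub>R c) \<bullet> b)) = (\<Prod>b\<in>Basis. f b (g b))" for g :: "'a \<Rightarrow> real"
    by (intro prod.cong) simp_all
  show "integrable lborel (\<lambda>x::'a. \<Prod>b\<in>Basis. f b (x \<bullet> b))"
    by (subst lborel_eq, subst integrable_distr_eq)
       (auto simp: eq intro!: P.product_integrable_prod f)
  show "(LBINT x. (\<Prod>b\<in>Basis. f b ((x::'a) \<bullet> b))) = (\<Prod>b\<in>Basis. \<integral>t. f b t \<partial>lborel)"
    by (subst lborel_eq, subst integral_distr)
       (auto simp: eq intro!: P.product_integral_prod f)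
qed

lemma gaussian_fourier_real:
  fixes a w :: real
  assumes a: "a > 0"
  shows "integrable lborel (\<lambda>t. complex_of_real (exp (- (a * t\<^sup>2))) * cis (w * t))"
    and "(LBINT t. complex_of_real (exp (- (a * t\<^sup>2))) * cis (w * t))
         = complex_of_real (sqrt (pi / a) * exp (- (w\<^sup>2 / (4 * a))))"
proof -
  \<comment> \<open>After the substitution \<open>x = c * t\<close> the integral is the
    characteristic function of the standard normal distribution at \<open>w / c\<close>; with this
    \<open>c\<close> the exponent \<open>(c * t)\<^sup>2 / 2\<close> of the normal density is
    \<open>a * t\<^sup>2\<close>.\<close>
  define c where "c = sqrt (2 * a)"
  have c: "c > 0" "c\<^sup>2 = 2 * a" using a by (auto simp: c_def)
  define F where "F x = complex_of_real (std_normal_density x) * cis (w / c * x)" for x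
  have [measurable]: "F \<in> borel_measurable borel" unfolding F_def by measurable
  have "char std_normal_distribution (w / c) = (LBINT x. std_normal_density x *\<^sub>R iexp (w / c * x))"
    unfolding char_def by (subst integral_density) auto
  also have "\<dots> = (LBINT x. F x)"
    by (intro Bochner_Integration.integral_cong) (auto simp: F_def cis_conv_exp scaleR_conv_of_real)
  finally have I: "(LBINT x. F x) = complex_of_real (exp (- ((w / c)\<^sup>2 / 2)))"
    by (simp add: char_std_normal_distribution)
  have iF: "integrable lborel F"
    unfolding F_def using integrable_std_normal_moment[of 0]
    by (intro integrable_mult_cis) auto
  have Fc: "F (c * t) = (1 / sqrt (2 * pi)) *\<^sub>R (complex_of_real (exp (- (a * t\<^sup>2))) * cis (w * t))" for t
    using c a by (simp add: F_def std_normal_density_def power_mult_distrib scaleR_conv_of_real)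
  have "integrable lborel (\<lambda>t. F (0 + c *\<^sub>R t))"
    using iF lborel_integral_affine(1)[of c F 0] c by simp
  hence "integrable lborel (\<lambda>t. sqrt (2 * pi) *\<^sub>R F (c * t))" by simp
  thus "integrable lborel (\<lambda>t. complex_of_real (exp (- (a * t\<^sup>2))) * cis (w * t))"
    unfolding Fc by simp
  have "complex_of_real (exp (- ((w / c)\<^sup>2 / 2)))
      = (c / sqrt (2 * pi)) *\<^sub>R (LBINT t. complex_of_real (exp (- (a * t\<^sup>2))) * cis (w * t))"
    using lborel_integral_affine(2)[of c F 0] c I by (simp add: Fc)
  moreover have "sqrt (pi / a) * (c / sqrt (2 * pi)) = 1"
    using a by (simp add: c_def real_sqrt_divide real_sqrt_mult)
  moreover have "(w / c)\<^sup>2 / 2 = w\<^sup>2 / (4 * a)"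
    using c by (simp add: power_divide)
  ultimately have "sqrt (pi / a) *\<^sub>R complex_of_real (exp (- (w\<^sup>2 / (4 * a))))
     = (LBINT t. complex_of_real (exp (- (a * t\<^sup>2))) * cis (w * t))"
    by (simp only: scaleR_scaleR mult.assoc[symmetric] scaleR_one)
  thus "(LBINT t. complex_of_real (exp (- (a * t\<^sup>2))) * cis (w * t))
         = complex_of_real (sqrt (pi / a) * exp (- (w\<^sup>2 / (4 * a))))"
    by (simp add: scaleR_conv_of_real)
qed

lemma norm_sq_Basis: "(norm (x::'a::euclidean_space))\<^sup>2 = (\<Sum>b\<in>Basis. (x \<bullet> b)\<^sup>2)"
  unfolding power2_norm_eq_inner by (subst euclidean_inner) (simp add: power2_eq_square)

lemma gaussian_fourier:
  fixes w :: "'a::euclidean_space"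
  assumes a: "a > 0"
  shows "integrable lborel (\<lambda>x::'a. exp (- (a * (norm x)\<^sup>2)))"
    and "(LBINT x. complex_of_real (exp (- (a * (norm x)\<^sup>2))) * cis (w \<bullet> x))
         = complex_of_real ((pi / a) powr (DIM('a) / 2) * exp (- ((norm w)\<^sup>2 / (4 * a))))"
proof -
  define f where "f w b t = complex_of_real (exp (- (a * t\<^sup>2))) * cis ((w \<bullet> b) * t)"
    for w b :: 'a and t :: real
  have i: "integrable lborel (f w b)" for w b
    unfolding f_def by (rule gaussian_fourier_real(1)[OF a])
  have e: "complex_of_real (exp (- (a * (norm x)\<^sup>2))) * cis (w \<bullet> x) = (\<Prod>b\<in>Basis. f w b (x \<bullet> b))" for w x
  proof -
    have "complex_of_real (exp (- (a * (norm x)\<^sup>2))) = (\<Prod>b\<in>Basis. complex_of_real (exp (- (a * (x \<bullet> b)\<^sup>2))))"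
      unfolding of_real_prod[symmetric] exp_sum[OF finite_Basis, symmetric]
      by (simp add: norm_sq_Basis sum_distrib_left sum_negf)
    moreover have "cis (w \<bullet> x) = (\<Prod>b\<in>Basis. cis ((w \<bullet> b) * (x \<bullet> b)))"
      by (simp add: cis_conv_exp exp_sum[OF finite_Basis, symmetric] euclidean_inner[of w x] sum_distrib_left)
    ultimately show ?thesis by (simp add: f_def prod.distrib)
  qed
  \<comment> \<open>At frequency \<open>0\<close> the factors \<open>cis\<close> disappear, which
    leaves the plain Gaussian.\<close>
  have "integrable lborel (\<lambda>x. \<Prod>b\<in>Basis. f 0 b (x \<bullet> b))"
    by (rule lborel_integral_prod(1)) (rule i)
  hence "integrable lborel (\<lambda>x::'a. complex_of_real (exp (- (a * (norm x)\<^sup>2))))"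
    unfolding e[symmetric] by simp
  thus "integrable lborel (\<lambda>x::'a. exp (- (a * (norm x)\<^sup>2)))"
    by (simp only: complex_of_real_integrable_eq)
  have "(LBINT x. complex_of_real (exp (- (a * (norm x)\<^sup>2))) * cis (w \<bullet> x)) = (\<Prod>b\<in>Basis. \<integral>t. f w b t \<partial>lborel)"
    unfolding e by (rule lborel_integral_prod(2)) (rule i)
  also have "\<dots> = (\<Prod>b\<in>(Basis::'a set). complex_of_real (sqrt (pi / a) * exp (- ((w \<bullet> b)\<^sup>2 / (4 * a)))))"
    unfolding f_def by (intro prod.cong refl gaussian_fourier_real(2)[OF a])
  also have "\<dots> = complex_of_real (sqrt (pi / a) ^ DIM('a) * (\<Prod>b\<in>(Basis::'a set). exp (- ((w \<bullet> b)\<^sup>2 / (4 * a)))))"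
    unfolding of_real_prod[symmetric] by (simp add: prod.distrib)
  also have "(\<Prod>b\<in>(Basis::'a set). exp (- ((w \<bullet> b)\<^sup>2 / (4 * a)))) = exp (- ((norm w)\<^sup>2 / (4 * a)))"
    unfolding exp_sum[OF finite_Basis, symmetric] by (simp add: norm_sq_Basis sum_divide_distrib sum_negf)
  also have "sqrt (pi / a) ^ DIM('a) = (pi / a) powr (DIM('a) / 2)"
    using a by (simp add: powr_half_sqrt[symmetric] powr_realpow[symmetric] powr_powr)
  finally show "(LBINT x. complex_of_real (exp (- (a * (norm x)\<^sup>2))) * cis (w \<bullet> x))
         = complex_of_real ((pi / a) powr (DIM('a) / 2) * exp (- ((norm w)\<^sup>2 / (4 * a))))" .
qed

section \<open>The Fourier transform on integrable functions\<close>

text \<open>Unnormalised, with the same sign as \<open>ft_trunc\<close>; the factors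
  \<open>(2 * pi) ^ DIM('a)\<close> in the L2 bound and in inversion come from this
  convention.\<close>

definition ft :: "('a::euclidean_space \<Rightarrow> complex) \<Rightarrow> 'a \<Rightarrow> complex" where
  "ft u \<omega> = (LBINT x. u x * cis (- (\<omega> \<bullet> x)))"

lemma borel_measurable_ft [measurable]:
  assumes [measurable]: "u \<in> borel_measurable borel"
  shows "ft u \<in> borel_measurable borel"
  unfolding ft_def by measurable

lemma norm_ft_le: "cmod (ft u \<omega>) \<le> (LBINT x. cmod (u x))"
  unfolding ft_def using integral_norm_bound[of lborel "\<lambda>x. u x * cis (- (\<omega> \<bullet> x))"]
  by (simp add: norm_mult)

lemma ft_diff:
  assumes "integrable lborel u" "integrable lborel v"
  shows "ft (\<lambda>x. u x - v x) \<omega> = ft u \<omega> - ft v \<omega>"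
  unfolding ft_def using assms by (simp add: left_diff_distrib integrable_mult_cis)

lemma integrable_pair_mult:
  fixes f :: "'a::euclidean_space \<Rightarrow> complex" and g :: "'b::euclidean_space \<Rightarrow> complex"
  assumes f: "integrable lborel f" and g: "integrable lborel g"
  shows "integrable (lborel \<Otimes>\<^sub>M lborel) (\<lambda>(x, y). f x * g y)"
proof -
  note [measurable] = borel_measurable_integrable[OF f] borel_measurable_integrable[OF g]
  show ?thesis
  proof (rule lborel_pair.Fubini_integrable)
    show "integrable lborel (\<lambda>x. \<integral>y. norm (case (x, y) of (x, y) \<Rightarrow> f x * g y) \<partial>lborel)"
      using f by (simp add: norm_mult)
    show "AE x in lborel. integrable lborel (\<lambda>y. case (x, y) of (x, y) \<Rightarrow> f x * g y)"
      using g by simp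
  qed measurable
qed

text \<open>The integrability that Fubini asks for when two integrable functions are paired through
  a bounded kernel, such as \<open>cis (- (\<omega> \<bullet> x))\<close> or a Gaussian.\<close>

lemma integrable_pair_mult_bounded:
  fixes f :: "'a::euclidean_space \<Rightarrow> complex" and g :: "'b::euclidean_space \<Rightarrow> complex"
  assumes f: "integrable lborel f" and g: "integrable lborel g"
    and [measurable]: "case_prod h \<in> borel_measurable (lborel \<Otimes>\<^sub>M lborel)" and b: "\<And>x y. cmod (h x y) \<le> B"
  shows "integrable (lborel \<Otimes>\<^sub>M lborel) (\<lambda>(x, y). f x * g y * h x y)"
proof -
  note [measurable] = borel_measurable_integrable[OF f] borel_measurable_integrable[OF g]
  have B: "B \<ge> 0" using b[of 0 0] norm_ge_zero order_trans by blast
  show ?thesis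
  proof (rule Bochner_Integration.integrable_bound)
    show "integrable (lborel \<Otimes>\<^sub>M lborel) (\<lambda>z. B *\<^sub>R (case z of (x, y) \<Rightarrow> f x * g y))"
      using integrable_pair_mult[OF f g] by (rule integrable_scaleR_right)
    show "(\<lambda>(x, y). f x * g y * h x y) \<in> borel_measurable (lborel \<Otimes>\<^sub>M lborel)"
      by measurable
    show "AE z in lborel \<Otimes>\<^sub>M lborel. norm (case z of (x, y) \<Rightarrow> f x * g y * h x y)
        \<le> norm (B *\<^sub>R (case z of (x, y) \<Rightarrow> f x * g y))"
      using b B by (intro AE_I2) (auto simp: norm_mult mult.commute[of B] intro!: mult_left_mono)
  qed
qed

text \<open>The multiplication formula: both sides are iterated integrals of the same function,
  since the kernel \<open>cis (- (\<omega> \<bullet> x))\<close> is symmetric in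
  \<open>\<omega>\<close> and \<open>x\<close>.\<close>

lemma ft_duality:
  assumes u: "integrable lborel u" and v: "integrable lborel v"
  shows "(LBINT \<omega>. ft u \<omega> * v \<omega>) = (LBINT x. u x * ft v x)"
proof -
  have i: "integrable (lborel \<Otimes>\<^sub>M lborel) (\<lambda>(\<omega>, x). v \<omega> * u x * cis (- (\<omega> \<bullet> x)))"
    by (rule integrable_pair_mult_bounded[OF v u, where B = 1]) auto
  have "(LBINT \<omega>. ft u \<omega> * v \<omega>) = (LBINT \<omega>. (LBINT x. v \<omega> * u x * cis (- (\<omega> \<bullet> x))))"
    by (subst mult.commute) (simp add: ft_def mult.assoc)
  also have "\<dots> = (LBINT x. (LBINT \<omega>. v \<omega> * u x * cis (- (\<omega> \<bullet> x))))"
    using lborel_pair.Fubini_integral[OF i] by simp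
  also have "\<dots> = (LBINT x. u x * ft v x)"
  proof (intro Bochner_Integration.integral_cong refl)
    fix x
    have "(LBINT \<omega>. v \<omega> * u x * cis (- (\<omega> \<bullet> x))) = (LBINT \<omega>. u x * (v \<omega> * cis (- (x \<bullet> \<omega>))))"
      by (intro Bochner_Integration.integral_cong refl) (simp add: inner_commute)
    thus "(LBINT \<omega>. v \<omega> * u x * cis (- (\<omega> \<bullet> x))) = u x * ft v x"
      by (simp add: ft_def)
  qed
  finally show ?thesis .
qed

section \<open>Convolution and Gaussian regularisation\<close>

definition conv :: "('a::euclidean_space \<Rightarrow> complex) \<Rightarrow> ('a \<Rightarrow> complex) \<Rightarrow> 'a \<Rightarrow> complex" where
  "conv u w x = (LBINT t. u (x - t) * w t)"

lemma borel_measurable_conv [measurable]: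
  assumes [measurable]: "u \<in> borel_measurable borel" "w \<in> borel_measurable borel"
  shows "conv u w \<in> borel_measurable borel"
  unfolding conv_def by measurable

lemma integrable_conv_pair:
  fixes u w :: "'a::euclidean_space \<Rightarrow> complex"
  assumes u: "integrable lborel u" and w: "integrable lborel w"
  shows "integrable (lborel \<Otimes>\<^sub>M lborel) (\<lambda>(t, x). u (x - t) * w t)"
proof -
  have [measurable]: "u \<in> borel_measurable borel" "w \<in> borel_measurable borel"
    using borel_measurable_integrable[OF u] borel_measurable_integrable[OF w] by auto
  have i: "integrable lborel (\<lambda>x. u (x - t))" for t
    using lborel_integral_translate(1)[of u "-t"] u by simp
  have e: "(LBINT x. cmod (u (x - t))) = (LBINT x. cmod (u x))" for t
    using lborel_integral_translate(2)[of "\<lambda>x. cmod (u x)" "-t"] by simp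
  show ?thesis
  proof (rule lborel_pair.Fubini_integrable)
    show "integrable lborel (\<lambda>t. \<integral>x. norm (case (t, x) of (t, x) \<Rightarrow> u (x - t) * w t) \<partial>lborel)"
      using w by (simp add: norm_mult e)
    show "AE t in lborel. integrable lborel (\<lambda>x. case (t, x) of (t, x) \<Rightarrow> u (x - t) * w t)"
      using i by simp
  qed measurable
qed

lemma integrable_conv:
  assumes u: "integrable lborel u" and w: "integrable lborel w"
  shows "integrable lborel (conv u w)"
  using lborel_pair.integrable_snd[OF integrable_conv_pair[OF u w]] by (simp add: conv_def[abs_def])

lemma ft_conv:
  assumes u: "integrable lborel u" and w: "integrable lborel w"
  shows "ft (conv u w) \<omega> = ft u \<omega> * ft w \<omega>"
proof -
  have [measurable]: "u \<in> borel_measurable borel" "w \<in> borel_measurable borel"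
    using borel_measurable_integrable[OF u] borel_measurable_integrable[OF w] by auto
  have i: "integrable (lborel \<Otimes>\<^sub>M lborel) (\<lambda>(t, x). u (x - t) * w t * cis (- (\<omega> \<bullet> x)))"
    by (rule Bochner_Integration.integrable_bound[OF integrable_conv_pair[OF u w]]) (auto simp: norm_mult)
  have "ft (conv u w) \<omega> = (LBINT x. (LBINT t. u (x - t) * w t * cis (- (\<omega> \<bullet> x))))"
    unfolding ft_def conv_def by simp
  also have "\<dots> = (LBINT t. (LBINT x. u (x - t) * w t * cis (- (\<omega> \<bullet> x))))"
    using lborel_pair.Fubini_integral[OF i] by simp
  also have "\<dots> = (LBINT t. ft u \<omega> * (w t * cis (- (\<omega> \<bullet> t))))"
  proof (intro Bochner_Integration.integral_cong refl)
    fix t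
    have "(LBINT x. u (x - t) * w t * cis (- (\<omega> \<bullet> x)))
        = (LBINT x. u (t + x - t) * w t * cis (- (\<omega> \<bullet> (t + x))))"
      by (rule lborel_integral_translate(2)[symmetric]) measurable
    also have "\<dots> = (LBINT x. (u x * cis (- (\<omega> \<bullet> x))) * (w t * cis (- (\<omega> \<bullet> t))))"
    proof (intro Bochner_Integration.integral_cong refl)
      fix x
      have "cis (- (\<omega> \<bullet> (t + x))) = cis (- (\<omega> \<bullet> x)) * cis (- (\<omega> \<bullet> t))"
        by (simp add: cis_mult inner_add_right algebra_simps)
      thus "u (t + x - t) * w t * cis (- (\<omega> \<bullet> (t + x)))
          = (u x * cis (- (\<omega> \<bullet> x))) * (w t * cis (- (\<omega> \<bullet> t)))"
        by simp
    qed
    finally show "(LBINT x. u (x - t) * w t * cis (- (\<omega> \<bullet> x))) = ft u \<omega> * (w t * cis (- (\<omega> \<bullet> t)))"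
      by (simp add: ft_def)
  qed
  also have "\<dots> = ft u \<omega> * ft w \<omega>" by (simp add: ft_def)
  finally show ?thesis .
qed

text \<open>For positive \<open>\<epsilon>\<close> this is \<open>(2 * pi) ^ DIM('a)\<close> times
  the heat kernel at time \<open>\<epsilon>\<close>; it arises as the transform of
  \<open>exp (- (\<epsilon> * (norm x)\<^sup>2))\<close>.\<close>

definition gauss_kernel :: "real \<Rightarrow> 'a::euclidean_space \<Rightarrow> real" where
  "gauss_kernel \<epsilon> z = (pi / \<epsilon>) powr (DIM('a) / 2) * exp (- ((norm z)\<^sup>2 / (4 * \<epsilon>)))"

lemma borel_measurable_gauss_kernel [measurable]: "gauss_kernel \<epsilon> \<in> borel_measurable borel"
  unfolding gauss_kernel_def by measurable

lemma gauss_kernel_nonneg: "gauss_kernel \<epsilon> z \<ge> 0"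
  by (simp add: gauss_kernel_def)

lemma gauss_kernel_le: "gauss_kernel \<epsilon> (z::'a::euclidean_space) \<le> (pi / \<epsilon>) powr (DIM('a) / 2)" if "\<epsilon> > 0"
  using that mult_left_mono[of "exp (- ((norm z)\<^sup>2 / (4 * \<epsilon>)))" 1 "(pi / \<epsilon>) powr (DIM('a) / 2)"]
  by (simp add: gauss_kernel_def)

lemma gauss_kernel_integral:
  assumes e: "\<epsilon> > 0"
  shows "integrable lborel (gauss_kernel \<epsilon> :: 'a::euclidean_space \<Rightarrow> real)"
    and "(LBINT x. gauss_kernel \<epsilon> (x::'a)) = (2 * pi) ^ DIM('a)"
proof -
  have a: "1 / (4 * \<epsilon>) > 0" using e by simp
  show "integrable lborel (gauss_kernel \<epsilon> :: 'a \<Rightarrow> real)"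
    unfolding gauss_kernel_def using gaussian_fourier(1)[OF a, where 'a = 'a] by simp
  have "complex_of_real (LBINT x. exp (- ((norm (x::'a))\<^sup>2 / (4 * \<epsilon>))))
      = complex_of_real ((pi * (4 * \<epsilon>)) powr (DIM('a) / 2))"
    using gaussian_fourier(2)[OF a, of "0 :: 'a"] by simp
  hence "(LBINT x. gauss_kernel \<epsilon> (x::'a)) = (pi / \<epsilon>) powr (DIM('a) / 2) * (pi * (4 * \<epsilon>)) powr (DIM('a) / 2)"
    unfolding gauss_kernel_def of_real_eq_iff by simp
  also have "\<dots> = ((2 * pi) powr 2) powr (DIM('a) / 2)"
    using e by (subst powr_mult[symmetric]) (auto simp: field_simps power2_eq_square)
  also have "\<dots> = (2 * pi) ^ DIM('a)"
    by (simp add: powr_powr powr_realpow del: powr_numeral)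
  finally show "(LBINT x. gauss_kernel \<epsilon> (x::'a)) = (2 * pi) ^ DIM('a)" .
qed

lemma ft_gauss_cis:
  fixes x y :: "'a::euclidean_space"
  assumes e: "\<epsilon> > 0"
  shows "integrable lborel (\<lambda>\<omega>. complex_of_real (exp (- (\<epsilon> * (norm \<omega>)\<^sup>2))) * cis (\<omega> \<bullet> y))"
    and "ft (\<lambda>\<omega>. complex_of_real (exp (- (\<epsilon> * (norm \<omega>)\<^sup>2))) * cis (\<omega> \<bullet> y)) x
       = complex_of_real (gauss_kernel \<epsilon> (y - x))"
proof -
  have "integrable lborel (\<lambda>\<omega>::'a. complex_of_real (exp (- (\<epsilon> * (norm \<omega>)\<^sup>2))))"
    using gaussian_fourier(1)[OF e, where 'a = 'a] by simp
  thus "integrable lborel (\<lambda>\<omega>. complex_of_real (exp (- (\<epsilon> * (norm \<omega>)\<^sup>2))) * cis (\<omega> \<bullet> y))"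
    by (rule integrable_mult_cis) simp
  have "ft (\<lambda>\<omega>. complex_of_real (exp (- (\<epsilon> * (norm \<omega>)\<^sup>2))) * cis (\<omega> \<bullet> y)) x
      = (LBINT \<omega>. complex_of_real (exp (- (\<epsilon> * (norm \<omega>)\<^sup>2))) * cis ((y - x) \<bullet> \<omega>))"
    unfolding ft_def
    by (intro Bochner_Integration.integral_cong refl)
       (simp add: inner_diff_left mult.assoc cis_mult inner_commute algebra_simps)
  thus "ft (\<lambda>\<omega>. complex_of_real (exp (- (\<epsilon> * (norm \<omega>)\<^sup>2))) * cis (\<omega> \<bullet> y)) x
       = complex_of_real (gauss_kernel \<epsilon> (y - x))"
    by (simp add: gaussian_fourier(2)[OF e] gauss_kernel_def)
qed

text \<open>Inversion with a Gaussian damping factor. It holds for every integrable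
  \<open>h\<close>, whether or not \<open>ft h\<close> is integrable, and its right-hand side is a
  smoothing of \<open>h\<close>. The L2 bound, inversion and injectivity are all drawn from
  it.\<close>

lemma ft_gauss_regularised:
  fixes h :: "'a::euclidean_space \<Rightarrow> complex"
  assumes h: "integrable lborel h" and e: "\<epsilon> > 0"
  shows "(LBINT \<omega>. ft h \<omega> * complex_of_real (exp (- (\<epsilon> * (norm \<omega>)\<^sup>2))) * cis (\<omega> \<bullet> y))
       = (LBINT x. h x * complex_of_real (gauss_kernel \<epsilon> (y - x)))"
  using ft_duality[OF h ft_gauss_cis(1)[OF e, of y]] by (simp add: mult.assoc ft_gauss_cis(2)[OF e])

section \<open>The upper half of the Plancherel identity\<close>

lemma cnj_ft:
  assumes [measurable]: "u \<in> borel_measurable borel"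
  shows "cnj (ft u \<omega>) = ft (\<lambda>y. cnj (u (- y))) \<omega>"
proof -
  have "cnj (ft u \<omega>) = (LBINT x. cnj (u x) * cis (\<omega> \<bullet> x))"
    unfolding ft_def Bochner_Integration.integral_cnj[symmetric] by (simp add: cis_cnj)
  also have "\<dots> = (LBINT x. cnj (u (0 - x)) * cis (\<omega> \<bullet> (0 - x)))"
    by (rule lborel_integral_reflect(2)[symmetric]) measurable
  finally show ?thesis by (simp add: ft_def)
qed

text \<open>As \<open>ft u\<close> is only known to be bounded, the Gaussian weight is what makes
  the integrals converge. With the weight, the multiplication formula turns the left side into a
  quadratic form of \<open>u\<close> against \<open>gauss_kernel\<close>, and a symmetric positive
  kernel whose rows have mass \<open>(2 * pi) ^ DIM('a)\<close> has at most that norm on L2.\<close>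

lemma ft_L2_gauss_bound:
  fixes u :: "'a::euclidean_space \<Rightarrow> complex"
  assumes u: "integrable lborel u" and u2: "sq_integrable lborel u" and e: "\<epsilon> > 0"
  shows "(\<integral>\<^sup>+\<omega>. ennreal ((cmod (ft u \<omega>))\<^sup>2 * exp (- (\<epsilon> * (norm \<omega>)\<^sup>2))) \<partial>lborel)
    \<le> ennreal ((2 * pi) ^ DIM('a) * (LBINT x. (cmod (u x))\<^sup>2))"
proof -
  have [measurable]: "u \<in> borel_measurable borel"
    using borel_measurable_integrable[OF u] by auto
  let ?c = "(2 * pi) ^ DIM('a)"
  define A where "A = (LBINT x. (cmod (u x))\<^sup>2)"
  define U where "U = (LBINT x. cmod (u x))"
  define E where "E \<omega> = exp (- (\<epsilon> * (norm \<omega>)\<^sup>2))" for \<omega> :: 'a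
  define K where "K x = complex_of_real (gauss_kernel \<epsilon> x)" for x :: 'a
  define Q where "Q x = complex_of_real ((cmod (u x))\<^sup>2)" for x
  \<comment> \<open>The transform of \<open>w\<close> is the conjugate of \<open>ft u\<close>, so
    \<open>ft w \<omega> * ft u \<omega>\<close> is the squared modulus.\<close>
  define w where "w = (\<lambda>y. cnj (u (- y)))"
  define \<psi> where "\<psi> \<omega> = ft u \<omega> * complex_of_real (E \<omega>)" for \<omega>
  define Hf where "Hf y = (LBINT x. u x * K (y - x))" for y
  have [measurable]: "E \<in> borel_measurable borel" "K \<in> borel_measurable borel" "Q \<in> borel_measurable borel"
     "w \<in> borel_measurable borel"
    unfolding E_def K_def Q_def w_def by measurable
  have [measurable]: "\<psi> \<in> borel_measurable borel" "Hf \<in> borel_measurable borel"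
    unfolding \<psi>_def Hf_def by measurable
  have iE: "integrable lborel E"
    unfolding E_def using gaussian_fourier(1)[OF e] .
  have iK: "integrable lborel K" and sK: "(LBINT x. K x) = ?c"
    unfolding K_def using gauss_kernel_integral[OF e, where 'a = 'a] by auto
  have iQ: "integrable lborel Q" and sQ: "(LBINT x. Q x) = A"
    unfolding Q_def A_def integral_complex_of_real using sq_integrable_norm2[OF u2] by (auto simp del: of_real_power)
  have iw: "integrable lborel w"
    unfolding w_def using lborel_integral_reflect(1)[of "\<lambda>y. cnj (u y)" 0] u by simp
  have i\<psi>: "integrable lborel \<psi>"
  proof (rule Bochner_Integration.integrable_bound)
    show "integrable lborel (\<lambda>\<omega>. U * E \<omega>)" using iE by simp
    show "AE \<omega> in lborel. norm (\<psi> \<omega>) \<le> norm (U * E \<omega>)"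
      using norm_ft_le[of u] unfolding U_def
      by (intro AE_I2) (auto simp: \<psi>_def norm_mult abs_mult E_def intro!: mult_right_mono intro: order_trans[OF _ abs_ge_self])
  qed simp
  have ftpsi: "ft \<psi> x = Hf (- x)" for x
  proof -
    have "ft \<psi> x = (LBINT \<omega>. ft u \<omega> * complex_of_real (exp (- (\<epsilon> * (norm \<omega>)\<^sup>2))) * cis (\<omega> \<bullet> (- x)))"
      unfolding ft_def[of \<psi>] \<psi>_def E_def by (simp add: inner_commute)
    also have "\<dots> = Hf (- x)"
      unfolding Hf_def K_def by (rule ft_gauss_regularised[OF u e])
    finally show ?thesis .
  qed
  have "(LBINT \<omega>. complex_of_real ((cmod (ft u \<omega>))\<^sup>2 * E \<omega>)) = (LBINT \<omega>. ft w \<omega> * \<psi> \<omega>)"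
    by (intro Bochner_Integration.integral_cong refl)
       (simp add: w_def cnj_ft[symmetric] \<psi>_def complex_norm_square mult_ac del: of_real_power)
  also have "\<dots> = (LBINT x. w x * ft \<psi> x)"
    by (rule ft_duality[OF iw i\<psi>])
  also have "\<dots> = (LBINT x. cnj (u (0 - x)) * Hf (0 - x))"
    by (simp add: w_def ftpsi)
  also have "\<dots> = (LBINT y. cnj (u y) * Hf y)"
    by (rule lborel_integral_reflect(2)) measurable
  finally have eq: "(LBINT \<omega>. complex_of_real ((cmod (ft u \<omega>))\<^sup>2 * E \<omega>)) = (LBINT y. cnj (u y) * Hf y)" .
  have iKy: "integrable lborel (\<lambda>x. K (y - x))" and sKy: "(LBINT x. K (y - x)) = ?c" for y
    using lborel_integral_reflect[of K y] iK sK by auto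
  \<comment> \<open>Schur test: \<open>2 |u y| |u x| \<le> |u y|\<^sup>2 + |u x|\<^sup>2\<close>, and the kernel has the same total mass in both variables.\<close>
  have pw: "cmod (cnj (u y) * Hf y) \<le> (?c * (cmod (u y))\<^sup>2 + Re (conv K Q y)) / 2"
    if iKQ: "integrable lborel (\<lambda>x. K (y - x) * Q x)" for y
  proof -
    have iuK: "integrable lborel (\<lambda>x. u x * K (y - x))"
    proof (rule Bochner_Integration.integrable_bound)
      show "integrable lborel (\<lambda>x. (pi / \<epsilon>) powr (DIM('a) / 2) * cmod (u x))" using u by simp
      show "AE x in lborel. norm (u x * K (y - x)) \<le> norm ((pi / \<epsilon>) powr (DIM('a) / 2) * cmod (u x))"
        using gauss_kernel_le[OF e, of "y - x" for x] gauss_kernel_nonneg[of \<epsilon> "y - x" for x]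
        by (intro AE_I2) (auto simp: norm_mult K_def mult.commute[of "cmod _"] intro!: mult_right_mono)
    qed simp
    have "cmod (cnj (u y) * Hf y) \<le> cmod (u y) * (LBINT x. cmod (u x * K (y - x)))"
      unfolding Hf_def norm_mult by (intro mult_mono integral_norm_bound[of lborel "\<lambda>x. u x * K (y - x)", unfolded norm_mult]) auto
    also have "\<dots> = (LBINT x. cmod (u y) * cmod (u x) * cmod (K (y - x)))"
      by (simp add: norm_mult mult.assoc)
    also have "\<dots> \<le> (LBINT x. ((cmod (u y))\<^sup>2 * Re (K (y - x)) + Re (K (y - x) * Q x)) / 2)"
    proof (rule integral_mono)
      show "integrable lborel (\<lambda>x. cmod (u y) * cmod (u x) * cmod (K (y - x)))"
        using integrable_norm[OF iuK] by (simp add: norm_mult mult.assoc)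
      show "integrable lborel (\<lambda>x. ((cmod (u y))\<^sup>2 * Re (K (y - x)) + Re (K (y - x) * Q x)) / 2)"
        using iKQ iKy[of y] by (intro Bochner_Integration.integrable_divide Bochner_Integration.integrable_add integrable_mult_right integrable_Re)
      fix x
      have "cmod (u y) * cmod (u x) \<le> ((cmod (u y))\<^sup>2 + (cmod (u x))\<^sup>2) / 2"
        using sum_squares_bound[of "cmod (u y)" "cmod (u x)"] by simp
      from mult_right_mono[OF this gauss_kernel_nonneg[of \<epsilon> "y - x"]]
      show "cmod (u y) * cmod (u x) * cmod (K (y - x)) \<le> ((cmod (u y))\<^sup>2 * Re (K (y - x)) + Re (K (y - x) * Q x)) / 2"
        using gauss_kernel_nonneg[of \<epsilon> "y - x"] by (simp add: K_def Q_def algebra_simps del: of_real_power)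
    qed
    also have "\<dots> = ((cmod (u y))\<^sup>2 * Re (LBINT x. K (y - x)) + Re (conv K Q y)) / 2"
      unfolding conv_def using iKQ iKy[of y]
      by (simp add: integral_Re[symmetric] integrable_Re del: integral_Re times_complex.simps)
    finally show ?thesis unfolding sKy by (simp add: mult.commute)
  qed
  have iC: "integrable lborel (conv K Q)" by (rule integrable_conv[OF iK iQ])
  \<comment> \<open>The transform at frequency \<open>0\<close> is the integral, so the total mass
    of a convolution is the product of the masses.\<close>
  have sC: "(LBINT y. conv K Q y) = ?c * A"
    using ft_conv[OF iK iQ, of 0] sK sQ by (simp add: ft_def)
  have aeKQ: "AE y in lborel. integrable lborel (\<lambda>x. K (y - x) * Q x)"
    using lborel_pair.AE_integrable_snd[OF integrable_conv_pair[OF iK iQ]] by simp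
  have iB: "integrable lborel (\<lambda>y. (?c * (cmod (u y))\<^sup>2 + Re (conv K Q y)) / 2)"
    using iC sq_integrable_norm2[OF u2] by (intro Bochner_Integration.integrable_divide Bochner_Integration.integrable_add integrable_mult_right integrable_Re)
  have iL: "integrable lborel (\<lambda>\<omega>. (cmod (ft u \<omega>))\<^sup>2 * E \<omega>)"
  proof (rule Bochner_Integration.integrable_bound)
    show "integrable lborel (\<lambda>\<omega>. U\<^sup>2 * E \<omega>)" using iE by simp
    show "AE \<omega> in lborel. norm ((cmod (ft u \<omega>))\<^sup>2 * E \<omega>) \<le> norm (U\<^sup>2 * E \<omega>)"
      using norm_ft_le[of u] unfolding U_def
      by (intro AE_I2) (auto simp: abs_mult E_def intro!: power_mono)
  qed simp
  have "(LBINT \<omega>. (cmod (ft u \<omega>))\<^sup>2 * E \<omega>) = cmod (LBINT y. cnj (u y) * Hf y)"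
    unfolding eq[symmetric] integral_complex_of_real by (simp add: E_def)
  also have "\<dots> \<le> (LBINT y. cmod (cnj (u y) * Hf y))" by (rule integral_norm_bound)
  also have "\<dots> \<le> (LBINT y. (?c * (cmod (u y))\<^sup>2 + Re (conv K Q y)) / 2)"
  proof (rule integral_mono_AE')
    show "AE y in lborel. cmod (cnj (u y) * Hf y) \<le> (?c * (cmod (u y))\<^sup>2 + Re (conv K Q y)) / 2"
      using aeKQ by eventually_elim (rule pw)
    show "AE y in lborel. 0 \<le> (?c * (cmod (u y))\<^sup>2 + Re (conv K Q y)) / 2"
      using aeKQ by eventually_elim (rule order_trans[OF norm_ge_zero pw])
  qed (rule iB)
  also have "\<dots> = (?c * A + Re (LBINT y. conv K Q y)) / 2"
    using iC sq_integrable_norm2[OF u2] unfolding A_def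
    by (simp add: integral_Re[symmetric] integrable_Re del: integral_Re)
  also have "\<dots> = ?c * A" unfolding sC by simp
  finally have le: "(LBINT \<omega>. (cmod (ft u \<omega>))\<^sup>2 * E \<omega>) \<le> ?c * A" .
  have "(\<integral>\<^sup>+\<omega>. ennreal ((cmod (ft u \<omega>))\<^sup>2 * E \<omega>) \<partial>lborel) = ennreal (LBINT \<omega>. (cmod (ft u \<omega>))\<^sup>2 * E \<omega>)"
    by (rule nn_integral_eq_integral[OF iL]) (auto simp: E_def)
  also have "\<dots> \<le> ennreal (?c * A)" by (rule ennreal_leI[OF le])
  finally show ?thesis unfolding E_def A_def .
qed

text \<open>The Gaussian weight tends to \<open>1\<close> and Fatou applies. The later use is to see
  that transforms are square-integrable and that L2 convergence passes through \<open>ft\<close>,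
  for which the inequality is enough.\<close>

lemma ft_L2_bound:
  fixes u :: "'a::euclidean_space \<Rightarrow> complex"
  assumes u: "integrable lborel u" and u2: "sq_integrable lborel u"
  shows "sq_integrable lborel (ft u)"
    and "(LBINT \<omega>. (cmod (ft u \<omega>))\<^sup>2) \<le> (2 * pi) ^ DIM('a) * (LBINT x. (cmod (u x))\<^sup>2)"
proof -
  have [measurable]: "u \<in> borel_measurable borel"
    using borel_measurable_integrable[OF u] by auto
  let ?C = "(2 * pi) ^ DIM('a) * (LBINT x. (cmod (u x))\<^sup>2)"
  define f where "f n \<omega> = ennreal ((cmod (ft u \<omega>))\<^sup>2 * exp (- (inverse (real (Suc n)) * (norm \<omega>)\<^sup>2)))" for n \<omega>
  have [measurable]: "f n \<in> borel_measurable lborel" for n unfolding f_def by measurable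
  have "(\<integral>\<^sup>+\<omega>. ennreal ((cmod (ft u \<omega>))\<^sup>2) \<partial>lborel) = (\<integral>\<^sup>+\<omega>. liminf (\<lambda>n. f n \<omega>) \<partial>lborel)"
  proof (intro nn_integral_cong)
    fix \<omega> :: 'a
    have "(\<lambda>n. f n \<omega>) \<longlonglongrightarrow> ennreal ((cmod (ft u \<omega>))\<^sup>2 * exp (- (0 * (norm \<omega>)\<^sup>2)))"
      unfolding f_def by (intro tendsto_intros LIMSEQ_inverse_real_of_nat)
    from lim_imp_Liminf[OF _ this] show "ennreal ((cmod (ft u \<omega>))\<^sup>2) = liminf (\<lambda>n. f n \<omega>)" by simp
  qed
  also have "\<dots> \<le> liminf (\<lambda>n. \<integral>\<^sup>+\<omega>. f n \<omega> \<partial>lborel)"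
    by (rule nn_integral_liminf) simp
  also have "\<dots> \<le> liminf (\<lambda>n::nat. ennreal ?C)"
    unfolding f_def by (intro Liminf_mono always_eventually allI ft_L2_gauss_bound[OF u u2]) simp
  also have "\<dots> = ennreal ?C" by (simp add: Liminf_const)
  finally have le: "(\<integral>\<^sup>+\<omega>. ennreal ((cmod (ft u \<omega>))\<^sup>2) \<partial>lborel) \<le> ennreal ?C" .
  have i: "integrable lborel (\<lambda>\<omega>. (cmod (ft u \<omega>))\<^sup>2)"
    using le by (intro integrableI_bounded) (auto intro: le_less_trans)
  thus "sq_integrable lborel (ft u)" by (simp add: sq_integrable_def)
  show "(LBINT \<omega>. (cmod (ft u \<omega>))\<^sup>2) \<le> ?C"
    using le by (subst (asm) nn_integral_eq_integral[OF i]) auto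
qed

section \<open>Inversion and uniqueness\<close>

lemma gauss_kernel_scale:
  assumes c: "c > 0"
  shows "c ^ DIM('a) * gauss_kernel (c\<^sup>2) (c *\<^sub>R (z::'a::euclidean_space)) = gauss_kernel 1 z"
proof -
  have "c ^ DIM('a) * (pi / c\<^sup>2) powr (DIM('a) / 2) = pi powr (DIM('a) / 2)"
  proof -
    have "c ^ DIM('a) = (c powr 2) powr (DIM('a) / 2)"
      using c by (simp add: powr_powr powr_realpow del: powr_numeral)
    also have "\<dots> = (c\<^sup>2) powr (DIM('a) / 2)" using c by simp
    finally show ?thesis using c by (simp add: powr_divide)
  qed
  thus ?thesis using c by (simp add: gauss_kernel_def power_mult_distrib mult.assoc[symmetric])
qed

text \<open>The parameter is a square so that the substitution
  \<open>x = y - c n *\<^sub>R z\<close> with \<open>c n = 1 / (n + 1)\<close> turns the moving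
  kernel into the fixed \<open>gauss_kernel 1\<close>; dominated convergence then rests on the
  boundedness of \<open>k\<close> and its continuity at \<open>y\<close>. The factor in the limit is
  the total mass of the kernel.\<close>

lemma gauss_kernel_approx_identity:
  fixes k :: "'a::euclidean_space \<Rightarrow> complex"
  assumes [measurable]: "k \<in> borel_measurable borel" and b: "\<And>x. cmod (k x) \<le> B" and cont: "isCont k y"
  shows "(\<lambda>n. \<integral>x. k x * complex_of_real (gauss_kernel ((inverse (real (Suc n)))\<^sup>2) (y - x)) \<partial>lborel)
    \<longlonglongrightarrow> (2 * pi) ^ DIM('a) * k y"
proof -
  define c where "c n = inverse (real (Suc n))" for n
  have c0: "c n > 0" for n by (simp add: c_def)
  have clim: "c \<longlonglongrightarrow> 0" unfolding c_def by (rule LIMSEQ_inverse_real_of_nat)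
  have eq: "(LBINT x. k x * complex_of_real (gauss_kernel ((c n)\<^sup>2) (y - x)))
     = (LBINT z. k (y - c n *\<^sub>R z) * complex_of_real (gauss_kernel 1 z))" for n
  proof -
    have "(LBINT x. k x * complex_of_real (gauss_kernel ((c n)\<^sup>2) (y - x)))
      = \<bar>- c n\<bar> ^ DIM('a) *\<^sub>R (LBINT z. k (y + (- c n) *\<^sub>R z) * complex_of_real (gauss_kernel ((c n)\<^sup>2) (y - (y + (- c n) *\<^sub>R z))))"
      using c0[of n] by (intro lborel_integral_affine(2)) auto
    also have "\<dots> = (LBINT z. k (y - c n *\<^sub>R z) * complex_of_real (c n ^ DIM('a) * gauss_kernel ((c n)\<^sup>2) (c n *\<^sub>R z)))"
      using c0[of n] by (subst integral_scaleR_right[symmetric]) (simp add: scaleR_conv_of_real mult_ac)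
    finally show ?thesis unfolding gauss_kernel_scale[OF c0] .
  qed
  have "(\<lambda>n. \<integral>z. k (y - c n *\<^sub>R z) * complex_of_real (gauss_kernel 1 z) \<partial>lborel)
     \<longlonglongrightarrow> (LBINT z. k y * complex_of_real (gauss_kernel 1 (z::'a)))"
  proof (rule integral_dominated_convergence[where w = "\<lambda>z. B * gauss_kernel 1 z"])
    show "integrable lborel (\<lambda>z::'a. B * gauss_kernel 1 z)"
      using gauss_kernel_integral(1)[of 1, where 'a = 'a] by simp
    show "AE z in lborel. norm (k (y - c n *\<^sub>R z) * complex_of_real (gauss_kernel 1 z)) \<le> B * gauss_kernel 1 z" for n
      using b gauss_kernel_nonneg[of 1, where 'a = 'a] by (auto simp: norm_mult intro!: mult_right_mono)
    show "AE z in lborel. (\<lambda>n. k (y - c n *\<^sub>R z) * complex_of_real (gauss_kernel 1 z)) \<longlonglongrightarrow> k y * complex_of_real (gauss_kernel 1 z)"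
    proof (rule AE_I2)
      fix z :: 'a
      have "(\<lambda>n. y - c n *\<^sub>R z) \<longlonglongrightarrow> y - 0 *\<^sub>R z" by (intro tendsto_intros clim)
      hence "(\<lambda>n. k (y - c n *\<^sub>R z)) \<longlonglongrightarrow> k y"
        using isCont_tendsto_compose[OF cont] by simp
      thus "(\<lambda>n. k (y - c n *\<^sub>R z) * complex_of_real (gauss_kernel 1 z)) \<longlonglongrightarrow> k y * complex_of_real (gauss_kernel 1 z)"
        by (intro tendsto_intros)
    qed
  qed auto
  thus ?thesis
    unfolding c_def[symmetric] eq using gauss_kernel_integral(2)[of 1, where 'a = 'a] by (simp add: mult.commute)
qed

text \<open>The damped inversion integral has two limits: one by dominated convergence on the
  frequency side, the other by the approximate identity on the space side.\<close>

lemma ft_inversion: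
  fixes u :: "'a::euclidean_space \<Rightarrow> complex"
  assumes u: "integrable lborel u" and b: "\<And>x. cmod (u x) \<le> B" and cont: "isCont u y"
    and fu: "integrable lborel (ft u)"
  shows "(LBINT \<omega>. ft u \<omega> * cis (\<omega> \<bullet> y)) = (2 * pi) ^ DIM('a) * u y"
proof -
  have [measurable]: "u \<in> borel_measurable borel"
    using borel_measurable_integrable[OF u] by auto
  define \<epsilon> where "\<epsilon> n = (inverse (real (Suc n)))\<^sup>2" for n
  have e: "\<epsilon> n > 0" for n by (simp add: \<epsilon>_def)
  have elim: "\<epsilon> \<longlonglongrightarrow> 0"
    unfolding \<epsilon>_def using tendsto_power[OF LIMSEQ_inverse_real_of_nat, of 2] by simp
  have "(\<lambda>n. \<integral>\<omega>. ft u \<omega> * complex_of_real (exp (- (\<epsilon> n * (norm \<omega>)\<^sup>2))) * cis (\<omega> \<bullet> y) \<partial>lborel)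
     \<longlonglongrightarrow> (LBINT \<omega>. ft u \<omega> * cis (\<omega> \<bullet> y))"
  proof (rule integral_dominated_convergence[where w = "\<lambda>\<omega>. cmod (ft u \<omega>)"])
    show "integrable lborel (\<lambda>\<omega>. cmod (ft u \<omega>))" using fu by simp
    show "AE \<omega> in lborel. norm (ft u \<omega> * complex_of_real (exp (- (\<epsilon> n * (norm \<omega>)\<^sup>2))) * cis (\<omega> \<bullet> y)) \<le> cmod (ft u \<omega>)" for n
      using e[of n] by (intro AE_I2) (auto simp: norm_mult intro!: mult_left_le)
    show "AE \<omega> in lborel. (\<lambda>n. ft u \<omega> * complex_of_real (exp (- (\<epsilon> n * (norm \<omega>)\<^sup>2))) * cis (\<omega> \<bullet> y)) \<longlonglongrightarrow> ft u \<omega> * cis (\<omega> \<bullet> y)"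
    proof (rule AE_I2)
      fix \<omega> :: 'a
      have "(\<lambda>n. ft u \<omega> * complex_of_real (exp (- (\<epsilon> n * (norm \<omega>)\<^sup>2))) * cis (\<omega> \<bullet> y))
         \<longlonglongrightarrow> ft u \<omega> * complex_of_real (exp (- (0 * (norm \<omega>)\<^sup>2))) * cis (\<omega> \<bullet> y)"
        by (intro tendsto_intros elim)
      thus "(\<lambda>n. ft u \<omega> * complex_of_real (exp (- (\<epsilon> n * (norm \<omega>)\<^sup>2))) * cis (\<omega> \<bullet> y)) \<longlonglongrightarrow> ft u \<omega> * cis (\<omega> \<bullet> y)"
        by simp
    qed
  qed measurable
  moreover have "(\<lambda>n. \<integral>\<omega>. ft u \<omega> * complex_of_real (exp (- (\<epsilon> n * (norm \<omega>)\<^sup>2))) * cis (\<omega> \<bullet> y) \<partial>lborel)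
     \<longlonglongrightarrow> (2 * pi) ^ DIM('a) * u y"
    unfolding ft_gauss_regularised[OF u e] unfolding \<epsilon>_def
    by (rule gauss_kernel_approx_identity[OF _ b cont]) simp
  ultimately show ?thesis by (rule LIMSEQ_unique)
qed

text \<open>Open boxes form an intersection-stable generator of the Borel sets, so the vanishing
  spreads to all Borel sets by induction over complements and disjoint unions.\<close>

lemma AE_zero_if_box_integrals_zero:
  fixes h :: "'a::euclidean_space \<Rightarrow> complex"
  assumes h: "integrable lborel h"
    and z: "\<And>a b. (LBINT x. indicator (box a b) x *\<^sub>R h x) = 0"
  shows "AE x in lborel. h x = 0"
proof (rule sigma_finite_measure.density_zero[OF sigma_finite_lborel h])
  have [measurable]: "h \<in> borel_measurable borel"
    using borel_measurable_integrable[OF h] by auto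
  have si: "set_integrable lborel A h" if "A \<in> sets borel" for A
    unfolding set_integrable_def using that h by (intro integrable_mult_indicator) auto
  \<comment> \<open>Complements need the integral over the whole space, which is exhausted by
    growing boxes.\<close>
  have tot: "(LBINT x. h x) = 0"
  proof -
    have "(\<lambda>n. \<integral>x. indicator (box (- real n *\<^sub>R One) (real n *\<^sub>R One)) x *\<^sub>R h x \<partial>lborel) \<longlonglongrightarrow> (LBINT x. h x)"
    proof (rule integral_dominated_convergence[where w = "\<lambda>x. cmod (h x)"])
      show "AE x in lborel. (\<lambda>n. indicator (box (- real n *\<^sub>R One) (real n *\<^sub>R One)) x *\<^sub>R h x) \<longlonglongrightarrow> h x"
      proof (rule AE_I2)
        fix x :: 'a
        obtain N :: nat where N: "norm x < real N" using reals_Archimedean2 by blast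
        have "x \<in> box (- real n *\<^sub>R One) (real n *\<^sub>R One)" if "n \<ge> N" for n
        proof -
          have "\<bar>x \<bullet> i\<bar> < real n" if "i \<in> Basis" for i
            using Basis_le_norm[OF that, of x] N \<open>n \<ge> N\<close> by linarith
          thus ?thesis by (auto simp: mem_box abs_less_iff) (metis minus_less_iff)
        qed
        hence "\<forall>\<^sub>F n in sequentially. indicator (box (- real n *\<^sub>R One) (real n *\<^sub>R One)) x *\<^sub>R h x = h x"
          by (intro eventually_sequentiallyI[of N]) auto
        thus "(\<lambda>n. indicator (box (- real n *\<^sub>R One) (real n *\<^sub>R One)) x *\<^sub>R h x) \<longlonglongrightarrow> h x"
          by (rule tendsto_eventually)
      qed
    qed (use h in \<open>auto split: split_indicator\<close>)
    thus ?thesis unfolding z by (simp add: LIMSEQ_const_iff)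
  qed
  fix A :: "'a set" assume "A \<in> sets lborel"
  hence A: "A \<in> sigma_sets UNIV (range (\<lambda>(a, b). box a b))"
    by (simp add: borel_eq_box)
  have "Int_stable (range (\<lambda>(a, b). box a b :: 'a set))"
    by (auto simp: Int_stable_def box_Int_box)
  moreover have "range (\<lambda>(a, b). box a b :: 'a set) \<subseteq> Pow UNIV" by simp
  ultimately show "set_lebesgue_integral lborel A h = 0"
    using A
  proof (induction A rule: sigma_sets_induct_disjoint)
    case (basic A) thus ?case using z by (auto simp: set_lebesgue_integral_def)
  next
    case empty thus ?case by (simp add: set_lebesgue_integral_def)
  next
    case (compl A)
    hence A: "A \<in> sets borel" by (simp add: borel_eq_box)
    have "(LBINT x. h x) = set_lebesgue_integral lborel (A \<union> (UNIV - A)) h"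
      by (simp add: set_lebesgue_integral_def)
    also have "\<dots> = set_lebesgue_integral lborel A h + set_lebesgue_integral lborel (UNIV - A) h"
      using A by (intro set_integral_Un si) auto
    finally show ?case using compl tot by simp
  next
    case (union A)
    hence A: "A i \<in> sets borel" for i by (auto simp: borel_eq_box)
    have "set_lebesgue_integral lborel (\<Union>i. A i) h = (\<Sum>i. set_lebesgue_integral lborel (A i) h)"
      using A union(1) by (intro lebesgue_integral_countable_add si) (auto simp: disjoint_family_on_def)
    thus ?case using union by simp
  qed
qed

lemma AE_not_in_frontier_box: "AE x in lborel. x \<notin> frontier (box a b :: 'a::euclidean_space set)"
proof -
  have "frontier (box a b :: 'a set) \<in> null_sets lborel"
    using negligible_convex_frontier[OF convex_box(2), of a b]
    by (auto simp: null_sets_completion_iff negligible_iff_null_sets)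
  thus ?thesis by (rule AE_not_in)
qed

text \<open>If \<open>ft h\<close> vanishes, so do the Gaussian smoothings of \<open>h\<close>.
  Moving the smoothing from \<open>h\<close> onto the indicator of a box and shrinking its width
  gives zero integrals over boxes; the indicator is discontinuous only on the frontier, a null
  set.\<close>

lemma ft_injective:
  fixes h :: "'a::euclidean_space \<Rightarrow> complex"
  assumes h: "integrable lborel h" and z: "\<And>\<omega>. ft h \<omega> = 0"
  shows "AE x in lborel. h x = 0"
proof (rule AE_zero_if_box_integrals_zero[OF h])
  have [measurable]: "h \<in> borel_measurable borel"
    using borel_measurable_integrable[OF h] by auto
  fix a b :: 'a
  define k where "k x = complex_of_real (indicator (box a b) x)" for x
  have [measurable]: "k \<in> borel_measurable borel" unfolding k_def by measurable
  have ik: "integrable lborel k"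
    unfolding k_def by (auto intro!: integrable_real_indicator emeasure_lborel_box_finite)
  have kb: "cmod (k x) \<le> 1" for x by (simp add: k_def)
  define \<epsilon> where "\<epsilon> n = (inverse (real (Suc n)))\<^sup>2" for n
  have e: "\<epsilon> n > 0" for n by (simp add: \<epsilon>_def)
  define G where "G n x = (LBINT y. k y * complex_of_real (gauss_kernel (\<epsilon> n) (x - y)))" for n x
  have Gm [measurable]: "G n \<in> borel_measurable borel" for n
    unfolding G_def by measurable
  have gksym: "gauss_kernel e (x - y) = gauss_kernel e (y - x)" for e and x y :: 'a
    by (simp add: gauss_kernel_def norm_minus_commute)
  have hG: "(LBINT x. h x * G n x) = 0" for n
  proof -
    have i: "integrable (lborel \<Otimes>\<^sub>M lborel) (\<lambda>(x, y). h x * k y * complex_of_real (gauss_kernel (\<epsilon> n) (x - y)))"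
      using gauss_kernel_le[OF e[of n], where 'a = 'a] gauss_kernel_nonneg[of "\<epsilon> n", where 'a = 'a]
      by (intro integrable_pair_mult_bounded[OF h ik, where B = "(pi / \<epsilon> n) powr (DIM('a) / 2)"]) auto
    have "(LBINT x. h x * G n x) = (LBINT x. (LBINT y. h x * k y * complex_of_real (gauss_kernel (\<epsilon> n) (x - y))))"
      by (simp add: G_def mult.assoc)
    also have "\<dots> = (LBINT y. (LBINT x. h x * k y * complex_of_real (gauss_kernel (\<epsilon> n) (x - y))))"
      using lborel_pair.Fubini_integral[OF i] by simp
    also have "\<dots> = (LBINT y. k y * (LBINT x. h x * complex_of_real (gauss_kernel (\<epsilon> n) (y - x))))"
      by (subst integral_mult_right_zero[symmetric]) (simp add: gksym mult_ac)
    also have "\<dots> = 0"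
      unfolding ft_gauss_regularised[OF h e, symmetric] by (simp add: z)
    finally show ?thesis .
  qed
  have Gb: "cmod (G n x) \<le> (2 * pi) ^ DIM('a)" for n x
  proof -
    have i: "integrable lborel (\<lambda>y. gauss_kernel (\<epsilon> n) (x - y))"
      using lborel_integral_reflect(1)[of "gauss_kernel (\<epsilon> n)" x] gauss_kernel_integral(1)[OF e, where 'a = 'a] by simp
    have "cmod (G n x) \<le> (LBINT y. cmod (k y * complex_of_real (gauss_kernel (\<epsilon> n) (x - y))))"
      unfolding G_def by (rule integral_norm_bound)
    also have "\<dots> \<le> (LBINT y. gauss_kernel (\<epsilon> n) (x - y))"
      using i kb gauss_kernel_nonneg[of "\<epsilon> n" "x - y" for y]
      by (intro integral_mono_AE') (auto simp: norm_mult intro!: mult_left_le_one_le)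
    also have "\<dots> = (2 * pi) ^ DIM('a)"
      using lborel_integral_reflect(2)[of "gauss_kernel (\<epsilon> n)" x] gauss_kernel_integral(2)[OF e, where 'a = 'a] by simp
    finally show ?thesis .
  qed
  have "(\<lambda>n. \<integral>x. h x * G n x \<partial>lborel) \<longlonglongrightarrow> (LBINT x. h x * ((2 * pi) ^ DIM('a) * k x))"
  proof (rule integral_dominated_convergence[where w = "\<lambda>x. (2 * pi) ^ DIM('a) * cmod (h x)"])
    show "AE x in lborel. (\<lambda>n. h x * G n x) \<longlonglongrightarrow> h x * ((2 * pi) ^ DIM('a) * k x)"
      using AE_not_in_frontier_box[of a b]
    proof eventually_elim
      case (elim x)
      hence "isCont k x"
        unfolding k_def using isCont_indicator[of x "box a b"] by (auto intro!: continuous_intros)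
      hence "(\<lambda>n. G n x) \<longlonglongrightarrow> (2 * pi) ^ DIM('a) * k x"
        unfolding G_def \<epsilon>_def by (intro gauss_kernel_approx_identity[OF _ kb]) auto
      thus ?case by (intro tendsto_intros)
    qed
    show "AE x in lborel. norm (h x * G n x) \<le> (2 * pi) ^ DIM('a) * cmod (h x)" for n
    proof (rule AE_I2)
      fix x show "norm (h x * G n x) \<le> (2 * pi) ^ DIM('a) * cmod (h x)"
        using mult_left_mono[OF Gb[of n x], of "cmod (h x)"] by (simp only: norm_mult mult.commute) simp
    qed
  qed (use h in auto)
  hence "(LBINT x. h x * ((2 * pi) ^ DIM('a) * k x)) = 0"
    unfolding hG by (simp add: LIMSEQ_const_iff)
  moreover have "(LBINT x. h x * ((2 * pi) ^ DIM('a) * k x)) = (2 * pi) ^ DIM('a) * (LBINT x. indicator (box a b) x *\<^sub>R h x)"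
    unfolding integral_mult_right_zero[symmetric]
    by (intro Bochner_Integration.integral_cong) (auto simp: k_def scaleR_conv_of_real)
  ultimately show "(LBINT x. indicator (box a b) x *\<^sub>R h x) = 0" by simp
qed

text \<open>The L2 Fourier transform of \<open>p\<close>, obtained as the L2 limit of the transforms
  of truncations. It is recorded through the multiplication formula, which is how \<open>V\<close>
  enters the later arguments.\<close>

lemma L2_fourier_transform_exists:
  fixes p :: "'a::euclidean_space \<Rightarrow> complex"
  assumes p: "sq_integrable lborel p"
  obtains V where "sq_integrable lborel V"
    "\<And>\<psi>. integrable lborel \<psi> \<Longrightarrow> sq_integrable lborel \<psi> \<Longrightarrow>
       (LBINT x. V x * \<psi> x) = (LBINT \<omega>. p \<omega> * ft \<psi> \<omega>)"
proof -
  have [measurable]: "p \<in> borel_measurable borel"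
    using sq_integrable_measurable[OF p] by simp
  have [measurable]: "ball (0::'a) r \<in> sets borel" for r by simp
  define P where "P n x = indicator (ball 0 (real n)) x *\<^sub>R p x" for n x
  have [measurable]: "P n \<in> borel_measurable borel" for n unfolding P_def by measurable
  have P2: "sq_integrable lborel (P n)" for n
    by (rule sq_integrable_bound[OF p, where C = 1]) (simp, auto simp: P_def split: split_indicator)
  have P1: "integrable lborel (P n)" for n
  proof -
    have "integrable lborel (\<lambda>x::'a. complex_of_real (indicator (ball 0 (real n)) x))"
      using emeasure_lborel_ball_finite[of "0::'a" "real n"] by simp
    hence "sq_integrable lborel (\<lambda>x::'a. complex_of_real (indicator (ball 0 (real n)) x))"
      by (rule sq_integrable_if_bounded[where B = 1]) auto
    from sq_integrable_mult_integrable[OF this p] show ?thesis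
      by (simp add: P_def[abs_def] scaleR_conv_of_real)
  qed
  have Plim: "(\<lambda>n. \<integral>x. (cmod (P n x - p x))\<^sup>2 \<partial>lborel) \<longlonglongrightarrow> 0"
  proof -
    have "(\<lambda>n. \<integral>x. (cmod (P n x - p x))\<^sup>2 \<partial>lborel) \<longlonglongrightarrow> (\<integral>x. 0 \<partial>(lborel :: 'a measure))"
    proof (rule integral_dominated_convergence[where w = "\<lambda>x. (cmod (p x))\<^sup>2"])
      show "AE x in lborel. (\<lambda>n. (cmod (P n x - p x))\<^sup>2) \<longlonglongrightarrow> 0"
      proof (rule AE_I2)
        fix x :: 'a
        obtain N :: nat where N: "norm x < real N" using reals_Archimedean2 by blast
        have "\<forall>\<^sub>F n in sequentially. (cmod (P n x - p x))\<^sup>2 = 0"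
          using N by (intro eventually_sequentiallyI[of N]) (auto simp: P_def)
        thus "(\<lambda>n. (cmod (P n x - p x))\<^sup>2) \<longlonglongrightarrow> 0" by (rule tendsto_eventually)
      qed
      show "AE x in lborel. norm ((cmod (P n x - p x))\<^sup>2) \<le> (cmod (p x))\<^sup>2" for n
        by (intro AE_I2) (auto simp: P_def split: split_indicator)
    qed (use sq_integrable_norm2[OF p] in auto)
    thus ?thesis by simp
  qed
  let ?c = "(2 * pi) ^ DIM('a)"
  have V2: "sq_integrable lborel (ft (P n))" for n by (rule ft_L2_bound(1)[OF P1 P2])
  have Vdiff: "(LBINT x. (cmod (ft (P m) x - ft (P n) x))\<^sup>2)
      \<le> ?c * (2 * (LBINT x. (cmod (P m x - p x))\<^sup>2) + 2 * (LBINT x. (cmod (P n x - p x))\<^sup>2))" for m n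
  proof -
    have "(LBINT x. (cmod (ft (P m) x - ft (P n) x))\<^sup>2) = (LBINT x. (cmod (ft (\<lambda>x. P m x - P n x) x))\<^sup>2)"
      by (simp add: ft_diff P1)
    also have "\<dots> \<le> ?c * (LBINT x. (cmod (P m x - P n x))\<^sup>2)"
      by (rule ft_L2_bound(2)) (auto intro: P1 P2 sq_integrable_diff)
    also have "(LBINT x. (cmod (P m x - P n x))\<^sup>2)
        \<le> (LBINT x. 2 * (cmod (P m x - p x))\<^sup>2 + 2 * (cmod (P n x - p x))\<^sup>2)"
    proof (rule integral_mono)
      fix x
      have "cmod (P m x - P n x) \<le> cmod (P m x - p x) + cmod (P n x - p x)"
        using norm_triangle_ineq4[of "P m x - p x" "P n x - p x"] by simp
      hence "(cmod (P m x - P n x))\<^sup>2 \<le> (cmod (P m x - p x) + cmod (P n x - p x))\<^sup>2"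
        by (intro power_mono) auto
      also have "\<dots> \<le> 2 * (cmod (P m x - p x))\<^sup>2 + 2 * (cmod (P n x - p x))\<^sup>2"
        using sum_squares_bound[of "cmod (P m x - p x)" "cmod (P n x - p x)"] by (simp add: power2_sum)
      finally show "(cmod (P m x - P n x))\<^sup>2 \<le> 2 * (cmod (P m x - p x))\<^sup>2 + 2 * (cmod (P n x - p x))\<^sup>2" .
    qed (auto intro!: sq_integrable_norm2 sq_integrable_diff P2 p)
    also have "\<dots> = 2 * (LBINT x. (cmod (P m x - p x))\<^sup>2) + 2 * (LBINT x. (cmod (P n x - p x))\<^sup>2)"
      by (subst Bochner_Integration.integral_add) (auto intro!: sq_integrable_norm2 sq_integrable_diff P2 p)
    finally show ?thesis by simp
  qed
  obtain V where V: "sq_integrable lborel V" and Vlim: "(\<lambda>n. \<integral>x. (cmod (ft (P n) x - V x))\<^sup>2 \<partial>lborel) \<longlonglongrightarrow> 0"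
  proof (rule L2_complete[of lborel "\<lambda>n. ft (P n)"])
    show "sq_integrable lborel (ft (P n))" for n by (rule V2)
    fix e :: real assume e: "e > 0"
    have c: "?c > 0" by simp
    obtain N where N: "\<And>n. n \<ge> N \<Longrightarrow> (LBINT x. (cmod (P n x - p x))\<^sup>2) < e / (4 * ?c)"
      using order_tendstoD(2)[OF Plim, of "e / (4 * ?c)"] e c by (auto simp: eventually_sequentially)
    show "\<exists>N. \<forall>m\<ge>N. \<forall>n\<ge>N. (LBINT x. (cmod (ft (P m) x - ft (P n) x))\<^sup>2) < e"
    proof (intro exI[of _ N] allI impI)
      fix m n assume "m \<ge> N" "n \<ge> N"
      from N[OF this(1)] N[OF this(2)]
      have "2 * (LBINT x. (cmod (P m x - p x))\<^sup>2) + 2 * (LBINT x. (cmod (P n x - p x))\<^sup>2) < 4 * (e / (4 * ?c))"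
        by linarith
      hence "?c * (2 * (LBINT x. (cmod (P m x - p x))\<^sup>2) + 2 * (LBINT x. (cmod (P n x - p x))\<^sup>2)) < ?c * (4 * (e / (4 * ?c)))"
        using c by (rule mult_strict_left_mono)
      also have "\<dots> = e" using c by (simp add: field_simps)
      finally show "(LBINT x. (cmod (ft (P m) x - ft (P n) x))\<^sup>2) < e"
        using Vdiff[of m n] by linarith
    qed
  qed auto
  show ?thesis
  proof (rule that[OF V])
    fix \<psi> :: "'a \<Rightarrow> complex" assume psi: "integrable lborel \<psi>" "sq_integrable lborel \<psi>"
    have "(\<lambda>n. \<integral>x. ft (P n) x * \<psi> x \<partial>lborel) \<longlonglongrightarrow> (LBINT x. V x * \<psi> x)"
      by (rule tendsto_integral_L2[OF V2 V psi(2) Vlim])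
    moreover have "(\<lambda>n. \<integral>x. P n x * ft \<psi> x \<partial>lborel) \<longlonglongrightarrow> (LBINT x. p x * ft \<psi> x)"
      by (rule tendsto_integral_L2[OF P2 p ft_L2_bound(1)[OF psi] Plim])
    ultimately show "(LBINT x. V x * \<psi> x) = (LBINT \<omega>. p \<omega> * ft \<psi> \<omega>)"
      unfolding ft_duality[OF P1 psi(1)] by (rule LIMSEQ_unique)
  qed
qed

section \<open>Gaussian mixtures and the Matern spectrum\<close>

text \<open>Fubini over the mixing parameter \<open>s\<close>; hypothesis \<open>i\<close> says that
  the L1 norms of the weighted Gaussians have a finite integral. Positivity of \<open>a s\<close> is
  asked only where \<open>w s \<noteq> 0\<close> because the mixing weights to which this is applied
  vanish for nonpositive \<open>s\<close>.\<close>

lemma gaussian_mixture_ft: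
  fixes w a :: "real \<Rightarrow> real"
  assumes [measurable]: "w \<in> borel_measurable borel" "a \<in> borel_measurable borel"
    and w: "\<And>s. w s \<ge> 0" and a: "\<And>s. w s \<noteq> 0 \<Longrightarrow> a s > 0"
    and i: "integrable lborel (\<lambda>s. w s * (pi / a s) powr (DIM('a) / 2))"
  defines "F \<equiv> \<lambda>x::'a::euclidean_space. \<integral>s. w s * exp (- (a s * (norm x)\<^sup>2)) \<partial>lborel"
  shows "integrable lborel F"
    and "ft (\<lambda>x. complex_of_real (F x)) \<omega>
         = complex_of_real (LBINT s. w s * (pi / a s) powr (DIM('a) / 2) * exp (- ((norm \<omega>)\<^sup>2 / (4 * a s))))"
proof -
  define f where "f s x = complex_of_real (w s * exp (- (a s * (norm x)\<^sup>2)))" for s and x :: 'a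
  have [measurable]: "case_prod f \<in> borel_measurable (lborel \<Otimes>\<^sub>M lborel)"
    unfolding f_def by measurable
  have inner: "integrable lborel (f s)" for s
  proof (cases "w s = 0")
    case False
    thus ?thesis unfolding f_def using gaussian_fourier(1)[OF a[of s], where 'a = 'a] by simp
  qed (simp add: f_def[abs_def])
  have ft_inner: "(LBINT x. f s x * cis (- (\<omega> \<bullet> x)))
      = complex_of_real (w s * (pi / a s) powr (DIM('a) / 2) * exp (- ((norm \<omega>)\<^sup>2 / (4 * a s))))" for s \<omega>
  proof (cases "w s = 0")
    case False
    have "(LBINT x. f s x * cis (- (\<omega> \<bullet> x)))
      = complex_of_real (w s) * (LBINT x. complex_of_real (exp (- (a s * (norm x)\<^sup>2))) * cis ((- \<omega>) \<bullet> x))"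
      by (simp add: f_def mult.assoc)
    thus ?thesis unfolding gaussian_fourier(2)[OF a[OF False]] by (simp add: mult.assoc)
  qed (simp add: f_def)
  \<comment> \<open>For a nonnegative function the L1 norm is the transform at
    \<open>0\<close>.\<close>
  have nrm: "(LBINT x. cmod (f s x)) = w s * (pi / a s) powr (DIM('a) / 2)" for s
  proof -
    have "complex_of_real (LBINT x. cmod (f s x)) = (LBINT x. f s x * cis (- (0 \<bullet> x)))"
      using w[of s] unfolding integral_complex_of_real[symmetric] by (simp add: f_def norm_mult)
    also note ft_inner[of s 0]
    finally show ?thesis unfolding of_real_eq_iff by simp
  qed
  have ip: "integrable (lborel \<Otimes>\<^sub>M lborel) (\<lambda>(s, x). f s x)"
  proof (rule lborel_pair.Fubini_integrable)
    show "integrable lborel (\<lambda>s. \<integral>x. norm (case (s, x) of (s, x) \<Rightarrow> f s x) \<partial>lborel)"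
      using i by (simp add: nrm)
  qed (use inner in auto)
  have Ff: "complex_of_real (F x) = (LBINT s. f s x)" for x
    unfolding F_def f_def integral_complex_of_real ..
  have "integrable lborel (\<lambda>x. \<integral>s. f s x \<partial>lborel)"
    using lborel_pair.integrable_snd[OF ip] by simp
  hence "integrable lborel (\<lambda>x. complex_of_real (F x))" by (simp add: Ff)
  thus "integrable lborel F" by (simp only: complex_of_real_integrable_eq)
  have ip2: "integrable (lborel \<Otimes>\<^sub>M lborel) (\<lambda>(s, x). f s x * cis (- (\<omega> \<bullet> x)))"
    by (rule Bochner_Integration.integrable_bound[OF ip]) (auto simp: norm_mult)
  have "ft (\<lambda>x. complex_of_real (F x)) \<omega> = (LBINT x. (LBINT s. f s x * cis (- (\<omega> \<bullet> x))))"
    unfolding ft_def Ff by simp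
  also have "\<dots> = (LBINT s. (LBINT x. f s x * cis (- (\<omega> \<bullet> x))))"
    using lborel_pair.Fubini_integral[OF ip2] by simp
  also have "\<dots> = complex_of_real (LBINT s. w s * (pi / a s) powr (DIM('a) / 2) * exp (- ((norm \<omega>)\<^sup>2 / (4 * a s))))"
    unfolding ft_inner integral_complex_of_real ..
  finally show "ft (\<lambda>x. complex_of_real (F x)) \<omega>
         = complex_of_real (LBINT s. w s * (pi / a s) powr (DIM('a) / 2) * exp (- ((norm \<omega>)\<^sup>2 / (4 * a s))))" .
qed

section \<open>Gamma mixtures, the Bessel function and the Matern spectrum\<close>

lemma Gamma_lborel_integral:
  fixes z l :: real
  assumes z: "z > 0" and l: "l > 0"
  shows "integrable lborel (\<lambda>s. indicator {0<..} s * s powr (z - 1) * exp (- (l * s)))"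
    and "(LBINT s. indicator {0<..} s * s powr (z - 1) * exp (- (l * s))) = Gamma z * l powr (- z)"
proof -
  define g where "g s = indicator {0<..} s * s powr (z - 1) * exp (- s)" for s :: real
  have [measurable]: "g \<in> borel_measurable borel" unfolding g_def by measurable
  have "(\<integral>\<^sup>+s. ennreal (g s) \<partial>lborel) = (\<integral>\<^sup>+t. ennreal (indicator {0..} t * t powr (z - 1) / exp t) \<partial>lborel)"
    by (intro nn_integral_cong) (auto simp: g_def exp_minus divide_inverse split: split_indicator)
  also have "\<dots> = ennreal (Gamma z)" using Gamma_conv_nn_integral_real[OF z] by simp
  finally have nn: "(\<integral>\<^sup>+s. ennreal (g s) \<partial>lborel) = ennreal (Gamma z)" .
  have g0: "g s \<ge> 0" for s by (simp add: g_def)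
  have ig: "integrable lborel g"
    using nn g0 by (intro integrableI_nonneg) auto
  have Ig: "(LBINT s. g s) = Gamma z"
    using nn g0 Gamma_real_pos[OF z] by (subst integral_eq_nn_integral) (auto simp: enn2real_ennreal less_imp_le)
  have gl: "g (l * s) = l powr (z - 1) * (indicator {0<..} s * s powr (z - 1) * exp (- (l * s)))" for s
    using l by (auto simp: g_def powr_mult zero_less_mult_iff split: split_indicator)
  have "integrable lborel (\<lambda>s. g (l * s))"
    using lborel_integral_affine(1)[of l g 0] ig l by simp
  hence "integrable lborel (\<lambda>s. l powr (1 - z) * g (l * s))" by simp
  moreover have "l powr (1 - z) * g (l * s) = indicator {0<..} s * s powr (z - 1) * exp (- (l * s))" for s
    using l unfolding gl mult.assoc[symmetric] powr_add[symmetric] by simp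
  ultimately show "integrable lborel (\<lambda>s. indicator {0<..} s * s powr (z - 1) * exp (- (l * s)))" by simp
  have "Gamma z = l * (l powr (z - 1) * (LBINT s. indicator {0<..} s * s powr (z - 1) * exp (- (l * s))))"
    using lborel_integral_affine(2)[of l g 0] l unfolding Ig by (simp add: gl mult.assoc)
  also have "\<dots> = l powr z * (LBINT s. indicator {0<..} s * s powr (z - 1) * exp (- (l * s)))"
    using l by (simp add: powr_diff)
  finally show "(LBINT s. indicator {0<..} s * s powr (z - 1) * exp (- (l * s))) = Gamma z * l powr (- z)"
    using l by (simp add: powr_minus)
qed

lemma lborel_integral_even:
  fixes e :: "real \<Rightarrow> real"
  assumes e: "integrable lborel e" and ev: "\<And>t. e (- t) = e t"
  shows "(LBINT t. e t) = 2 * (LBINT t. indicator {0<..} t * e t)"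
proof -
  have [measurable]: "e \<in> borel_measurable borel"
    using borel_measurable_integrable[OF e] by simp
  have ii: "integrable lborel (\<lambda>t. indicator A t * e t)" if [measurable]: "A \<in> sets borel" for A
    using integrable_mult_indicator[of A lborel e] e that by simp
  have "(LBINT t. e t) = (LBINT t. indicator {0<..} t * e t + indicator {..<0} t * e t)"
    using AE_lborel_singleton[of "0::real"]
    by (intro integral_cong_AE) (auto split: split_indicator)
  also have "\<dots> = (LBINT t. indicator {0<..} t * e t) + (LBINT t. indicator {..<0} t * e t)"
    by (intro Bochner_Integration.integral_add ii) auto
  also have "(LBINT t. indicator {..<0} t * e t) = (LBINT t. indicator {..<0} (0 - t) * e (0 - t))"
    by (rule lborel_integral_reflect(2)[symmetric]) measurable
  also have "\<dots> = (LBINT t. indicator {0<..} t * e t)"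
    by (intro Bochner_Integration.integral_cong) (auto simp: ev split: split_indicator)
  finally show ?thesis by simp
qed

text \<open>Substituting \<open>s = r / 2 * exp t\<close> turns
  \<open>s + r\<^sup>2 / (4 * s)\<close> into \<open>r * cosh t\<close>, and the power of
  \<open>s\<close> together with the Jacobian into a multiple of \<open>exp (\<nu> * t)\<close>, on
  the whole line. Averaging over \<open>t\<close> and \<open>- t\<close> gives
  \<open>cosh (\<nu> * t)\<close>, and evenness folds the line onto the half-line of
  \<open>besselK\<close>, whence the factor \<open>2\<close>.\<close>

lemma besselK_mixture:
  assumes nu: "\<nu> > 0" and r: "r > 0"
  shows "(LBINT s. indicator {0<..} s * s powr (\<nu> - 1) * exp (- s) * exp (- (r\<^sup>2 / (4 * s))))
       = 2 * (r / 2) powr \<nu> * besselK \<nu> r"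
proof -
  define f where "f s = s powr (\<nu> - 1) * exp (- s) * exp (- (r\<^sup>2 / (4 * s)))" for s :: real
  define J where "J = (LBINT s. indicator {0<..} s * f s)"
  have [measurable]: "f \<in> borel_measurable borel" unfolding f_def by measurable
  have fi: "integrable lborel (\<lambda>s. indicator {0<..} s * f s)"
  proof (rule Bochner_Integration.integrable_bound[OF Gamma_lborel_integral(1)[OF nu zero_less_one]])
    show "AE s in lborel. norm (indicator {0<..} s * f s) \<le> norm (indicator {0<..} s * s powr (\<nu> - 1) * exp (- (1 * s)))"
      by (intro AE_I2) (auto simp: f_def abs_mult intro!: mult_left_le split: split_indicator)
  qed simp
  define g where "g t = r / 2 * exp t" for t :: real
  have gU: "g ` UNIV = {0<..}"
  proof (intro equalityI subsetI)
    fix s :: real assume "s \<in> {0<..}"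
    hence "s = g (ln (2 * s / r))" using r by (simp add: g_def)
    thus "s \<in> g ` UNIV" by blast
  qed (use r in \<open>auto simp: g_def\<close>)
  have ai: "f absolutely_integrable_on {0<..}" and aJ: "integral {0<..} f = J"
  proof -
    have si: "set_integrable lborel {0<..} f"
      using fi by (simp add: set_integrable_def)
    thus a: "f absolutely_integrable_on {0<..}"
      by (simp add: set_integrable_def integrable_completion)
    have "integral {0<..} f = (LINT x : {0<..} | lebesgue. f x)"
      using set_lebesgue_integral_eq_integral(2)[OF a] ..
    also have "\<dots> = J" by (simp add: set_lebesgue_integral_def J_def integral_completion)
    finally show "integral {0<..} f = J" .
  qed
  define k where "k t = (r / 2) powr \<nu> * (exp (- r * cosh t) * exp (\<nu> * t))" for t
  have [measurable]: "k \<in> borel_measurable borel"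
    unfolding k_def cosh_def by measurable
  have kf: "\<bar>g t\<bar> * f (g t) = k t" for t
  proof -
    have g0: "g t > 0" using r by (simp add: g_def)
    have "g t * g t powr (\<nu> - 1) = g t powr \<nu>" using g0 by (simp add: powr_diff)
    also have "\<dots> = (r / 2) powr \<nu> * exp (\<nu> * t)"
      using r unfolding g_def by (subst powr_mult) (auto simp: exp_powr_real mult.commute)
    finally have 1: "g t * g t powr (\<nu> - 1) = (r / 2) powr \<nu> * exp (\<nu> * t)" .
    have 2: "r\<^sup>2 / (4 * g t) = r / 2 * exp (- t)"
      using r by (simp add: g_def exp_minus field_simps power2_eq_square)
    have 3: "exp (- g t) * exp (- (r\<^sup>2 / (4 * g t))) = exp (- r * cosh t)"
      unfolding 2 exp_add[symmetric] by (simp add: g_def cosh_def field_simps)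
    have "\<bar>g t\<bar> * f (g t) = (g t * g t powr (\<nu> - 1)) * (exp (- g t) * exp (- (r\<^sup>2 / (4 * g t))))"
      using g0 by (simp add: f_def)
    thus ?thesis unfolding 1 3 by (simp add: k_def)
  qed
  \<comment> \<open>\<open>g\<close> is its own derivative and therefore also the Jacobian of the
    change of variables.\<close>
  have "(g has_field_derivative g t) (at t within UNIV)" for t
    unfolding g_def by (auto intro!: derivative_eq_intros)
  hence "k absolutely_integrable_on UNIV \<and> integral UNIV k = J"
    using has_absolute_integral_change_of_variables_1'[of UNIV g g f J] ai aJ r
    unfolding gU kf by (auto simp: g_def inj_on_def)
  hence kL: "integrable lebesgue k" and kU: "integral UNIV k = J"
    by (auto simp: set_integrable_def)
  have ki: "integrable lborel k" using kL by (simp add: integrable_completion)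
  have kJ: "(LBINT t. k t) = J"
  proof -
    have "integral UNIV k = (LINT x : UNIV | lebesgue. k x)"
      using kL by (intro set_lebesgue_integral_eq_integral(2)[symmetric]) (simp add: set_integrable_def)
    also have "\<dots> = (LBINT t. k t)" by (simp add: set_lebesgue_integral_def integral_completion)
    finally show ?thesis using kU by simp
  qed
  define e where "e t = exp (- r * cosh t) * cosh (\<nu> * t)" for t
  have km: "integrable lborel (\<lambda>t. k (0 - t))" "(LBINT t. k (0 - t)) = J"
    using lborel_integral_reflect[of k 0] ki kJ by auto
  have ek: "(r / 2) powr \<nu> * e t = (k t + k (0 - t)) / 2" for t
    by (simp add: e_def k_def cosh_def field_simps)
  have "integrable lborel (\<lambda>t. (r / 2) powr \<nu> * e t)"
    unfolding ek using ki km by (intro Bochner_Integration.integrable_divide Bochner_Integration.integrable_add)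
  hence ei: "integrable lborel e"
    using r by simp
  have "(r / 2) powr \<nu> * (LBINT t. e t) = (LBINT t. (k t + k (0 - t)) / 2)"
    unfolding ek[symmetric] by simp
  also have "\<dots> = J" using ki km kJ by (simp del: diff_0)
  finally have "J = (r / 2) powr \<nu> * (LBINT t. e t)" ..
  also have "(LBINT t. e t) = 2 * (LBINT t. indicator {0<..} t * e t)"
    by (rule lborel_integral_even[OF ei]) (simp add: e_def)
  also have "(LBINT t. indicator {0<..} t * e t) = besselK \<nu> r"
    unfolding besselK_def e_def
    by (simp add: interval_lebesgue_integral_0_infty set_lebesgue_integral_def)
  finally show ?thesis by (simp add: J_def f_def mult.assoc)
qed

text \<open>The density of the Gamma distribution with shape \<open>\<nu>\<close> and rate
  \<open>1\<close>; in the mixture for the Matern kernel, \<open>s\<close> is proportional to the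
  squared width of the Gaussian.\<close>

definition matern_mixing :: "real \<Rightarrow> real \<Rightarrow> real" where
  "matern_mixing \<nu> s = indicator {0<..} s * s powr (\<nu> - 1) * exp (- s) / Gamma \<nu>"

lemma borel_measurable_matern_mixing [measurable]: "matern_mixing \<nu> \<in> borel_measurable borel"
  unfolding matern_mixing_def by measurable

lemma matern_mixture:
  assumes nu: "\<nu> > 0" and phi: "\<phi> > 0" and k: "\<kappa> = 2 * sqrt \<nu> * \<phi>"
  shows "matern \<nu> \<phi> x = (LBINT s. matern_mixing \<nu> s * exp (- (\<kappa>\<^sup>2 / (4 * s) * (norm x)\<^sup>2)))"
proof (cases "x = 0")
  case True
  thus ?thesis
    using Gamma_lborel_integral(2)[OF nu zero_less_one] Gamma_real_pos[OF nu]
    by (simp add: matern_def matern_mixing_def)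
next
  case False
  define r where "r = \<kappa> * norm x"
  have r: "r > 0" using False nu phi by (simp add: r_def k)
  have "(LBINT s. matern_mixing \<nu> s * exp (- (\<kappa>\<^sup>2 / (4 * s) * (norm x)\<^sup>2)))
    = (LBINT s. indicator {0<..} s * s powr (\<nu> - 1) * exp (- s) * exp (- (r\<^sup>2 / (4 * s))) / Gamma \<nu>)"
    by (intro Bochner_Integration.integral_cong) (auto simp: matern_mixing_def r_def power_mult_distrib)
  also have "\<dots> = 2 * (r / 2) powr \<nu> * besselK \<nu> r / Gamma \<nu>"
    using besselK_mixture[OF nu r] by simp
  also have "\<dots> = matern \<nu> \<phi> x"
    using False r by (simp add: matern_def Let_def r_def[unfolded k, symmetric] powr_divide powr_diff) (simp add: mult_ac)
  finally show ?thesis ..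
qed

text \<open>Normalised so that its transform is the Matern kernel without any factor. As the kernel
  is \<open>1\<close> at the origin, this is a probability density, namely that of a multivariate
  t-distribution.\<close>

definition matern_spectrum :: "real \<Rightarrow> real \<Rightarrow> 'a::euclidean_space \<Rightarrow> real" where
  "matern_spectrum \<nu> \<phi> \<omega> =
     ((2 * sqrt \<nu> * \<phi>)\<^sup>2 * pi) powr (- (DIM('a) / 2)) * (Gamma (\<nu> + DIM('a) / 2) / Gamma \<nu>)
     * (1 + (norm \<omega>)\<^sup>2 / (2 * sqrt \<nu> * \<phi>)\<^sup>2) powr (- (\<nu> + DIM('a) / 2))"

text \<open>The factor \<open>s powr h\<close> raises the shape of the Gamma density from
  \<open>\<nu>\<close> to \<open>\<nu> + h\<close>. The exponent is written with
  \<open>l - 1\<close> because \<open>matern_mixing\<close> already contains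
  \<open>exp (- s)\<close>.\<close>

lemma Gamma_real_shift_integral:
  fixes \<nu> h l :: real
  assumes nu: "\<nu> > 0" and h: "h \<ge> 0" and l: "l > 0"
  shows "integrable lborel (\<lambda>s. matern_mixing \<nu> s * s powr h * exp (- ((l - 1) * s)))"
    and "(LBINT s. matern_mixing \<nu> s * s powr h * exp (- ((l - 1) * s))) = Gamma (\<nu> + h) / Gamma \<nu> * l powr (- (\<nu> + h))"
proof -
  have eq: "matern_mixing \<nu> s * s powr h * exp (- ((l - 1) * s))
      = (indicator {0<..} s * s powr (\<nu> + h - 1) * exp (- (l * s))) / Gamma \<nu>" for s
  proof (cases "s > 0")
    case True
    have "s powr (\<nu> - 1) * s powr h = s powr (\<nu> + h - 1)"
      unfolding powr_add[symmetric] by (simp add: algebra_simps)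
    moreover have "exp (- s) * exp (- ((l - 1) * s)) = exp (- (l * s))"
      unfolding exp_add[symmetric] by (simp add: algebra_simps)
    moreover have "matern_mixing \<nu> s * s powr h * exp (- ((l - 1) * s))
      = (s powr (\<nu> - 1) * s powr h) * (exp (- s) * exp (- ((l - 1) * s))) / Gamma \<nu>"
      using True by (simp add: matern_mixing_def)
    ultimately show ?thesis using True by simp
  qed (simp add: matern_mixing_def)
  have nh: "\<nu> + h > 0" using nu h by simp
  show "integrable lborel (\<lambda>s. matern_mixing \<nu> s * s powr h * exp (- ((l - 1) * s)))"
    unfolding eq using Gamma_lborel_integral(1)[OF nh l] by (rule Bochner_Integration.integrable_divide)
  show "(LBINT s. matern_mixing \<nu> s * s powr h * exp (- ((l - 1) * s))) = Gamma (\<nu> + h) / Gamma \<nu> * l powr (- (\<nu> + h))"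
    unfolding eq using Gamma_lborel_integral(2)[OF nh l] by simp
qed

lemma matern_mixing_nonneg: "\<nu> > 0 \<Longrightarrow> matern_mixing \<nu> s \<ge> 0"
  using Gamma_real_pos[of \<nu>] by (simp add: matern_mixing_def)

lemma matern_ft:
  fixes \<omega> :: "'a::euclidean_space"
  assumes nu: "\<nu> > 0" and phi: "\<phi> > 0"
  shows "integrable lborel (matern \<nu> \<phi> :: 'a \<Rightarrow> real)"
    and "ft (\<lambda>x. complex_of_real (matern \<nu> \<phi> x)) \<omega> = complex_of_real ((2 * pi) ^ DIM('a) * matern_spectrum \<nu> \<phi> \<omega>)"
proof -
  define \<kappa> where "\<kappa> = 2 * sqrt \<nu> * \<phi>"
  have k: "\<kappa> > 0" using nu phi by (simp add: \<kappa>_def)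
  let ?h = "real DIM('a) / 2"
  let ?a = "\<lambda>s. \<kappa>\<^sup>2 / (4 * s)"
  have sh: "matern_mixing \<nu> s * (pi / ?a s) powr ?h = (4 * pi / \<kappa>\<^sup>2) powr ?h * (matern_mixing \<nu> s * s powr ?h)" for s
  proof (cases "s > 0")
    case True
    have "(pi / ?a s) powr ?h = (4 * pi / \<kappa>\<^sup>2) powr ?h * s powr ?h"
      using True k by (subst powr_mult[symmetric]) (auto simp: field_simps)
    thus ?thesis by simp
  qed (simp add: matern_mixing_def)
  have i: "integrable lborel (\<lambda>s. matern_mixing \<nu> s * (pi / ?a s) powr ?h)"
    unfolding sh using Gamma_real_shift_integral(1)[OF nu, of ?h 1] by simp
  note mix = gaussian_mixture_ft[where 'a = 'a, OF _ _ matern_mixing_nonneg[OF nu] _ i, folded matern_mixture[OF nu phi \<kappa>_def]]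
  show "integrable lborel (matern \<nu> \<phi> :: 'a \<Rightarrow> real)"
    using k by (intro mix(1)) (auto simp: matern_mixing_def split: split_indicator_asm)
  have "ft (\<lambda>x. complex_of_real (matern \<nu> \<phi> x)) \<omega>
    = complex_of_real (LBINT s. matern_mixing \<nu> s * (pi / ?a s) powr ?h * exp (- ((norm \<omega>)\<^sup>2 / (4 * ?a s))))"
    using k by (intro mix(2)) (auto simp: matern_mixing_def split: split_indicator_asm)
  also have "(LBINT s. matern_mixing \<nu> s * (pi / ?a s) powr ?h * exp (- ((norm \<omega>)\<^sup>2 / (4 * ?a s))))
     = (LBINT s. (4 * pi / \<kappa>\<^sup>2) powr ?h * (matern_mixing \<nu> s * s powr ?h * exp (- (((1 + (norm \<omega>)\<^sup>2 / \<kappa>\<^sup>2) - 1) * s))))"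
    unfolding sh by (intro Bochner_Integration.integral_cong) (auto simp: mult.assoc)
  also have "\<dots> = (4 * pi / \<kappa>\<^sup>2) powr ?h * (Gamma (\<nu> + ?h) / Gamma \<nu> * (1 + (norm \<omega>)\<^sup>2 / \<kappa>\<^sup>2) powr (- (\<nu> + ?h)))"
    by (subst integral_mult_right_zero, subst Gamma_real_shift_integral(2)[OF nu])
       (auto intro!: add_pos_nonneg)
  \<comment> \<open>Splits off the normalisation of \<open>matern_spectrum\<close>, by \<open>(2 *
    pi)\<^sup>2 = (4 * pi / \<kappa>\<^sup>2) * (\<kappa>\<^sup>2 * pi)\<close>.\<close>
  also have "(4 * pi / \<kappa>\<^sup>2) powr ?h = (2 * pi) ^ DIM('a) * (\<kappa>\<^sup>2 * pi) powr (- ?h)"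
  proof -
    have "(2 * pi) ^ DIM('a) = ((2 * pi) powr 2) powr ?h"
      by (simp add: powr_powr powr_realpow del: powr_numeral)
    also have "(2 * pi) powr 2 = 4 * pi / \<kappa>\<^sup>2 * (\<kappa>\<^sup>2 * pi)"
      using k by (simp add: power2_eq_square)
    also have "\<dots> powr ?h = (4 * pi / \<kappa>\<^sup>2) powr ?h * (\<kappa>\<^sup>2 * pi) powr ?h"
      by (rule powr_mult)
    finally show ?thesis using k by (simp add: powr_minus)
  qed
  finally show "ft (\<lambda>x. complex_of_real (matern \<nu> \<phi> x)) \<omega> = complex_of_real ((2 * pi) ^ DIM('a) * matern_spectrum \<nu> \<phi> \<omega>)"
    by (simp add: matern_spectrum_def \<kappa>_def mult.assoc)
qed

text \<open>The spectrum is again a Gaussian mixture, with the same Gamma density and reciprocal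
  widths, so its transform follows from \<open>gaussian_mixture_ft\<close> rather than from
  inversion.\<close>

lemma matern_spectrum_ft:
  fixes x :: "'a::euclidean_space"
  assumes nu: "\<nu> > 0" and phi: "\<phi> > 0"
  shows "integrable lborel (matern_spectrum \<nu> \<phi> :: 'a \<Rightarrow> real)"
    and "ft (\<lambda>\<omega>. complex_of_real (matern_spectrum \<nu> \<phi> \<omega>)) x = complex_of_real (matern \<nu> \<phi> x)"
proof -
  define \<kappa> where "\<kappa> = 2 * sqrt \<nu> * \<phi>"
  have k: "\<kappa> > 0" using nu phi by (simp add: \<kappa>_def)
  let ?h = "real DIM('a) / 2"
  let ?a = "\<lambda>s. s / \<kappa>\<^sup>2"
  \<comment> \<open>The power of \<open>s\<close> cancels the factor
    \<open>(pi / ?a s) powr ?h\<close> that each Gaussian acquires under the transform, so that the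
    Gamma density remains.\<close>
  define w where "w s = matern_mixing \<nu> s * (s / (\<kappa>\<^sup>2 * pi)) powr ?h" for s
  have [measurable]: "w \<in> borel_measurable borel" unfolding w_def by measurable
  have w0: "w s \<ge> 0" for s using matern_mixing_nonneg[OF nu] by (simp add: w_def)
  have wa: "?a s > 0" if "w s \<noteq> 0" for s
    using that k by (auto simp: w_def matern_mixing_def split: split_indicator_asm)
  have sh: "w s * (pi / ?a s) powr ?h = matern_mixing \<nu> s" for s
  proof (cases "s > 0")
    case True
    have "(s / (\<kappa>\<^sup>2 * pi)) powr ?h * (pi / ?a s) powr ?h = 1"
      using True k by (subst powr_mult[symmetric]) (auto simp: field_simps)
    thus ?thesis by (simp add: w_def mult.assoc)
  qed (simp add: w_def matern_mixing_def)
  have i: "integrable lborel (\<lambda>s. w s * (pi / ?a s) powr ?h)"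
    unfolding sh using Gamma_lborel_integral(1)[OF nu zero_less_one] by (simp add: matern_mixing_def)
  have spec: "(LBINT s. w s * exp (- (?a s * (norm (\<omega>::'a))\<^sup>2))) = matern_spectrum \<nu> \<phi> \<omega>" for \<omega>
  proof -
    have "(LBINT s. w s * exp (- (?a s * (norm \<omega>)\<^sup>2)))
      = (LBINT s. (\<kappa>\<^sup>2 * pi) powr (- ?h) * (matern_mixing \<nu> s * s powr ?h * exp (- (((1 + (norm \<omega>)\<^sup>2 / \<kappa>\<^sup>2) - 1) * s))))"
    proof (intro Bochner_Integration.integral_cong refl)
      fix s
      show "w s * exp (- (?a s * (norm \<omega>)\<^sup>2))
         = (\<kappa>\<^sup>2 * pi) powr (- ?h) * (matern_mixing \<nu> s * s powr ?h * exp (- (((1 + (norm \<omega>)\<^sup>2 / \<kappa>\<^sup>2) - 1) * s)))"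
      proof (cases "s > 0")
        case True
        have "(s / (\<kappa>\<^sup>2 * pi)) powr ?h = s powr ?h / (\<kappa>\<^sup>2 * pi) powr ?h"
          by (rule powr_divide)
        hence "(s / (\<kappa>\<^sup>2 * pi)) powr ?h = (\<kappa>\<^sup>2 * pi) powr (- ?h) * s powr ?h"
          by (simp only: powr_minus_divide) simp
        moreover have "?a s * (norm \<omega>)\<^sup>2 = ((1 + (norm \<omega>)\<^sup>2 / \<kappa>\<^sup>2) - 1) * s"
          by simp
        ultimately show ?thesis unfolding w_def by simp
      qed (simp add: w_def matern_mixing_def)
    qed
    also have "\<dots> = (\<kappa>\<^sup>2 * pi) powr (- ?h) * (Gamma (\<nu> + ?h) / Gamma \<nu> * (1 + (norm \<omega>)\<^sup>2 / \<kappa>\<^sup>2) powr (- (\<nu> + ?h)))"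
      by (subst integral_mult_right_zero, subst Gamma_real_shift_integral(2)[OF nu])
         (auto intro!: add_pos_nonneg)
    finally show ?thesis by (simp add: matern_spectrum_def \<kappa>_def mult.assoc)
  qed
  note mix = gaussian_mixture_ft[where 'a = 'a, OF _ _ w0 wa i, unfolded spec]
  show "integrable lborel (matern_spectrum \<nu> \<phi> :: 'a \<Rightarrow> real)"
    by (intro mix(1)) auto
  have "ft (\<lambda>\<omega>. complex_of_real (matern_spectrum \<nu> \<phi> \<omega>)) x
    = complex_of_real (LBINT s. w s * (pi / ?a s) powr ?h * exp (- ((norm x)\<^sup>2 / (4 * ?a s))))"
    by (intro mix(2)) auto
  also have "(LBINT s. w s * (pi / ?a s) powr ?h * exp (- ((norm x)\<^sup>2 / (4 * ?a s)))) = matern \<nu> \<phi> x"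
    unfolding sh matern_mixture[OF nu phi \<kappa>_def]
    by (intro Bochner_Integration.integral_cong) (auto simp: mult.commute)
  finally show "ft (\<lambda>\<omega>. complex_of_real (matern_spectrum \<nu> \<phi> \<omega>)) x = complex_of_real (matern \<nu> \<phi> x)" .
qed

text \<open>\<open>1 + (norm \<omega>)\<^sup>2 / \<kappa>\<^sup>2\<close> lies between
  \<open>1 + (norm \<omega>)\<^sup>2\<close> times the minimum and times the maximum of
  \<open>1\<close> and \<open>1 / \<kappa>\<^sup>2\<close>. The exponent \<open>- m\<close> reverses
  the order, so the maximum produces the lower bound.\<close>

lemma matern_spectrum_bounds:
  assumes nu: "\<nu> > 0" and phi: "\<phi> > 0" and m: "m = \<nu> + real DIM('a::euclidean_space) / 2"
  obtains c C where "c > 0" "\<And>\<omega>::'a. c * (1 + (norm \<omega>)\<^sup>2) powr (- m) \<le> matern_spectrum \<nu> \<phi> \<omega>"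
    "\<And>\<omega>::'a. matern_spectrum \<nu> \<phi> \<omega> \<le> C * (1 + (norm \<omega>)\<^sup>2) powr (- m)"
proof -
  define \<kappa> where "\<kappa> = 2 * sqrt \<nu> * \<phi>"
  have k: "\<kappa> > 0" using nu phi by (simp add: \<kappa>_def)
  have m0: "m > 0" using nu by (simp add: m add_pos_nonneg)
  define A where "A = (\<kappa>\<^sup>2 * pi) powr (- (DIM('a) / 2)) * (Gamma (\<nu> + DIM('a) / 2) / Gamma \<nu>)"
  have A: "A > 0" using k nu Gamma_real_pos[of \<nu>] Gamma_real_pos[of "\<nu> + DIM('a) / 2"]
    by (auto simp: A_def intro!: mult_pos_pos divide_pos_pos add_pos_nonneg)
  have sp: "matern_spectrum \<nu> \<phi> \<omega> = A * (1 + (norm \<omega>)\<^sup>2 / \<kappa>\<^sup>2) powr (- m)" for \<omega> :: 'a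
    by (simp add: matern_spectrum_def A_def \<kappa>_def m)
  define M where "M = max 1 (1 / \<kappa>\<^sup>2)"
  define L where "L = min 1 (1 / \<kappa>\<^sup>2)"
  have MLp: "M > 0" "L > 0" using k by (auto simp: M_def L_def)
  have up: "1 + (norm \<omega>)\<^sup>2 / \<kappa>\<^sup>2 \<le> M * (1 + (norm \<omega>)\<^sup>2)" for \<omega> :: 'a
  proof -
    have "(norm \<omega>)\<^sup>2 / \<kappa>\<^sup>2 \<le> M * (norm \<omega>)\<^sup>2"
      using mult_right_mono[of "1 / \<kappa>\<^sup>2" M "(norm \<omega>)\<^sup>2"] by (simp add: M_def)
    moreover have "1 \<le> M" by (simp add: M_def)
    ultimately show ?thesis by (simp add: distrib_left)
  qed
  have lw: "L * (1 + (norm \<omega>)\<^sup>2) \<le> 1 + (norm \<omega>)\<^sup>2 / \<kappa>\<^sup>2" for \<omega> :: 'a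
  proof -
    have "L * (norm \<omega>)\<^sup>2 \<le> (norm \<omega>)\<^sup>2 / \<kappa>\<^sup>2"
      using mult_right_mono[of L "1 / \<kappa>\<^sup>2" "(norm \<omega>)\<^sup>2"] by (simp add: L_def)
    moreover have "L \<le> 1" by (simp add: L_def)
    ultimately show ?thesis by (simp add: distrib_left)
  qed
  have pos: "1 + (norm \<omega>)\<^sup>2 > 0" for \<omega> :: 'a by (simp add: add_pos_nonneg)
  show ?thesis
  proof (rule that[of "A * M powr (- m)" "A * L powr (- m)"])
    show "A * M powr (- m) > 0" using A MLp by simp
    fix \<omega> :: 'a
    have "(M * (1 + (norm \<omega>)\<^sup>2)) powr (- m) \<le> (1 + (norm \<omega>)\<^sup>2 / \<kappa>\<^sup>2) powr (- m)"
      using m0 up by (intro powr_mono2') (auto simp: add_pos_nonneg)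
    hence "M powr (- m) * (1 + (norm \<omega>)\<^sup>2) powr (- m) \<le> (1 + (norm \<omega>)\<^sup>2 / \<kappa>\<^sup>2) powr (- m)"
      by (simp add: powr_mult)
    thus "A * M powr (- m) * (1 + (norm \<omega>)\<^sup>2) powr (- m) \<le> matern_spectrum \<nu> \<phi> \<omega>"
      using A by (simp add: sp mult.assoc)
    have "(1 + (norm \<omega>)\<^sup>2 / \<kappa>\<^sup>2) powr (- m) \<le> (L * (1 + (norm \<omega>)\<^sup>2)) powr (- m)"
      using m0 lw MLp pos by (intro powr_mono2') auto
    hence "(1 + (norm \<omega>)\<^sup>2 / \<kappa>\<^sup>2) powr (- m) \<le> L powr (- m) * (1 + (norm \<omega>)\<^sup>2) powr (- m)"
      by (simp add: powr_mult)
    thus "matern_spectrum \<nu> \<phi> \<omega> \<le> A * L powr (- m) * (1 + (norm \<omega>)\<^sup>2) powr (- m)"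
      using A by (simp add: sp mult.assoc)
  qed
qed

section \<open>Native spaces of spectral kernels\<close>

text \<open>What the rest of the argument takes from the Matern kernel: a transform pair and the
  exact rate of decay. The upper bound on \<open>S\<close> makes convolutions with \<open>K\<close>
  regular; the lower bound recovers a square-integrable quotient from regularity and lets
  \<open>S\<close> dominate the transforms of test functions.\<close>

locale spectral_kernel =
  fixes K S :: "'a::euclidean_space \<Rightarrow> real" and m c C :: real
  assumes K_integrable: "integrable lborel K"
    and S_integrable: "integrable lborel S"
    and S_even: "S (- \<omega>) = S \<omega>"
    and ft_S: "ft (\<lambda>\<omega>. complex_of_real (S \<omega>)) x = complex_of_real (K x)"
    and ft_K: "ft (\<lambda>x. complex_of_real (K x)) \<omega> = complex_of_real ((2 * pi) ^ DIM('a) * S \<omega>)"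
    and c_pos: "c > 0" and m_pos: "m > 0"
    and S_lower: "c * (1 + (norm \<omega>)\<^sup>2) powr (- m) \<le> S \<omega>"
    and S_upper: "S \<omega> \<le> C * (1 + (norm \<omega>)\<^sup>2) powr (- m)"
begin

lemma K_measurable [measurable]: "K \<in> borel_measurable borel"
  using borel_measurable_integrable[OF K_integrable] by simp

lemma S_measurable [measurable]: "S \<in> borel_measurable borel"
  using borel_measurable_integrable[OF S_integrable] by simp

lemma one_plus_norm_pos: "1 + (norm (\<omega>::'a))\<^sup>2 > 0"
  by (simp add: add_pos_nonneg)

lemma S_pos: "S \<omega> > 0"
proof -
  have "0 < c * (1 + (norm \<omega>)\<^sup>2) powr (- m)" using c_pos one_plus_norm_pos[of \<omega>] by simp
  thus ?thesis using S_lower[of \<omega>] by linarith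
qed

lemma C_pos: "C > 0"
  using S_upper[of 0] S_pos[of 0] by simp

lemma S_le_C: "S \<omega> \<le> C"
proof -
  have "(1 + (norm \<omega>)\<^sup>2) powr (- m) \<le> 1 powr (- m)"
    using m_pos by (intro powr_mono2') auto
  hence "C * (1 + (norm \<omega>)\<^sup>2) powr (- m) \<le> C * 1"
    using C_pos by (intro mult_left_mono) auto
  thus ?thesis using S_upper[of \<omega>] by linarith
qed

text \<open>Evenness of \<open>S\<close> allows the positive sign in \<open>cis\<close>, the one
  that occurs in \<open>synth\<close>.\<close>

lemma K_spectral: "complex_of_real (K x) = (LBINT \<omega>. complex_of_real (S \<omega>) * cis (\<omega> \<bullet> x))"
proof -
  have "(LBINT \<omega>. complex_of_real (S \<omega>) * cis (\<omega> \<bullet> x))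
      = (LBINT \<omega>. complex_of_real (S (0 - \<omega>)) * cis ((0 - \<omega>) \<bullet> x))"
    by (rule lborel_integral_reflect(2)[symmetric]) measurable
  thus ?thesis unfolding ft_S[symmetric] ft_def by (simp add: S_even inner_commute)
qed

lemma K_bounded: "\<bar>K x\<bar> \<le> (LBINT \<omega>. S \<omega>)"
proof -
  have "\<bar>K x\<bar> = cmod (ft (\<lambda>\<omega>. complex_of_real (S \<omega>)) x)" by (simp add: ft_S)
  also have "\<dots> \<le> (LBINT \<omega>. cmod (complex_of_real (S \<omega>)))" by (rule norm_ft_le)
  finally show ?thesis using S_pos by (simp add: less_imp_le)
qed

definition rootS :: "'a \<Rightarrow> complex" where
  "rootS \<omega> = complex_of_real (sqrt (S \<omega>))"

lemma rootS_measurable [measurable]: "rootS \<in> borel_measurable borel"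
  unfolding rootS_def by measurable

lemma rootS_mult_self: "rootS \<omega> * rootS \<omega> = complex_of_real (S \<omega>)"
  using S_pos[of \<omega>] by (simp add: rootS_def flip: of_real_mult)

lemma rootS_nz: "rootS \<omega> \<noteq> 0"
  using S_pos[of \<omega>] by (simp add: rootS_def)

lemma cmod_rootS_sq: "(cmod (rootS \<omega>))\<^sup>2 = S \<omega>"
  using S_pos[of \<omega>] by (simp add: rootS_def)

lemma cmod_rootS_le: "cmod (rootS \<omega>) \<le> sqrt C"
  using S_pos[of \<omega>] S_le_C[of \<omega>] by (simp add: rootS_def)

lemma sq_integrable_rootS: "sq_integrable lborel rootS"
  unfolding sq_integrable_def cmod_rootS_sq using S_integrable by simp

lemma sq_integrable_rootS_cis: "sq_integrable lborel (\<lambda>\<omega>. rootS \<omega> * cis (\<omega> \<bullet> x))"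
  by (rule sq_integrable_bound[OF sq_integrable_rootS, where C = 1]) (auto simp: norm_mult)

definition trig :: "(real \<times> 'a) list \<Rightarrow> 'a \<Rightarrow> complex" where
  "trig l \<omega> = (\<Sum>(b, y)\<leftarrow>l. complex_of_real b * cis (- (\<omega> \<bullet> y)))"

lemma trig_Nil [simp]: "trig [] \<omega> = 0"
  and trig_Cons [simp]: "trig ((b, y) # l) \<omega> = complex_of_real b * cis (- (\<omega> \<bullet> y)) + trig l \<omega>"
  by (simp_all add: trig_def)

lemma trig_measurable [measurable]: "trig l \<in> borel_measurable borel"
proof (induction l)
  case Nil thus ?case by (simp add: trig_def[abs_def])
next
  case (Cons p l)
  obtain b y where p: "p = (b, y)" by force
  have "trig (p # l) = (\<lambda>\<omega>. complex_of_real b * cis (- (\<omega> \<bullet> y)) + trig l \<omega>)"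
    by (auto simp: p)
  thus ?case using Cons by simp
qed

lemma norm_trig_le: "cmod (trig l \<omega>) \<le> (\<Sum>(b, y)\<leftarrow>l. \<bar>b\<bar>)"
proof (induction l)
  case (Cons p l)
  obtain b y where p: "p = (b, y)" by force
  show ?case using Cons norm_triangle_ineq[of "complex_of_real b * cis (- (\<omega> \<bullet> y))" "trig l \<omega>"]
    by (simp add: p norm_mult)
qed simp

lemma sq_integrable_rootS_trig: "sq_integrable lborel (\<lambda>\<omega>. rootS \<omega> * trig l \<omega>)"
  using norm_trig_le[of l]
  by (intro sq_integrable_bound[OF sq_integrable_rootS, where C = "\<Sum>(b, y)\<leftarrow>l. \<bar>b\<bar>"])
     (auto simp: norm_mult mult.commute[of "cmod (rootS _)"] intro!: mult_right_mono)

text \<open>The map \<open>synth\<close> identifies \<open>L\<^sup>2\<close> with the native space of the whole space; an expansion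
  \<open>kexp K l\<close> comes from \<open>rootS * trig l\<close>.\<close>

definition synth :: "('a \<Rightarrow> complex) \<Rightarrow> 'a \<Rightarrow> complex" where
  "synth q x = (LBINT \<omega>. q \<omega> * (rootS \<omega> * cis (\<omega> \<bullet> x)))"

lemma synth_integrable: "sq_integrable lborel q \<Longrightarrow> integrable lborel (\<lambda>\<omega>. q \<omega> * (rootS \<omega> * cis (\<omega> \<bullet> x)))"
  by (rule sq_integrable_mult_integrable[OF _ sq_integrable_rootS_cis])

lemma synth_diff:
  "sq_integrable lborel p \<Longrightarrow> sq_integrable lborel q \<Longrightarrow> synth (\<lambda>\<omega>. p \<omega> - q \<omega>) x = synth p x - synth q x"
  unfolding synth_def by (simp add: left_diff_distrib synth_integrable)

lemma synth_trig: "synth (\<lambda>\<omega>. rootS \<omega> * trig l \<omega>) x = complex_of_real (kexp K l x)"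
proof (induction l)
  case Nil thus ?case by (simp add: synth_def kexp_def)
next
  case (Cons p l)
  obtain b y where p: "p = (b, y)" by force
  have 1: "rootS \<omega> * trig (p # l) \<omega> * (rootS \<omega> * cis (\<omega> \<bullet> x))
     = complex_of_real b * (complex_of_real (S \<omega>) * cis (\<omega> \<bullet> (x - y))) + rootS \<omega> * trig l \<omega> * (rootS \<omega> * cis (\<omega> \<bullet> x))" for \<omega>
  proof -
    have "cis (\<omega> \<bullet> (x - y)) = cis (\<omega> \<bullet> x) * cis (- (\<omega> \<bullet> y))"
      by (simp add: cis_mult inner_diff_right)
    thus ?thesis by (simp add: p rootS_mult_self[symmetric] algebra_simps)
  qed
  have iS: "integrable lborel (\<lambda>\<omega>. complex_of_real (S \<omega>) * cis (\<omega> \<bullet> (x - y)))"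
    using S_integrable by (intro integrable_mult_cis) auto
  have "synth (\<lambda>\<omega>. rootS \<omega> * trig (p # l) \<omega>) x
    = complex_of_real b * complex_of_real (K (x - y)) + synth (\<lambda>\<omega>. rootS \<omega> * trig l \<omega>) x"
    unfolding synth_def 1 K_spectral[of "x - y"]
    by (subst Bochner_Integration.integral_add)
       (auto intro: iS synth_integrable[OF sq_integrable_rootS_trig])
  thus ?case using Cons by (simp add: kexp_def p)
qed

text \<open>Conjugating the trigonometric polynomial gives terms
  \<open>b * cis (\<omega> \<bullet> y)\<close>, so the inner product is the sum of
  \<open>b * synth r y\<close>: the reproducing property in L2 form.\<close>

lemma integral_synth_orthogonal_trig:
  assumes r: "sq_integrable lborel r" and z: "\<And>y. y \<in> snd ` set l \<Longrightarrow> synth r y = 0"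
  shows "(LBINT \<omega>. r \<omega> * cnj (rootS \<omega> * trig l \<omega>)) = 0"
  using z
proof (induction l)
  case (Cons p l)
  obtain b y where p: "p = (b, y)" by force
  have 1: "r \<omega> * cnj (rootS \<omega> * trig (p # l) \<omega>)
     = complex_of_real b * (r \<omega> * (rootS \<omega> * cis (\<omega> \<bullet> y))) + r \<omega> * cnj (rootS \<omega> * trig l \<omega>)" for \<omega>
    by (simp add: p rootS_def cis_cnj algebra_simps)
  have i: "integrable lborel (\<lambda>\<omega>. r \<omega> * cnj (rootS \<omega> * trig l \<omega>))"
    by (rule sq_integrable_mult_integrable[OF r sq_integrable_cnj[OF sq_integrable_rootS_trig]])
  have "(LBINT \<omega>. r \<omega> * cnj (rootS \<omega> * trig (p # l) \<omega>))
    = complex_of_real b * synth r y + (LBINT \<omega>. r \<omega> * cnj (rootS \<omega> * trig l \<omega>))"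
    unfolding 1 synth_def
    by (subst Bochner_Integration.integral_add) (use i synth_integrable[OF r, of y] in simp_all)
  thus ?case using Cons by (simp add: p)
qed simp

text \<open>The isometry between expansions and L2. The conjugate falls on \<open>l\<close>, so the
  induction peels off the nodes of \<open>l\<close> and meets the values of the expansion
  \<open>l'\<close> there.\<close>

lemma kinner_trig: "complex_of_real (kinner K l l') = (LBINT \<omega>. (rootS \<omega> * trig l' \<omega>) * cnj (rootS \<omega> * trig l \<omega>))"
proof (induction l)
  case Nil thus ?case by (simp add: kinner_def)
next
  case (Cons p l)
  obtain b y where p: "p = (b, y)" by force
  let ?r = "\<lambda>\<omega>. rootS \<omega> * trig l' \<omega>"
  have 1: "?r \<omega> * cnj (rootS \<omega> * trig (p # l) \<omega>)
     = complex_of_real b * (?r \<omega> * (rootS \<omega> * cis (\<omega> \<bullet> y))) + ?r \<omega> * cnj (rootS \<omega> * trig l \<omega>)" for \<omega>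
    by (simp add: p rootS_def cis_cnj algebra_simps)
  have i: "integrable lborel (\<lambda>\<omega>. ?r \<omega> * cnj (rootS \<omega> * trig l \<omega>))"
    by (rule sq_integrable_mult_integrable[OF sq_integrable_rootS_trig sq_integrable_cnj[OF sq_integrable_rootS_trig]])
  have "(LBINT \<omega>. ?r \<omega> * cnj (rootS \<omega> * trig (p # l) \<omega>))
    = complex_of_real b * synth ?r y + (LBINT \<omega>. ?r \<omega> * cnj (rootS \<omega> * trig l \<omega>))"
    unfolding 1 synth_def
    by (subst Bochner_Integration.integral_add) (use i synth_integrable[OF sq_integrable_rootS_trig, of l' y] in simp_all)
  also have "\<dots> = complex_of_real b * complex_of_real (kexp K l' y) + complex_of_real (kinner K l l')"
    unfolding synth_trig Cons ..
  also have "\<dots> = complex_of_real (kinner K (p # l) l')"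
    by (simp add: kinner_def kexp_def p sum_list_const_mult split_def mult.assoc)
  finally show ?case ..
qed

lemma trig_append: "trig (l @ l') \<omega> = trig l \<omega> + trig l' \<omega>"
  by (simp add: trig_def)

lemma trig_uminus: "trig (map (\<lambda>(b, y). (- b, y)) l) \<omega> = - trig l \<omega>"
  by (induction l) auto

lemma kdist2_trig:
  "kdist2 K l l' = (LBINT \<omega>. (cmod (rootS \<omega> * trig l \<omega> - rootS \<omega> * trig l' \<omega>))\<^sup>2)"
proof -
  define d where "d = l @ map (\<lambda>(b, y). (- b, y)) l'"
  have t: "rootS \<omega> * trig d \<omega> = rootS \<omega> * trig l \<omega> - rootS \<omega> * trig l' \<omega>" for \<omega>
    by (simp add: d_def trig_append trig_uminus algebra_simps)
  have "complex_of_real (kdist2 K l l') = complex_of_real (LBINT \<omega>. (cmod (rootS \<omega> * trig d \<omega>))\<^sup>2)"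
    unfolding kdist2_def Let_def d_def[symmetric] kinner_trig integral_complex_of_real[symmetric]
    by (simp only: complex_norm_square)
  thus ?thesis unfolding t of_real_eq_iff .
qed

text \<open>Evaluation at \<open>x\<close> is the pairing with the fixed L2 function
  \<open>rootS \<omega> * cis (\<omega> \<bullet> x)\<close>, so norm convergence forces pointwise
  convergence at every point of the space, wherever the nodes lie. Hence the limits in
  \<open>canon_ext\<close> exist outside \<open>D\<close> as well.\<close>

lemma kcauchy_L2_limit:
  assumes "kcauchy K s"
  obtains q where "sq_integrable lborel q"
    "(\<lambda>n. \<integral>\<omega>. (cmod (rootS \<omega> * trig (s n) \<omega> - q \<omega>))\<^sup>2 \<partial>lborel) \<longlonglongrightarrow> 0"
    "\<And>x. (\<lambda>n. complex_of_real (kexp K (s n) x)) \<longlonglongrightarrow> synth q x"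
proof -
  obtain q where q: "sq_integrable lborel q"
    "(\<lambda>n. \<integral>\<omega>. (cmod (rootS \<omega> * trig (s n) \<omega> - q \<omega>))\<^sup>2 \<partial>lborel) \<longlonglongrightarrow> 0"
  proof (rule L2_complete[of lborel "\<lambda>n \<omega>. rootS \<omega> * trig (s n) \<omega>"])
    show "sq_integrable lborel (\<lambda>\<omega>. rootS \<omega> * trig (s n) \<omega>)" for n by (rule sq_integrable_rootS_trig)
    show "\<exists>N. \<forall>m\<ge>N. \<forall>n\<ge>N. (LBINT \<omega>. (cmod (rootS \<omega> * trig (s m) \<omega> - rootS \<omega> * trig (s n) \<omega>))\<^sup>2) < e"
      if "e > 0" for e
      using assms that unfolding kcauchy_def kdist2_trig by blast
  qed auto
  show ?thesis
  proof (rule that[OF q])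
    fix x
    show "(\<lambda>n. complex_of_real (kexp K (s n) x)) \<longlonglongrightarrow> synth q x"
      unfolding synth_trig[symmetric] synth_def
      by (rule tendsto_integral_L2[OF sq_integrable_rootS_trig q(1) sq_integrable_rootS_cis q(2)])
  qed
qed

lemma native_space_spectral:
  assumes "f \<in> native_space K D"
  obtains q s where "sq_integrable lborel q" "\<And>n. snd ` set (s n) \<subseteq> D"
    "(\<lambda>n. \<integral>\<omega>. (cmod (rootS \<omega> * trig (s n) \<omega> - q \<omega>))\<^sup>2 \<partial>lborel) \<longlonglongrightarrow> 0"
    "\<And>x. complex_of_real (canon_ext K D f x) = synth q x"
    "\<And>x. x \<in> D \<Longrightarrow> canon_ext K D f x = f x"
proof -
  \<comment> \<open>The sequence chosen inside \<open>canon_ext\<close>, so that \<open>q\<close>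
    describes that very extension.\<close>
  define s where "s = (SOME s. approx_seq K D f s)"
  have s: "approx_seq K D f s"
    using assms someI_ex[of "approx_seq K D f"] unfolding s_def native_space_def by simp
  obtain q where q: "sq_integrable lborel q"
    "(\<lambda>n. \<integral>\<omega>. (cmod (rootS \<omega> * trig (s n) \<omega> - q \<omega>))\<^sup>2 \<partial>lborel) \<longlonglongrightarrow> 0"
    "\<And>x. (\<lambda>n. complex_of_real (kexp K (s n) x)) \<longlonglongrightarrow> synth q x"
    using kcauchy_L2_limit[of s] s unfolding approx_seq_def by blast
  have ce: "canon_ext K D f x = lim (\<lambda>n. kexp K (s n) x)" for x
    by (simp add: canon_ext_def Let_def s_def)
  have lim: "(\<lambda>n. kexp K (s n) x) \<longlonglongrightarrow> Re (synth q x)" for x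
    using tendsto_Re[OF q(3)[of x]] by simp
  have ce': "canon_ext K D f x = Re (synth q x)" for x
    unfolding ce by (rule limI[OF lim])
  show ?thesis
  proof (rule that[OF q(1) _ q(2)])
    show "snd ` set (s n) \<subseteq> D" for n using s by (simp add: approx_seq_def)
    show "complex_of_real (canon_ext K D f x) = synth q x" for x
    proof -
      have "(\<lambda>n. complex_of_real (kexp K (s n) x)) \<longlonglongrightarrow> complex_of_real (Re (synth q x))"
        by (intro tendsto_of_real lim)
      thus ?thesis unfolding ce' using q(3)[of x] LIMSEQ_unique by blast
    qed
    show "canon_ext K D f x = f x" if "x \<in> D" for x
    proof -
      have "(\<lambda>n. kexp K (s n) x) \<longlonglongrightarrow> f x" using s that by (simp add: approx_seq_def)
      thus ?thesis unfolding ce' using lim LIMSEQ_unique by blast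
    qed
  qed
qed

section \<open>Convolutions with the kernel and the canonical extension\<close>

lemma conv_K_eq_synth:
  assumes v: "integrable lborel v"
  shows "conv (\<lambda>x. complex_of_real (K x)) v x = synth (\<lambda>\<omega>. rootS \<omega> * ft v \<omega>) x"
proof -
  have i: "integrable lborel (\<lambda>\<omega>. complex_of_real (S \<omega>) * cis (\<omega> \<bullet> x))"
    using S_integrable by (intro integrable_mult_cis) auto
  have f: "ft (\<lambda>\<omega>. complex_of_real (S \<omega>) * cis (\<omega> \<bullet> x)) t = complex_of_real (K (x - t))" for t
    unfolding K_spectral ft_def
    by (intro Bochner_Integration.integral_cong) (auto simp: mult.assoc cis_mult inner_diff_right inner_commute)
  have "synth (\<lambda>\<omega>. rootS \<omega> * ft v \<omega>) x = (LBINT \<omega>. ft v \<omega> * (complex_of_real (S \<omega>) * cis (\<omega> \<bullet> x)))"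
    unfolding synth_def rootS_mult_self[symmetric] by (simp add: mult_ac)
  also have "\<dots> = (LBINT t. v t * complex_of_real (K (x - t)))"
    unfolding ft_duality[OF v i] f ..
  finally show ?thesis by (simp add: conv_def mult.commute)
qed

lemma sq_integrable_rootS_mult:
  assumes "sq_integrable lborel p"
  shows "sq_integrable lborel (\<lambda>\<omega>. rootS \<omega> * p \<omega>)"
proof -
  note [measurable] = sq_integrable_measurable[OF assms]
  show ?thesis
    using cmod_rootS_le
    by (intro sq_integrable_bound[OF assms, where C = "sqrt C"]) (measurable, auto simp: norm_mult intro!: mult_right_mono)
qed

text \<open>The continuous counterpart of \<open>integral_synth_orthogonal_trig\<close>: the
  integral equals that of \<open>cnj (v y) * synth r y\<close>. It is applied when
  \<open>synth r\<close> vanishes on \<open>D\<close> and \<open>v\<close> vanishes off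
  \<open>D\<close>.\<close>

lemma integral_synth_orthogonal_ft:
  assumes r: "sq_integrable lborel r" and v: "integrable lborel v"
    and z: "\<And>y. synth r y = 0 \<or> v y = 0"
  shows "(LBINT \<omega>. r \<omega> * cnj (rootS \<omega> * ft v \<omega>)) = 0"
proof -
  have [measurable]: "v \<in> borel_measurable borel"
    using borel_measurable_integrable[OF v] by simp
  define w where "w = (\<lambda>y. cnj (v (- y)))"
  have w: "integrable lborel w"
    unfolding w_def using lborel_integral_reflect(1)[of "\<lambda>y. cnj (v y)" 0] v by simp
  have i: "integrable lborel (\<lambda>\<omega>. r \<omega> * rootS \<omega>)"
    by (rule sq_integrable_mult_integrable[OF r sq_integrable_rootS])
  have f: "ft (\<lambda>\<omega>. r \<omega> * rootS \<omega>) x = synth r (- x)" for x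
    unfolding ft_def synth_def by (simp add: inner_commute mult.assoc)
  have "(LBINT \<omega>. r \<omega> * cnj (rootS \<omega> * ft v \<omega>)) = (LBINT \<omega>. ft w \<omega> * (r \<omega> * rootS \<omega>))"
    by (intro Bochner_Integration.integral_cong) (auto simp: w_def cnj_ft rootS_def)
  also have "\<dots> = (LBINT x. w x * synth r (- x))"
    unfolding ft_duality[OF w i] f ..
  also have "\<dots> = (\<integral>x. 0 \<partial>(lborel :: 'a measure))"
    by (rule Bochner_Integration.integral_cong) (use z in \<open>auto simp: w_def\<close>)
  finally show ?thesis by simp
qed

lemma canon_ext_eq_conv:
  assumes f: "f \<in> native_space K D"
    and v: "integrable lborel v" "sq_integrable lborel v" and vD: "\<And>t. t \<notin> D \<Longrightarrow> v t = 0"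
    and eq: "\<And>x. x \<in> D \<Longrightarrow> complex_of_real (f x) = conv (\<lambda>x. complex_of_real (K x)) v x"
  shows "complex_of_real (canon_ext K D f x) = conv (\<lambda>x. complex_of_real (K x)) v x"
proof -
  obtain q s where q: "sq_integrable lborel q" and s: "\<And>n. snd ` set (s n) \<subseteq> D"
    and lim: "(\<lambda>n. \<integral>\<omega>. (cmod (rootS \<omega> * trig (s n) \<omega> - q \<omega>))\<^sup>2 \<partial>lborel) \<longlonglongrightarrow> 0"
    and ce: "\<And>x. complex_of_real (canon_ext K D f x) = synth q x"
    and cf: "\<And>x. x \<in> D \<Longrightarrow> canon_ext K D f x = f x"
    by (rule native_space_spectral[OF f]) (rule that)
  define q' where "q' = (\<lambda>\<omega>. rootS \<omega> * ft v \<omega>)"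
  have q': "sq_integrable lborel q'"
    unfolding q'_def by (intro sq_integrable_rootS_mult ft_L2_bound(1) v)
  \<comment> \<open>Orthogonality of \<open>r\<close> to \<open>q\<close> and to \<open>q'\<close>
    has two sources: \<open>q\<close> is a limit of trigonometric polynomials with nodes in
    \<open>D\<close>, while \<open>q'\<close> is a continuous superposition with density
    \<open>v\<close> on \<open>D\<close>.\<close>
  define r where "r = (\<lambda>\<omega>. q \<omega> - q' \<omega>)"
  have r: "sq_integrable lborel r" unfolding r_def by (intro sq_integrable_diff q q')
  have sr: "synth r y = 0" if "y \<in> D" for y
    unfolding r_def synth_diff[OF q q'] ce[symmetric] using cf[OF that] eq[OF that]
    by (simp add: q'_def conv_K_eq_synth[OF v(1)])
  have o1: "(LBINT \<omega>. r \<omega> * cnj (q' \<omega>)) = 0"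
    unfolding q'_def by (rule integral_synth_orthogonal_ft[OF r v(1)]) (use sr vD in blast)
  have on: "(LBINT \<omega>. r \<omega> * cnj (rootS \<omega> * trig (s n) \<omega>)) = 0" for n
    by (rule integral_synth_orthogonal_trig[OF r]) (use sr s in blast)
  have "(\<lambda>n. \<integral>\<omega>. cnj (rootS \<omega> * trig (s n) \<omega>) * r \<omega> \<partial>lborel) \<longlonglongrightarrow> (LBINT \<omega>. cnj (q \<omega>) * r \<omega>)"
  proof (rule tendsto_integral_L2[OF sq_integrable_cnj[OF sq_integrable_rootS_trig] sq_integrable_cnj[OF q] r])
    have "cmod (cnj a - cnj b) = cmod (a - b)" for a b
      by (metis complex_cnj_diff complex_mod_cnj)
    thus "(\<lambda>n. \<integral>\<omega>. (cmod (cnj (rootS \<omega> * trig (s n) \<omega>) - cnj (q \<omega>)))\<^sup>2 \<partial>lborel) \<longlonglongrightarrow> 0"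
      using lim by (simp only:)
  qed
  hence o2: "(LBINT \<omega>. r \<omega> * cnj (q \<omega>)) = 0"
    unfolding mult.commute[of _ "r _"] on by (simp add: LIMSEQ_const_iff)
  have "complex_of_real (LBINT \<omega>. (cmod (r \<omega>))\<^sup>2) = (LBINT \<omega>. r \<omega> * cnj (q \<omega>) - r \<omega> * cnj (q' \<omega>))"
    unfolding integral_complex_of_real[symmetric] complex_norm_square
    by (intro Bochner_Integration.integral_cong) (auto simp: r_def algebra_simps)
  also have "\<dots> = 0"
    using o1 o2 by (subst Bochner_Integration.integral_diff)
      (auto intro!: sq_integrable_mult_integrable sq_integrable_cnj r q q')
  finally have "(LBINT \<omega>. (cmod (r \<omega>))\<^sup>2) = 0" by simp
  hence "AE \<omega> in lborel. (cmod (r \<omega>))\<^sup>2 = 0"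
    using sq_integrable_norm2[OF r] by (subst (asm) integral_nonneg_eq_0_iff_AE) auto
  hence ae: "AE \<omega> in lborel. q \<omega> = q' \<omega>" by eventually_elim (simp add: r_def)
  note [measurable] = sq_integrable_measurable[OF q] sq_integrable_measurable[OF q']
  have "synth q x = synth q' x"
    unfolding synth_def using ae by (intro integral_cong_AE) (measurable, auto)
  thus ?thesis unfolding ce conv_K_eq_synth[OF v(1)] q'_def .
qed

end

section \<open>Compactly supported test functions\<close>

text \<open>For positive \<open>h\<close> the uniform density on the cube of half-width
  \<open>h\<close>, written as a product so that its transform factors over the coordinates.\<close>

definition box_kernel :: "real \<Rightarrow> 'a::euclidean_space \<Rightarrow> complex" where
  "box_kernel h z = (\<Prod>b\<in>Basis. complex_of_real (indicator {-h..h} (z \<bullet> b) / (2 * h)))"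

lemma box_kernel_measurable [measurable]: "box_kernel h \<in> borel_measurable borel"
  unfolding box_kernel_def by measurable

lemma box_kernel_nonneg: "box_kernel h z = complex_of_real (cmod (box_kernel h z))" if "h > 0"
proof -
  define r :: real where "r = (\<Prod>b\<in>Basis. indicator {-h..h} (z \<bullet> b) / (2 * h))"
  have "r \<ge> 0" unfolding r_def using that by (intro prod_nonneg) auto
  moreover have "box_kernel h z = complex_of_real r" by (simp add: box_kernel_def r_def)
  ultimately show ?thesis by simp
qed

lemma box_kernel_support:
  assumes "box_kernel h (z::'a::euclidean_space) \<noteq> 0"
  shows "norm z \<le> real DIM('a) * h"
proof -
  have "\<bar>z \<bullet> b\<bar> \<le> h" if "b \<in> Basis" for b
    using assms that by (auto simp: box_kernel_def split: split_indicator_asm)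
  hence "(\<Sum>b\<in>Basis. \<bar>z \<bullet> b\<bar>) \<le> real DIM('a) * h"
    by (intro order_trans[OF sum_bounded_above[where K = h]]) auto
  thus ?thesis using norm_le_l1[of z] by linarith
qed

lemma integrable_scaled_interval: "integrable lborel (\<lambda>t. indicator {-h..h} t / (2 * h) :: real)"
proof -
  have "integrable lborel (indicator {-h..h} :: real \<Rightarrow> real)"
    by (rule integrable_real_indicator) (auto simp: emeasure_lborel_Icc_eq)
  thus ?thesis by (rule Bochner_Integration.integrable_divide)
qed

text \<open>For nonzero \<open>w\<close>, \<open>F\<close> is \<open>sin (w * h) / (w * h)\<close>:
  at most \<open>1\<close> in modulus, and decaying like the reciprocal of its argument.\<close>

lemma ft_interval_bound:
  fixes w h :: real
  assumes h: "h > 0"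
  defines "F \<equiv> \<integral>t. complex_of_real (indicator {-h..h} t / (2 * h)) * cis (- (w * t)) \<partial>lborel"
  shows "cmod F \<le> 1" and "cmod F * \<bar>w\<bar> * h \<le> 1"
proof -
  have "cmod F \<le> (LBINT t. cmod (complex_of_real (indicator {-h..h} t / (2 * h)) * cis (- (w * t))))"
    unfolding F_def by (rule integral_norm_bound)
  also have "\<dots> = (LBINT t. indicator {-h..h} t / (2 * h))"
    using h by (intro Bochner_Integration.integral_cong) (auto simp: norm_mult norm_divide)
  also have "\<dots> = 1" using h by (simp add: measure_def)
  finally show F1: "cmod F \<le> 1" .
  show "cmod F * \<bar>w\<bar> * h \<le> 1"
  proof (cases "w = 0")
    case False
    have "(LBINT t. indicator {-h..h} t *\<^sub>R cis (- (w * t))) = \<i> / w * cis (- (w * h)) - \<i> / w * cis (- (w * - h))"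
    proof (rule integral_FTC_atLeastAtMost)
      show "- h \<le> h" using h by simp
      show "continuous_on {-h..h} (\<lambda>t. cis (- (w * t)))" by (intro continuous_intros)
      fix t
      have "((\<lambda>t. \<i> / w * cis (- (w * t))) has_vector_derivative \<i> / w * (- w *\<^sub>R (\<i> * cis (- (w * t))))) (at t within {-h..h})"
        unfolding cis_conv_exp
        by (auto intro!: derivative_eq_intros has_vector_derivative_real_field simp: scaleR_conv_of_real field_simps)
      thus "((\<lambda>t. \<i> / w * cis (- (w * t))) has_vector_derivative cis (- (w * t))) (at t within {-h..h})"
        using False by (simp add: scaleR_conv_of_real field_simps)
    qed
    moreover have "F = (1 / (2 * h)) *\<^sub>R (LBINT t. indicator {-h..h} t *\<^sub>R cis (- (w * t)))"
      unfolding F_def integral_scaleR_right[symmetric]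
      by (intro Bochner_Integration.integral_cong) (auto simp: scaleR_conv_of_real field_simps)
    ultimately have "F = (1 / (2 * h)) *\<^sub>R (\<i> / w * (cis (- (w * h)) - cis (w * h)))"
      by (simp add: right_diff_distrib)
    hence "cmod F = cmod (cis (- (w * h)) - cis (w * h)) / (2 * h * \<bar>w\<bar>)"
      using h by (simp add: norm_mult norm_divide)
    also have "\<dots> \<le> 2 / (2 * h * \<bar>w\<bar>)"
      using h norm_triangle_ineq4[of "cis (- (w * h))" "cis (w * h)"] by (intro divide_right_mono) auto
    finally show ?thesis using False h by (simp add: field_simps)
  qed simp
qed

lemma box_kernel_integral:
  assumes h: "h > 0"
  shows "integrable lborel (box_kernel h :: 'a::euclidean_space \<Rightarrow> complex)"
    and "(LBINT z. cmod (box_kernel h (z::'a))) = 1"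
    and "(LBINT z. box_kernel h (z::'a)) = 1"
proof -
  let ?f = "\<lambda>t. complex_of_real (indicator {-h..h} t / (2 * h))"
  have i: "integrable lborel ?f"
    unfolding complex_of_real_integrable_eq by (rule integrable_scaled_interval)
  have e: "(LBINT t. ?f t) = 1"
    unfolding integral_complex_of_real using h by (simp add: measure_def)
  show "integrable lborel (box_kernel h :: 'a \<Rightarrow> complex)"
    unfolding box_kernel_def by (rule lborel_integral_prod(1)) (rule i)
  show 1: "(LBINT z. box_kernel h (z::'a)) = 1"
    unfolding box_kernel_def by (subst lborel_integral_prod(2)) (use i e in auto)
  have "complex_of_real (LBINT z. cmod (box_kernel h (z::'a))) = 1"
    unfolding integral_complex_of_real[symmetric] box_kernel_nonneg[OF h, symmetric] by (rule 1)
  thus "(LBINT z. cmod (box_kernel h (z::'a))) = 1" by (simp only: of_real_eq_1_iff)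
qed

text \<open>Each coordinate factor has modulus at most \<open>1\<close>, so the product is bounded
  by any single factor. The decay of factor \<open>b\<close> then controls the term
  \<open>(\<omega> \<bullet> b)\<^sup>2\<close> of the squared norm, and the \<open>DIM('a)\<close>
  terms are added.\<close>

lemma ft_box_kernel_bound:
  assumes h: "h > 0"
  shows "(cmod (ft (box_kernel h) (\<omega>::'a::euclidean_space)))\<^sup>2 * (1 + (norm \<omega>)\<^sup>2) \<le> 1 + real DIM('a) / h\<^sup>2"
proof -
  define F where "F b = (LBINT t. complex_of_real (indicator {-h..h} t / (2 * h)) * cis (- ((\<omega> \<bullet> b) * t)))" for b
  have F1: "cmod (F b) \<le> 1" and F2: "cmod (F b) * \<bar>\<omega> \<bullet> b\<bar> * h \<le> 1" for b
    unfolding F_def using ft_interval_bound[OF h] by auto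
  have i: "integrable lborel (\<lambda>t. complex_of_real (indicator {-h..h} t / (2 * h)) * cis (- ((\<omega> \<bullet> b) * t)))" for b
    using integrable_scaled_interval[of h] unfolding complex_of_real_integrable_eq[symmetric]
    by (rule integrable_mult_cis) simp
  have "ft (box_kernel h) \<omega> = (LBINT x. (\<Prod>b\<in>Basis. complex_of_real (indicator {-h..h} (x \<bullet> b) / (2 * h)) * cis (- ((\<omega> \<bullet> b) * (x \<bullet> b)))))"
    unfolding ft_def box_kernel_def prod.distrib
  proof (intro Bochner_Integration.integral_cong refl arg_cong2[where f = "(*)"])
    fix x
    have "- (\<omega> \<bullet> x) = (\<Sum>b\<in>Basis. - ((\<omega> \<bullet> b) * (x \<bullet> b)))"
      by (subst euclidean_inner) (simp add: sum_negf)
    thus "cis (- (\<omega> \<bullet> x)) = (\<Prod>b\<in>Basis. cis (- ((\<omega> \<bullet> b) * (x \<bullet> b))))"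
      by (simp add: cis_conv_exp exp_sum[OF finite_Basis, symmetric] sum_distrib_left)
  qed
  also have "\<dots> = (\<Prod>b\<in>Basis. F b)"
    unfolding F_def by (rule lborel_integral_prod(2)) (rule i)
  finally have ft: "cmod (ft (box_kernel h) \<omega>) = (\<Prod>b\<in>Basis. cmod (F b))"
    by (simp add: prod_norm)
  define P where "P = cmod (ft (box_kernel h) \<omega>)"
  have P0: "P \<ge> 0" by (simp add: P_def)
  have P1: "P \<le> 1" unfolding P_def ft by (intro prod_le_1) (auto simp: F1)
  have Pb: "P \<le> cmod (F b)" if "b \<in> Basis" for b
  proof -
    have "P = cmod (F b) * (\<Prod>b\<in>Basis - {b}. cmod (F b))"
      unfolding P_def ft using that by (subst prod.remove[of _ b]) auto
    also have "\<dots> \<le> cmod (F b) * 1"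
      by (intro mult_left_mono prod_le_1) (auto simp: F1)
    finally show ?thesis by simp
  qed
  have Pw: "P\<^sup>2 * (\<omega> \<bullet> b)\<^sup>2 \<le> 1 / h\<^sup>2" if "b \<in> Basis" for b
  proof -
    have "P * \<bar>\<omega> \<bullet> b\<bar> * h \<le> cmod (F b) * \<bar>\<omega> \<bullet> b\<bar> * h"
      using Pb[OF that] h by (intro mult_right_mono) auto
    hence "P * \<bar>\<omega> \<bullet> b\<bar> * h \<le> 1" using F2[of b] by linarith
    hence "P * \<bar>\<omega> \<bullet> b\<bar> \<le> 1 / h" using h by (simp add: field_simps)
    hence "(P * \<bar>\<omega> \<bullet> b\<bar>)\<^sup>2 \<le> (1 / h)\<^sup>2" using P0 by (intro power_mono) auto
    thus ?thesis by (simp add: power_mult_distrib power_divide)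
  qed
  have "P\<^sup>2 * (norm \<omega>)\<^sup>2 \<le> real DIM('a) / h\<^sup>2"
    using sum_bounded_above[of "Basis :: 'a set" "\<lambda>b. P\<^sup>2 * (\<omega> \<bullet> b)\<^sup>2" "1 / h\<^sup>2"] Pw
    by (simp add: norm_sq_Basis sum_distrib_left)
  moreover have "P\<^sup>2 \<le> 1" using P0 P1 by (simp add: power_le_one)
  ultimately show ?thesis unfolding P_def[symmetric] by (simp add: distrib_left)
qed

text \<open>Iterated box averages take the place of smooth bump functions: the support stays compact, and
  the Fourier transform gains one order of decay with each average.\<close>

definition mollify :: "real \<Rightarrow> nat \<Rightarrow> ('a::euclidean_space \<Rightarrow> complex) \<Rightarrow> 'a \<Rightarrow> complex" where
  "mollify h N k = ((\<lambda>u. conv u (box_kernel h)) ^^ N) k"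

lemma conv_box_kernel_bounded:
  fixes u :: "'a::euclidean_space \<Rightarrow> complex"
  assumes h: "h > 0" and [measurable]: "u \<in> borel_measurable borel" and b: "\<And>x. cmod (u x) \<le> 1"
  shows "cmod (conv u (box_kernel h) x) \<le> 1"
proof -
  have "cmod (conv u (box_kernel h) x) \<le> (LBINT t. cmod (u (x - t) * box_kernel h t))"
    unfolding conv_def by (rule integral_norm_bound)
  also have "\<dots> \<le> (LBINT t. cmod (box_kernel h (t::'a)))"
    using box_kernel_integral(1)[OF h, where 'a = 'a] b
    by (intro integral_mono_AE') (auto simp: norm_mult intro!: mult_left_le_one_le)
  finally show ?thesis by (simp add: box_kernel_integral(2)[OF h])
qed

text \<open>Averaging reproduces constants because the kernel has mass \<open>1\<close>, and it
  looks no further than the support of the kernel, so the radius shrinks by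
  \<open>DIM('a) * h\<close>.\<close>

lemma conv_box_kernel_local_const:
  fixes u :: "'a::euclidean_space \<Rightarrow> complex"
  assumes h: "h > 0" and u: "\<And>y. dist x y < r \<Longrightarrow> u y = a" and y: "dist x y < r - real DIM('a) * h"
  shows "conv u (box_kernel h) y = a"
proof -
  have "u (y - t) * box_kernel h t = a * box_kernel h t" for t
  proof (cases "box_kernel h t = 0")
    case False
    from box_kernel_support[OF this] have "norm t \<le> real DIM('a) * h" .
    moreover have "dist x (y - t) \<le> dist x y + norm t"
      using dist_triangle[of x "y - t" y] by (simp add: dist_norm)
    ultimately have "dist x (y - t) < r" using y by linarith
    thus ?thesis by (simp add: u)
  qed simp
  hence "conv u (box_kernel h) y = (LBINT t. a * box_kernel h (t::'a))"
    unfolding conv_def by (simp only:)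
  thus ?thesis by (simp add: box_kernel_integral(3)[OF h])
qed

lemma mollify_properties:
  fixes k :: "'a::euclidean_space \<Rightarrow> complex"
  assumes h: "h > 0" and k: "integrable lborel k" and b: "\<And>x. cmod (k x) \<le> 1"
  shows "integrable lborel (mollify h N k)" and "cmod (mollify h N k x) \<le> 1"
    and "ft (mollify h N k) \<omega> = ft k \<omega> * ft (box_kernel h) \<omega> ^ N"
proof -
  have "integrable lborel (mollify h N k) \<and> (\<forall>x. cmod (mollify h N k x) \<le> 1)
      \<and> ft (mollify h N k) \<omega> = ft k \<omega> * ft (box_kernel h) \<omega> ^ N"
  proof (induction N)
    case 0 thus ?case using k b by (simp add: mollify_def)
  next
    case (Suc N)
    let ?u = "mollify h N k"
    have eq: "mollify h (Suc N) k = conv ?u (box_kernel h)" by (simp add: mollify_def)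
    have [measurable]: "?u \<in> borel_measurable borel"
      using Suc borel_measurable_integrable[of lborel ?u] by simp
    show ?case
      unfolding eq using Suc box_kernel_integral(1)[OF h, where 'a = 'a]
      by (auto simp: ft_conv intro!: integrable_conv conv_box_kernel_bounded[OF h])
  qed
  thus "integrable lborel (mollify h N k)" "cmod (mollify h N k x) \<le> 1"
    "ft (mollify h N k) \<omega> = ft k \<omega> * ft (box_kernel h) \<omega> ^ N" by auto
qed

text \<open>Serves with \<open>a = 0\<close> to locate the support, and with \<open>a\<close> the
  value of an indicator to get pointwise convergence as \<open>h\<close> shrinks.\<close>

lemma mollify_local_const:
  fixes k :: "'a::euclidean_space \<Rightarrow> complex"
  assumes h: "h > 0" and k: "\<And>y. dist x y < r \<Longrightarrow> k y = a" and y: "dist x y < r - real N * (real DIM('a) * h)"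
  shows "mollify h N k y = a"
  using y
proof (induction N arbitrary: y)
  case 0 thus ?case using k by (simp add: mollify_def)
next
  case (Suc N)
  have "mollify h (Suc N) k y = conv (mollify h N k) (box_kernel h) y" by (simp add: mollify_def)
  also have "\<dots> = a"
    by (rule conv_box_kernel_local_const[OF h, of x "r - real N * (real DIM('a) * h)"])
       (use Suc in \<open>auto simp: algebra_simps\<close>)
  finally show ?case .
qed

text \<open>The number of averages is even because \<open>ft_box_kernel_bound\<close> controls a
  squared modulus: two averages give one factor
  \<open>1 / (1 + (norm \<omega>)\<^sup>2)\<close>.\<close>

lemma ft_mollify_bound:
  fixes k :: "'a::euclidean_space \<Rightarrow> complex"
  assumes h: "h > 0" and k: "integrable lborel k" and b: "\<And>x. cmod (k x) \<le> 1"
  shows "\<exists>A. \<forall>\<omega>. cmod (ft (mollify h (2 * N) k) \<omega>) \<le> A * (1 + (norm \<omega>)\<^sup>2) powr (- real N)"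
proof (intro exI allI)
  fix \<omega> :: 'a
  define M where "M = 1 + real DIM('a) / h\<^sup>2"
  define U where "U = (LBINT x. cmod (k x))"
  have U: "cmod (ft k \<omega>) \<le> U" unfolding U_def by (rule norm_ft_le)
  have U0: "U \<ge> 0" by (simp add: U_def)
  have p: "1 + (norm \<omega>)\<^sup>2 > 0" by (simp add: add_pos_nonneg)
  have "(cmod (ft (box_kernel h) \<omega>))\<^sup>2 \<le> M / (1 + (norm \<omega>)\<^sup>2)"
    using ft_box_kernel_bound[OF h, of \<omega>] p by (simp add: M_def field_simps)
  hence "((cmod (ft (box_kernel h) \<omega>))\<^sup>2) ^ N \<le> (M / (1 + (norm \<omega>)\<^sup>2)) ^ N"
    by (intro power_mono) auto
  moreover have "(M / (1 + (norm \<omega>)\<^sup>2)) ^ N = M ^ N * (1 + (norm \<omega>)\<^sup>2) powr (- real N)"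
    using p by (simp add: power_divide powr_minus_divide powr_realpow)
  ultimately have 1: "cmod (ft (box_kernel h) \<omega>) ^ (2 * N) \<le> M ^ N * (1 + (norm \<omega>)\<^sup>2) powr (- real N)"
    by (simp add: power_mult)
  have "cmod (ft (mollify h (2 * N) k) \<omega>) = cmod (ft k \<omega>) * cmod (ft (box_kernel h) \<omega>) ^ (2 * N)"
    by (simp add: mollify_properties(3)[OF h k b] norm_mult norm_power)
  also have "\<dots> \<le> U * (M ^ N * (1 + (norm \<omega>)\<^sup>2) powr (- real N))"
    using U U0 1 by (intro mult_mono) auto
  finally show "cmod (ft (mollify h (2 * N) k) \<omega>) \<le> (U * M ^ N) * (1 + (norm \<omega>)\<^sup>2) powr (- real N)"
    by (simp add: mult.assoc)
qed

section \<open>Sobolev regularity and the integral equation\<close>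

lemma ft_trunc_eq_ft:
  fixes f :: "'a::euclidean_space \<Rightarrow> real"
  assumes [measurable]: "f \<in> borel_measurable borel"
  shows "ft_trunc f R \<omega> = ft (\<lambda>x. indicator (ball 0 R) x *\<^sub>R complex_of_real (f x)) \<omega>"
proof -
  have [measurable]: "ball (0::'a) R \<in> sets borel" by simp
  have "ft_trunc f R \<omega> = (LBINT x. indicator (ball 0 R) x *\<^sub>R (f x *\<^sub>R cis (- (\<omega> \<bullet> x))))"
    unfolding ft_trunc_def set_lebesgue_integral_def by (rule integral_completion) measurable
  also have "\<dots> = ft (\<lambda>x. indicator (ball 0 R) x *\<^sub>R complex_of_real (f x)) \<omega>"
    unfolding ft_def by (simp add: scaleR_conv_of_real mult.assoc)
  finally show ?thesis .
qed

text \<open>\<open>sobolev_space\<close> speaks of Lebesgue-measurable functions, whereas the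
  transform theory above is Borel; a representative bridges the two.\<close>

lemma lebesgue_ex_borel_complex:
  fixes g :: "'a::euclidean_space \<Rightarrow> complex"
  assumes [measurable]: "g \<in> borel_measurable lebesgue"
  obtains g' where "g' \<in> borel_measurable borel" "AE x in lborel. g x = g' x"
proof -
  have "(\<lambda>x. Re (g x)) \<in> borel_measurable lebesgue" "(\<lambda>x. Im (g x)) \<in> borel_measurable lebesgue"
    by measurable
  from this[THEN completion_ex_borel_measurable_real]
  obtain a b where [measurable]: "a \<in> borel_measurable lborel" "b \<in> borel_measurable lborel"
    and ab: "AE x in lborel. Re (g x) = a x" "AE x in lborel. Im (g x) = b x" by auto
  show ?thesis
  proof (rule that[of "\<lambda>x. complex_of_real (a x) + \<i> * complex_of_real (b x)"])
    show "AE x in lborel. g x = complex_of_real (a x) + \<i> * complex_of_real (b x)"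
      using ab by eventually_elim (auto simp: complex_eq_iff)
  qed simp
qed

lemma nn_integral_lebesgue_borel_AE:
  fixes u v :: "'a::euclidean_space \<Rightarrow> ennreal"
  assumes "AE x in lborel. u x = v x"
  shows "(\<integral>\<^sup>+x. u x \<partial>lebesgue) = (\<integral>\<^sup>+x. v x \<partial>lborel)"
proof -
  have "(\<integral>\<^sup>+x. u x \<partial>lebesgue) = (\<integral>\<^sup>+x. v x \<partial>lebesgue)"
    by (intro nn_integral_cong_AE AE_completion assms)
  also have "\<dots> = (\<integral>\<^sup>+x. v x \<partial>lborel)" by (rule nn_integral_completion)
  finally show ?thesis .
qed

lemma nn_integral_sq_integrable:
  "sq_integrable M u \<Longrightarrow> (\<integral>\<^sup>+x. ennreal ((cmod (u x))\<^sup>2) \<partial>M) = ennreal (\<integral>x. (cmod (u x))\<^sup>2 \<partial>M)"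
  by (intro nn_integral_eq_integral sq_integrable_norm2) auto

lemma sq_integrableI_nn:
  assumes [measurable]: "u \<in> borel_measurable M" and "(\<integral>\<^sup>+x. ennreal ((cmod (u x))\<^sup>2) \<partial>M) < \<infinity>"
  shows "sq_integrable M u"
  unfolding sq_integrable_def using assms(2) by (auto intro!: integrableI_bounded)

lemma integrable_local_sq_integrable:
  assumes V: "sq_integrable lborel (V::'a::euclidean_space \<Rightarrow> complex)"
  shows "integrable lborel (\<lambda>x. indicator (ball 0 R) x *\<^sub>R V x)"
proof -
  have "integrable lborel (\<lambda>x::'a. complex_of_real (indicator (ball 0 R) x))"
    using emeasure_lborel_ball_finite[of "0::'a" R] by simp
  hence "sq_integrable lborel (\<lambda>x::'a. complex_of_real (indicator (ball 0 R) x))"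
    by (rule sq_integrable_if_bounded[where B = 1]) auto
  from sq_integrable_mult_integrable[OF this V] show ?thesis
    by (simp add: scaleR_conv_of_real)
qed

context spectral_kernel
begin

section \<open>Sobolev regularity of convolutions with the kernel\<close>

lemma conv_K_in_sobolev_space:
  fixes E :: "'a \<Rightarrow> real"
  assumes v: "integrable lborel v" "sq_integrable lborel v"
    and E: "\<And>x. complex_of_real (E x) = conv (\<lambda>x. complex_of_real (K x)) v x"
  shows "E \<in> sobolev_space (2 * m)"
proof -
  have [measurable]: "v \<in> borel_measurable borel" using borel_measurable_integrable[OF v(1)] by simp
  have [measurable]: "ball (0::'a) R \<in> sets borel" for R by simp
  have KC: "integrable lborel (\<lambda>x. complex_of_real (K x))" using K_integrable by simp
  define e where "e x = complex_of_real (E x)" for x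
  have e: "e = conv (\<lambda>x. complex_of_real (K x)) v" by (auto simp: e_def E)
  have [measurable]: "e \<in> borel_measurable borel" unfolding e by measurable
  have "E = (\<lambda>x. Re (e x))" by (simp add: e_def)
  hence Em [measurable]: "E \<in> borel_measurable borel" by simp
  have ei: "integrable lborel e" unfolding e by (rule integrable_conv[OF KC v(1)])
  have eb: "cmod (e x) \<le> (LBINT t. (LBINT \<omega>. S \<omega>) * cmod (v t))" for x
  proof -
    have "cmod (e x) \<le> (LBINT t. cmod (complex_of_real (K (x - t)) * v t))"
      unfolding e conv_def by (rule integral_norm_bound)
    also have "\<dots> \<le> (LBINT t. (LBINT \<omega>. S \<omega>) * cmod (v t))"
    proof (rule integral_mono_AE')
      show "AE t in lborel. cmod (complex_of_real (K (x - t)) * v t) \<le> (LBINT \<omega>. S \<omega>) * cmod (v t)"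
        using K_bounded by (intro AE_I2) (auto simp: norm_mult intro!: mult_right_mono)
      show "AE t in lborel. 0 \<le> (LBINT \<omega>. S \<omega>) * cmod (v t)"
        using S_pos by (intro AE_I2 mult_nonneg_nonneg integral_nonneg_AE) (auto intro: less_imp_le)
    qed (use v in simp)
    finally show ?thesis .
  qed
  have e2: "sq_integrable lborel e" by (rule sq_integrable_if_bounded[OF ei eb])
  have fe: "ft e \<omega> = complex_of_real ((2 * pi) ^ DIM('a) * S \<omega>) * ft v \<omega>" for \<omega>
    unfolding e ft_conv[OF KC v(1)] ft_K ..
  \<comment> \<open>As \<open>e\<close> is integrable, its classical transform is the witness for
    \<open>sobolev_space\<close>. The truncation error is the transform of the part of
    \<open>e\<close> outside the ball, which the L2 bound sends to zero.\<close>
  define tail where "tail n x = indicator (- ball 0 (real n)) x *\<^sub>R e x" for n x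
  have [measurable]: "tail n \<in> borel_measurable borel" for n unfolding tail_def by measurable
  have ti: "integrable lborel (tail n)" for n
    by (rule Bochner_Integration.integrable_bound[OF ei]) (simp, auto simp: tail_def split: split_indicator)
  have t2: "sq_integrable lborel (tail n)" for n
    by (rule sq_integrable_bound[OF e2, where C = 1]) (simp, auto simp: tail_def split: split_indicator)
  have diff: "ft e \<omega> - ft_trunc E (real n) \<omega> = ft (tail n) \<omega>" for n \<omega>
  proof -
    have "integrable lborel (\<lambda>x. indicator (ball 0 (real n)) x *\<^sub>R e x)"
      by (rule integrable_local_sq_integrable[OF e2])
    from ft_diff[OF ei this, of \<omega>] show ?thesis
      unfolding ft_trunc_eq_ft[OF Em] e_def[symmetric]
      by (simp add: tail_def[abs_def] indicator_compl scaleR_diff_left)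
  qed
  have tlim: "(\<lambda>n. \<integral>x. (cmod (tail n x))\<^sup>2 \<partial>lborel) \<longlonglongrightarrow> (\<integral>x. 0 \<partial>(lborel :: 'a measure))"
  proof (rule integral_dominated_convergence[where w = "\<lambda>x. (cmod (e x))\<^sup>2"])
    show "AE x in lborel. (\<lambda>n. (cmod (tail n x))\<^sup>2) \<longlonglongrightarrow> 0"
    proof (rule AE_I2)
      fix x :: 'a
      obtain N :: nat where N: "norm x < real N" using reals_Archimedean2 by blast
      have "\<forall>\<^sub>F n in sequentially. (cmod (tail n x))\<^sup>2 = 0"
        using N by (intro eventually_sequentiallyI[of N]) (auto simp: tail_def)
      thus "(\<lambda>n. (cmod (tail n x))\<^sup>2) \<longlonglongrightarrow> 0" by (rule tendsto_eventually)
    qed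
    show "AE x in lborel. norm ((cmod (tail n x))\<^sup>2) \<le> (cmod (e x))\<^sup>2" for n
      by (intro AE_I2) (auto simp: tail_def split: split_indicator)
  qed (use sq_integrable_norm2[OF e2] in auto)
  let ?c = "(2 * pi) ^ DIM('a)"
  show ?thesis
    unfolding sobolev_space_def
  proof (intro CollectI conjI exI)
    show "E \<in> borel_measurable lebesgue" by (rule measurable_completion) simp
    have "(\<integral>\<^sup>+x. ennreal ((E x)\<^sup>2) \<partial>lebesgue) = (\<integral>\<^sup>+x. ennreal ((cmod (e x))\<^sup>2) \<partial>lborel)"
      by (rule nn_integral_lebesgue_borel_AE) (auto simp: e_def)
    thus "(\<integral>\<^sup>+x. ennreal ((E x)\<^sup>2) \<partial>lebesgue) < \<infinity>"
      by (simp add: nn_integral_sq_integrable[OF e2])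
    show "ft e \<in> borel_measurable lebesgue" by (rule measurable_completion) simp
    have "(\<integral>\<^sup>+\<omega>. ennreal ((1 + (norm \<omega>)\<^sup>2) powr (2 * m) * (cmod (ft e \<omega>))\<^sup>2) \<partial>lebesgue)
        = (\<integral>\<^sup>+\<omega>. ennreal ((1 + (norm \<omega>)\<^sup>2) powr (2 * m) * (cmod (ft e \<omega>))\<^sup>2) \<partial>lborel)"
      by (rule nn_integral_lebesgue_borel_AE) auto
    \<comment> \<open>The transform of \<open>e\<close> is \<open>?c * S\<close> times that of
      \<open>v\<close>. The upper bound on \<open>S\<close> absorbs
      \<open>(1 + (norm \<omega>)\<^sup>2) powr m\<close>, and squaring gives exactly the weight of
      order \<open>2 * m\<close>.\<close>
    also have "\<dots> \<le> (\<integral>\<^sup>+\<omega>. ennreal ((cmod (complex_of_real (?c * C) * ft v \<omega>))\<^sup>2) \<partial>lborel)"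
    proof (intro nn_integral_mono ennreal_leI)
      fix \<omega> :: 'a
      have p: "1 + (norm \<omega>)\<^sup>2 > 0" by (rule one_plus_norm_pos)
      have "(1 + (norm \<omega>)\<^sup>2) powr m * S \<omega> \<le> (1 + (norm \<omega>)\<^sup>2) powr m * (C * (1 + (norm \<omega>)\<^sup>2) powr (- m))"
        using S_upper[of \<omega>] by (intro mult_left_mono) auto
      also have "\<dots> = C" using p by (simp add: powr_minus)
      finally have "(1 + (norm \<omega>)\<^sup>2) powr m * S \<omega> \<le> C" .
      hence "((1 + (norm \<omega>)\<^sup>2) powr m * S \<omega>)\<^sup>2 \<le> C\<^sup>2"
        using S_pos[of \<omega>] by (intro power_mono) auto
      hence "(?c * cmod (ft v \<omega>))\<^sup>2 * ((1 + (norm \<omega>)\<^sup>2) powr m * S \<omega>)\<^sup>2 \<le> (?c * cmod (ft v \<omega>))\<^sup>2 * C\<^sup>2"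
        by (intro mult_left_mono) auto
      moreover have "(1 + (norm \<omega>)\<^sup>2) powr (2 * m) = ((1 + (norm \<omega>)\<^sup>2) powr m)\<^sup>2"
        using p by (simp add: powr_power mult.commute)
      ultimately show "(1 + (norm \<omega>)\<^sup>2) powr (2 * m) * (cmod (ft e \<omega>))\<^sup>2 \<le> (cmod (complex_of_real (?c * C) * ft v \<omega>))\<^sup>2"
        unfolding fe norm_mult norm_of_real power_mult_distrib abs_mult power2_abs by (simp add: mult_ac)
    qed
    also have "\<dots> < \<infinity>"
      unfolding nn_integral_sq_integrable[OF sq_integrable_scale[OF ft_L2_bound(1)[OF v]]] by simp
    finally show "(\<integral>\<^sup>+\<omega>. ennreal ((1 + (norm \<omega>)\<^sup>2) powr (2 * m) * (cmod (ft e \<omega>))\<^sup>2) \<partial>lebesgue) < \<infinity>" .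
    have le: "(\<integral>\<^sup>+\<omega>. ennreal ((cmod (ft e \<omega> - ft_trunc E (real n) \<omega>))\<^sup>2) \<partial>lebesgue)
        \<le> ennreal (?c * (LBINT x. (cmod (tail n x))\<^sup>2))" for n
    proof -
      have "(\<integral>\<^sup>+\<omega>. ennreal ((cmod (ft e \<omega> - ft_trunc E (real n) \<omega>))\<^sup>2) \<partial>lebesgue)
         = (\<integral>\<^sup>+\<omega>. ennreal ((cmod (ft (tail n) \<omega>))\<^sup>2) \<partial>lborel)"
        by (rule nn_integral_lebesgue_borel_AE) (auto simp: diff)
      also have "\<dots> \<le> ennreal (?c * (LBINT x. (cmod (tail n x))\<^sup>2))"
        unfolding nn_integral_sq_integrable[OF ft_L2_bound(1)[OF ti t2]]
        by (intro ennreal_leI ft_L2_bound(2)[OF ti t2])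
      finally show ?thesis .
    qed
    have lim0: "(\<lambda>n. ennreal (?c * (LBINT x. (cmod (tail n x))\<^sup>2))) \<longlonglongrightarrow> 0"
    proof -
      have "(\<lambda>n. ennreal (?c * (LBINT x. (cmod (tail n x))\<^sup>2))) \<longlonglongrightarrow> ennreal (?c * (\<integral>x. 0 \<partial>(lborel :: 'a measure)))"
        by (intro tendsto_intros tlim)
      thus ?thesis by simp
    qed
    show "(\<lambda>n. \<integral>\<^sup>+\<omega>. ennreal ((cmod (ft e \<omega> - ft_trunc E (real n) \<omega>))\<^sup>2) \<partial>lebesgue) \<longlonglongrightarrow> 0"
      by (rule tendsto_sandwich[OF always_eventually always_eventually tendsto_const lim0])
         (intro allI zero_le le)+
  qed
qed

section \<open>From Sobolev regularity to a square-integrable quotient\<close>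

lemma synth_eq_ft: "synth q x = ft (\<lambda>\<omega>. q \<omega> * rootS \<omega>) (- x)"
  unfolding synth_def ft_def by (simp add: inner_commute mult.assoc)

lemma synth_measurable:
  assumes "sq_integrable lborel q"
  shows "synth q \<in> borel_measurable borel"
proof -
  have [measurable]: "q \<in> borel_measurable borel" using sq_integrable_measurable[OF assms] by simp
  show ?thesis unfolding synth_def by measurable
qed

lemma synth_bounded:
  assumes "sq_integrable lborel q"
  shows "cmod (synth q x) \<le> (LBINT \<omega>. cmod (q \<omega> * rootS \<omega>))"
  unfolding synth_eq_ft by (rule norm_ft_le)

text \<open>\<open>synth\<close> yields a bounded measurable function, with no integrability at
  hand; cutting it off at radius \<open>R\<close> puts it into L1 and L2, where the transform is
  available.\<close>

lemma synth_real_truncation: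
  fixes E :: "'a \<Rightarrow> real"
  assumes q: "sq_integrable lborel q" and E: "\<And>x. complex_of_real (E x) = synth q x"
  shows "E \<in> borel_measurable borel" and "\<bar>E x\<bar> \<le> (LBINT \<omega>. cmod (q \<omega> * rootS \<omega>))"
    and "integrable lborel (\<lambda>x. indicator (ball 0 R) x *\<^sub>R complex_of_real (E x))"
    and "sq_integrable lborel (ft_trunc E R)"
proof -
  have [measurable]: "synth q \<in> borel_measurable borel" by (rule synth_measurable[OF q])
  have [measurable]: "ball (0::'a) R \<in> sets borel" by simp
  have "E = (\<lambda>x. Re (synth q x))" by (simp add: E[symmetric])
  thus Em [measurable]: "E \<in> borel_measurable borel" by simp
  define B where "B = (LBINT \<omega>. cmod (q \<omega> * rootS \<omega>))"
  have Eb: "\<bar>E x\<bar> \<le> B" for x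
    using synth_bounded[OF q, of x] unfolding B_def E[symmetric] by simp
  thus "\<bar>E x\<bar> \<le> (LBINT \<omega>. cmod (q \<omega> * rootS \<omega>))" unfolding B_def .
  have B0: "B \<ge> 0" by (simp add: B_def)
  let ?u = "\<lambda>x. indicator (ball 0 R) x *\<^sub>R complex_of_real (E x)"
  have ub: "cmod (?u x) \<le> B" for x using Eb[of x] B0 by (auto split: split_indicator)
  show ui: "integrable lborel ?u"
  proof (rule Bochner_Integration.integrable_bound)
    show "integrable lborel (\<lambda>x::'a. B * indicator (ball 0 R) x)"
      using emeasure_lborel_ball_finite[of "0::'a" R] by simp
    show "AE x in lborel. norm (?u x) \<le> norm (B * indicator (ball 0 R) x)"
      using Eb B0 by (intro AE_I2) (auto split: split_indicator)
  qed simp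
  show "sq_integrable lborel (ft_trunc E R)" unfolding ft_trunc_eq_ft[OF Em, abs_def]
    by (rule ft_L2_bound(1)[OF ui sq_integrable_if_bounded[OF ui ub]])
qed

text \<open>Both sides have the same pairing with every modulated Gaussian.\<close>

lemma sobolev_ft_eq:
  fixes E :: "'a \<Rightarrow> real"
  assumes q: "sq_integrable lborel q" and E: "\<And>x. complex_of_real (E x) = synth q x"
    and g: "sq_integrable lborel g"
    and lim: "(\<lambda>n. \<integral>\<omega>. (cmod (ft_trunc E (real n) \<omega> - g \<omega>))\<^sup>2 \<partial>lborel) \<longlonglongrightarrow> 0"
  shows "AE \<omega> in lborel. g \<omega> = complex_of_real ((2 * pi) ^ DIM('a)) * (q \<omega> * rootS \<omega>)"
proof -
  let ?c = "(2 * pi) ^ DIM('a)"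
  have [measurable]: "q \<in> borel_measurable borel" "g \<in> borel_measurable borel"
    using sq_integrable_measurable[OF q] sq_integrable_measurable[OF g] by auto
  have [measurable]: "ball (0::'a) R \<in> sets borel" for R by simp
  have [measurable]: "synth q \<in> borel_measurable borel" by (rule synth_measurable[OF q])
  note Em [measurable] = synth_real_truncation(1)[OF q E]
  define B where "B = (LBINT \<omega>. cmod (q \<omega> * rootS \<omega>))"
  have Eb: "\<bar>E x\<bar> \<le> B" for x
    unfolding B_def by (rule synth_real_truncation(2)[OF q E])
  have qR: "integrable lborel (\<lambda>\<omega>. q \<omega> * rootS \<omega>)"
    by (rule sq_integrable_mult_integrable[OF q sq_integrable_rootS])
  have qR2: "sq_integrable lborel (\<lambda>\<omega>. q \<omega> * rootS \<omega>)"
    using sq_integrable_rootS_mult[OF q] by (simp add: mult.commute)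
  define u where "u n x = indicator (ball 0 (real n)) x *\<^sub>R complex_of_real (E x)" for n x
  have [measurable]: "u n \<in> borel_measurable borel" for n unfolding u_def by measurable
  have B0: "B \<ge> 0" by (simp add: B_def)
  have ub: "cmod (u n x) \<le> B" for n x using Eb[of x] B0 by (auto simp: u_def split: split_indicator)
  have ui: "integrable lborel (u n)" for n
    unfolding u_def by (rule synth_real_truncation(3)[OF q E])
  have fu: "ft_trunc E (real n) = ft (u n)" for n
    unfolding u_def by (rule ext) (rule ft_trunc_eq_ft[OF Em])
  have fu2: "sq_integrable lborel (ft (u n))" for n
    unfolding fu[symmetric] by (rule synth_real_truncation(4)[OF q E])
  define G where "G y \<omega> = complex_of_real (exp (- (1 * (norm \<omega>)\<^sup>2))) * cis (\<omega> \<bullet> y)" for y \<omega> :: 'a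
  have Gi: "integrable lborel (G y)" and Gft: "ft (G y) x = complex_of_real (gauss_kernel 1 (y - x))" for y x
    unfolding G_def using ft_gauss_cis[OF zero_less_one] by auto
  have Gb: "cmod (G y \<omega>) \<le> 1" for y \<omega> by (simp add: G_def norm_mult)
  have Gm [measurable]: "G y \<in> borel_measurable borel" for y unfolding G_def by measurable
  have G2: "sq_integrable lborel (G y)" for y by (rule sq_integrable_if_bounded[OF Gi Gb])
  have Gfi: "integrable lborel (ft (G y))" for y
  proof -
    have "integrable lborel (\<lambda>x. gauss_kernel 1 (y - x))"
      using lborel_integral_reflect(1)[of "gauss_kernel 1" y] gauss_kernel_integral(1)[of 1, where 'a = 'a] by simp
    thus ?thesis unfolding Gft[abs_def] by simp
  qed
  have Gc: "isCont (G y) \<omega>" for y \<omega> unfolding G_def isCont_def by (intro tendsto_intros)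
  have Ginv: "(LBINT x. ft (G y) x * cis (x \<bullet> \<omega>)) = complex_of_real ?c * G y \<omega>" for y \<omega>
    using ft_inversion[OF Gi Gb Gc Gfi, of y \<omega>] by simp
  have pair: "(LBINT \<omega>. g \<omega> * G y \<omega>) = complex_of_real ?c * (LBINT \<omega>. q \<omega> * rootS \<omega> * G y \<omega>)" for y
  proof -
    \<comment> \<open>Inversion for \<open>G y\<close>, in the form that \<open>?c * G y\<close> is
      itself a transform; the reflection turns the inverse transform into \<open>ft\<close>.\<close>
    have ftG: "ft (\<lambda>x. ft (G y) (0 - x)) \<omega> = complex_of_real ?c * G y \<omega>" for \<omega>
    proof -
      have "ft (\<lambda>x. ft (G y) (0 - x)) \<omega> = (LBINT x. ft (G y) (0 - x) * cis ((0 - x) \<bullet> \<omega>))"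
        unfolding ft_def[of "\<lambda>x. ft (G y) (0 - x)"] by (simp add: inner_commute)
      also have "\<dots> = (LBINT x. ft (G y) x * cis (x \<bullet> \<omega>))"
        by (rule lborel_integral_reflect(2)) measurable
      finally show ?thesis unfolding Ginv .
    qed
    \<comment> \<open>One pairing with two limits: on the frequency side by L2 convergence to
      \<open>g\<close>, on the space side by dominated convergence, since \<open>E\<close> is
      bounded and \<open>ft (G y)\<close> integrable.\<close>
    have "(\<lambda>n. \<integral>\<omega>. ft (u n) \<omega> * G y \<omega> \<partial>lborel) \<longlonglongrightarrow> (LBINT \<omega>. g \<omega> * G y \<omega>)"
      using lim unfolding fu by (rule tendsto_integral_L2[OF fu2 g G2])
    moreover have "(\<lambda>n. \<integral>x. u n x * ft (G y) x \<partial>lborel) \<longlonglongrightarrow> (LBINT x. synth q x * ft (G y) x)"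
    proof (rule integral_dominated_convergence[where w = "\<lambda>x. B * cmod (ft (G y) x)"])
      show "integrable lborel (\<lambda>x. B * cmod (ft (G y) x))" using Gfi by simp
      show "AE x in lborel. (\<lambda>n. u n x * ft (G y) x) \<longlonglongrightarrow> synth q x * ft (G y) x"
      proof (rule AE_I2)
        fix x :: 'a
        obtain N :: nat where N: "norm x < real N" using reals_Archimedean2 by blast
        have "\<forall>\<^sub>F n in sequentially. u n x * ft (G y) x = synth q x * ft (G y) x"
          using N by (intro eventually_sequentiallyI[of N]) (auto simp: u_def E)
        thus "(\<lambda>n. u n x * ft (G y) x) \<longlonglongrightarrow> synth q x * ft (G y) x" by (rule tendsto_eventually)
      qed
      show "AE x in lborel. norm (u n x * ft (G y) x) \<le> B * cmod (ft (G y) x)" for n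
        using ub by (intro AE_I2) (auto simp: norm_mult intro!: mult_right_mono)
    qed measurable
    ultimately have "(LBINT \<omega>. g \<omega> * G y \<omega>) = (LBINT x. synth q x * ft (G y) x)"
      unfolding ft_duality[OF ui Gi] by (rule LIMSEQ_unique)
    also have "\<dots> = (LBINT x. synth q (0 - x) * ft (G y) (0 - x))"
      by (rule lborel_integral_reflect(2)[symmetric]) measurable
    also have "\<dots> = (LBINT x. ft (\<lambda>\<omega>. q \<omega> * rootS \<omega>) x * ft (G y) (0 - x))"
      by (simp add: synth_eq_ft)
    also have "\<dots> = (LBINT \<omega>. q \<omega> * rootS \<omega> * ft (\<lambda>x. ft (G y) (0 - x)) \<omega>)"
      by (rule ft_duality[OF qR]) (use Gfi[of y] in \<open>simp add: lborel_integral_reflect(1)[of "ft (G y)" 0, simplified]\<close>)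
    also have "\<dots> = complex_of_real ?c * (LBINT \<omega>. q \<omega> * rootS \<omega> * G y \<omega>)"
      unfolding integral_mult_right_zero[symmetric] ftG by (simp add: mult_ac)
    finally show ?thesis .
  qed
  define d where "d \<omega> = g \<omega> - complex_of_real ?c * (q \<omega> * rootS \<omega>)" for \<omega>
  have d2: "sq_integrable lborel d"
    unfolding d_def by (intro sq_integrable_diff sq_integrable_scale g qR2)
  have di: "integrable lborel (\<lambda>\<omega>. d \<omega> * G 0 \<omega>)"
    by (rule sq_integrable_mult_integrable[OF d2 G2])
  \<comment> \<open>\<open>ft_injective\<close> needs an integrable function; multiplying
    \<open>d\<close> by the nonvanishing Gaussian \<open>G 0\<close> provides one, and the transform
    of the product at \<open>x\<close> is the pairing of \<open>d\<close> with
    \<open>G (- x)\<close>.\<close>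
  have "AE \<omega> in lborel. d \<omega> * G 0 \<omega> = 0"
  proof (rule ft_injective[OF di])
    fix x
    have "ft (\<lambda>\<omega>. d \<omega> * G 0 \<omega>) x = (LBINT \<omega>. g \<omega> * G (- x) \<omega> - complex_of_real ?c * (q \<omega> * rootS \<omega> * G (- x) \<omega>))"
      unfolding ft_def by (intro Bochner_Integration.integral_cong) (auto simp: d_def G_def inner_commute algebra_simps)
    also have "\<dots> = 0"
      using pair[of "- x"] sq_integrable_mult_integrable[OF g G2[of "- x"]] sq_integrable_mult_integrable[OF qR2 G2[of "- x"]]
      by simp
    finally show "ft (\<lambda>\<omega>. d \<omega> * G 0 \<omega>) x = 0" .
  qed
  thus ?thesis by eventually_elim (simp add: d_def G_def)
qed

text \<open>Up to a constant the transform of \<open>E\<close> is \<open>q * rootS\<close>, and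
  \<open>q / rootS\<close> is \<open>q * rootS / S\<close>. Dividing by \<open>S\<close> costs at
  most a factor \<open>(1 + (norm \<omega>)\<^sup>2) powr m / c\<close>, which is what the Sobolev
  weight of order \<open>2 * m\<close> pays for.\<close>

lemma sobolev_divide_rootS:
  fixes E :: "'a \<Rightarrow> real"
  assumes q: "sq_integrable lborel q" and E: "\<And>x. complex_of_real (E x) = synth q x"
    and sob: "E \<in> sobolev_space (2 * m)"
  shows "sq_integrable lborel (\<lambda>\<omega>. q \<omega> / rootS \<omega>)"
proof -
  let ?c = "(2 * pi) ^ DIM('a)"
  have [measurable]: "q \<in> borel_measurable borel" using sq_integrable_measurable[OF q] by simp
  have [measurable]: "ball (0::'a) R \<in> sets borel" for R by simp
  note Em [measurable] = synth_real_truncation(1)[OF q E]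
  have ftm [measurable]: "ft_trunc E R \<in> borel_measurable borel" for R
    unfolding ft_trunc_eq_ft[OF Em, abs_def] by measurable
  obtain g0 where g0: "g0 \<in> borel_measurable lebesgue"
    "(\<integral>\<^sup>+ \<omega>. ennreal ((1 + (norm \<omega>)\<^sup>2) powr (2 * m) * (cmod (g0 \<omega>))\<^sup>2) \<partial>lebesgue) < \<infinity>"
    "(\<lambda>n. \<integral>\<^sup>+ \<omega>. ennreal ((cmod (g0 \<omega> - ft_trunc E (real n) \<omega>))\<^sup>2) \<partial>lebesgue) \<longlonglongrightarrow> 0"
    using sob unfolding sobolev_space_def by blast
  obtain g where [measurable]: "g \<in> borel_measurable borel" and gg: "AE x in lborel. g0 x = g x"
    using lebesgue_ex_borel_complex[OF g0(1)] by blast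
  define w where "w \<omega> = complex_of_real ((1 + (norm \<omega>)\<^sup>2) powr m) * g \<omega>" for \<omega>
  have [measurable]: "w \<in> borel_measurable borel" unfolding w_def by measurable
  have p1: "(1 + (norm (\<omega>::'a))\<^sup>2) powr m \<ge> 1" for \<omega>
    using m_pos by (intro ge_one_powr_ge_zero) auto
  have w2: "sq_integrable lborel w"
  proof (rule sq_integrableI_nn)
    have "(\<integral>\<^sup>+ \<omega>. ennreal ((1 + (norm \<omega>)\<^sup>2) powr (2 * m) * (cmod (g0 \<omega>))\<^sup>2) \<partial>lebesgue)
       = (\<integral>\<^sup>+ \<omega>. ennreal ((cmod (w \<omega>))\<^sup>2) \<partial>lborel)"
    proof (rule nn_integral_lebesgue_borel_AE)
      show "AE \<omega> in lborel. ennreal ((1 + (norm \<omega>)\<^sup>2) powr (2 * m) * (cmod (g0 \<omega>))\<^sup>2) = ennreal ((cmod (w \<omega>))\<^sup>2)"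
        using gg
      proof eventually_elim
        case (elim \<omega>)
        have "(1 + (norm \<omega>)\<^sup>2) powr (2 * m) = ((1 + (norm \<omega>)\<^sup>2) powr m)\<^sup>2"
          using one_plus_norm_pos[of \<omega>] by (simp add: powr_power mult.commute)
        thus ?case using elim by (simp add: w_def norm_mult power_mult_distrib)
      qed
    qed
    thus "(\<integral>\<^sup>+ \<omega>. ennreal ((cmod (w \<omega>))\<^sup>2) \<partial>lborel) < \<infinity>" using g0(2) by simp
  qed simp
  have g2: "sq_integrable lborel g"
  proof (rule sq_integrable_bound[OF w2, where C = 1])
    show "AE \<omega> in lborel. cmod (g \<omega>) \<le> 1 * cmod (w \<omega>)"
    proof (rule AE_I2)
      fix \<omega> :: 'a
      show "cmod (g \<omega>) \<le> 1 * cmod (w \<omega>)"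
        using mult_right_mono[OF p1[of \<omega>], of "cmod (g \<omega>)"] by (simp add: w_def norm_mult)
    qed
  qed simp
  have ft2: "sq_integrable lborel (ft_trunc E R)" for R by (rule synth_real_truncation(4)[OF q E])
  have nneq: "(\<integral>\<^sup>+ \<omega>. ennreal ((cmod (g0 \<omega> - ft_trunc E (real n) \<omega>))\<^sup>2) \<partial>lebesgue)
      = ennreal (LBINT \<omega>. (cmod (ft_trunc E (real n) \<omega> - g \<omega>))\<^sup>2)" for n
  proof -
    have "(\<integral>\<^sup>+ \<omega>. ennreal ((cmod (g0 \<omega> - ft_trunc E (real n) \<omega>))\<^sup>2) \<partial>lebesgue)
      = (\<integral>\<^sup>+ \<omega>. ennreal ((cmod (ft_trunc E (real n) \<omega> - g \<omega>))\<^sup>2) \<partial>lborel)"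
      using gg by (intro nn_integral_lebesgue_borel_AE) (auto simp: norm_minus_commute)
    also have "\<dots> = ennreal (LBINT \<omega>. (cmod (ft_trunc E (real n) \<omega> - g \<omega>))\<^sup>2)"
      by (rule nn_integral_sq_integrable[OF sq_integrable_diff[OF ft2 g2]])
    finally show ?thesis .
  qed
  have lim: "(\<lambda>n. \<integral>\<omega>. (cmod (ft_trunc E (real n) \<omega> - g \<omega>))\<^sup>2 \<partial>lborel) \<longlonglongrightarrow> 0"
    using g0(3) unfolding nneq by (subst (asm) tendsto_ennreal_iff[of _ _ 0, simplified]) auto
  note ae = sobolev_ft_eq[OF q E g2 lim]
  show ?thesis
  proof (rule sq_integrable_bound[OF w2, where C = "1 / (?c * c)"])
    show "AE \<omega> in lborel. cmod (q \<omega> / rootS \<omega>) \<le> 1 / (?c * c) * cmod (w \<omega>)"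
      using ae
    proof eventually_elim
      case (elim \<omega>)
      have "c = (1 + (norm \<omega>)\<^sup>2) powr m * (c * (1 + (norm \<omega>)\<^sup>2) powr (- m))"
        using one_plus_norm_pos[of \<omega>] by (simp add: powr_minus)
      also have "\<dots> \<le> (1 + (norm \<omega>)\<^sup>2) powr m * S \<omega>"
        by (rule mult_left_mono[OF S_lower]) simp
      finally have "cmod (q \<omega> / rootS \<omega>) * c \<le> cmod (q \<omega> / rootS \<omega>) * ((1 + (norm \<omega>)\<^sup>2) powr m * S \<omega>)"
        by (intro mult_left_mono) auto
      also have "\<dots> = (1 + (norm \<omega>)\<^sup>2) powr m * (cmod (q \<omega>) * cmod (rootS \<omega>))"
        using rootS_nz[of \<omega>] unfolding cmod_rootS_sq[of \<omega>, symmetric]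
        by (simp add: norm_divide power2_eq_square)
      also have "\<dots> = cmod (w \<omega>) / ?c"
        unfolding w_def elim by (simp add: norm_mult norm_power)
      finally have "cmod (q \<omega> / rootS \<omega>) * c \<le> cmod (w \<omega>) / ?c" .
      hence "cmod (q \<omega> / rootS \<omega>) \<le> cmod (w \<omega>) / ?c / c"
        using c_pos by (subst pos_le_divide_eq) auto
      thus ?case by simp
    qed
  qed simp
qed

section \<open>Support of the solution\<close>

lemma trig_pairing:
  fixes F :: "'a \<Rightarrow> complex"
  assumes F: "integrable lborel F" and z: "\<And>y. y \<in> snd ` set l \<Longrightarrow> (LBINT \<omega>. F \<omega> * cis (\<omega> \<bullet> (- y))) = 0"
  shows "(LBINT \<omega>. trig l \<omega> * F \<omega>) = 0"
proof -
  have "integrable lborel (\<lambda>\<omega>. trig l \<omega> * F \<omega>) \<and> (LBINT \<omega>. trig l \<omega> * F \<omega>) = 0"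
    using z
  proof (induction l)
    case (Cons p l)
    obtain b y where p: "p = (b, y)" by force
    have 1: "trig (p # l) \<omega> * F \<omega> = complex_of_real b * (F \<omega> * cis (\<omega> \<bullet> (- y))) + trig l \<omega> * F \<omega>" for \<omega>
      by (simp add: p algebra_simps)
    have i: "integrable lborel (\<lambda>\<omega>. complex_of_real b * (F \<omega> * cis (\<omega> \<bullet> (- y))))"
      by (intro integrable_mult_right integrable_mult_cis F) simp
    have IH: "integrable lborel (\<lambda>\<omega>. trig l \<omega> * F \<omega>)" "(LBINT \<omega>. trig l \<omega> * F \<omega>) = 0"
      using Cons by auto
    have "(LBINT \<omega>. F \<omega> * cis (\<omega> \<bullet> (- y))) = 0" using Cons.prems[of y] by (simp add: p)
    hence "(LBINT \<omega>. complex_of_real b * (F \<omega> * cis (\<omega> \<bullet> (- y)))) = 0"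
      by (subst integral_mult_right_zero) simp
    thus ?case unfolding 1 using i IH
      by (subst Bochner_Integration.integral_add) (auto intro: Bochner_Integration.integrable_add)
  qed simp
  thus ?thesis ..
qed

text \<open>The bound on \<open>ft \<psi>\<close> makes \<open>ft \<psi> / rootS\<close>
  square-integrable, so \<open>1 / rootS\<close> is moved from \<open>q\<close> onto the test
  function before passing to the limit. Against \<open>rootS * trig\<close> the roots cancel and
  inversion evaluates \<open>\<psi>\<close> at \<open>- y\<close>; the sign stems from
  \<open>cis (- (\<omega> \<bullet> y))\<close> in \<open>trig\<close>.\<close>

lemma limit_pairing_zero:
  assumes q: "sq_integrable lborel q" and s: "\<And>n. snd ` set (s n) \<subseteq> D"
    and lim: "(\<lambda>n. \<integral>\<omega>. (cmod (rootS \<omega> * trig (s n) \<omega> - q \<omega>))\<^sup>2 \<partial>lborel) \<longlonglongrightarrow> 0"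
    and psi: "integrable lborel \<psi>" "\<And>x. cmod (\<psi> x) \<le> 1" and A: "\<And>\<omega>. cmod (ft \<psi> \<omega>) \<le> A * S \<omega>"
    and z: "\<And>y. y \<in> D \<Longrightarrow> isCont \<psi> (- y) \<and> \<psi> (- y) = 0"
  shows "(LBINT \<omega>. q \<omega> / rootS \<omega> * ft \<psi> \<omega>) = 0"
proof -
  have [measurable]: "\<psi> \<in> borel_measurable borel" using borel_measurable_integrable[OF psi(1)] by simp
  have fi: "integrable lborel (ft \<psi>)"
  proof (rule Bochner_Integration.integrable_bound)
    show "integrable lborel (\<lambda>\<omega>. A * S \<omega>)" using S_integrable by simp
    show "AE \<omega> in lborel. norm (ft \<psi> \<omega>) \<le> norm (A * S \<omega>)"
      using A by (intro AE_I2) (auto intro: order_trans[OF _ abs_ge_self])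
  qed simp
  have g: "sq_integrable lborel (\<lambda>\<omega>. ft \<psi> \<omega> / rootS \<omega>)"
  proof (rule sq_integrable_bound[OF sq_integrable_rootS, where C = A])
    show "AE \<omega> in lborel. cmod (ft \<psi> \<omega> / rootS \<omega>) \<le> A * cmod (rootS \<omega>)"
    proof (rule AE_I2)
      fix \<omega>
      have "cmod (ft \<psi> \<omega>) / cmod (rootS \<omega>) \<le> (A * (cmod (rootS \<omega>))\<^sup>2) / cmod (rootS \<omega>)"
        using A[of \<omega>] unfolding cmod_rootS_sq by (intro divide_right_mono) auto
      thus "cmod (ft \<psi> \<omega> / rootS \<omega>) \<le> A * cmod (rootS \<omega>)"
        using rootS_nz[of \<omega>] by (simp add: norm_divide power2_eq_square)
    qed
  qed simp
  have "(\<lambda>n. \<integral>\<omega>. rootS \<omega> * trig (s n) \<omega> * (ft \<psi> \<omega> / rootS \<omega>) \<partial>lborel) \<longlonglongrightarrow> (LBINT \<omega>. q \<omega> * (ft \<psi> \<omega> / rootS \<omega>))"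
    by (rule tendsto_integral_L2[OF sq_integrable_rootS_trig q g lim])
  moreover have "(LBINT \<omega>. rootS \<omega> * trig (s n) \<omega> * (ft \<psi> \<omega> / rootS \<omega>)) = 0" for n
  proof -
    have "(LBINT \<omega>. rootS \<omega> * trig (s n) \<omega> * (ft \<psi> \<omega> / rootS \<omega>)) = (LBINT \<omega>. trig (s n) \<omega> * ft \<psi> \<omega>)"
      using rootS_nz by (intro Bochner_Integration.integral_cong) auto
    also have "\<dots> = 0"
    proof (rule trig_pairing[OF fi])
      fix y assume "y \<in> snd ` set (s n)"
      hence "y \<in> D" using s by blast
      thus "(LBINT \<omega>. ft \<psi> \<omega> * cis (\<omega> \<bullet> (- y))) = 0"
        using ft_inversion[OF psi _ fi, of "- y"] z by simp
    qed
    finally show ?thesis .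
  qed
  ultimately have "(LBINT \<omega>. q \<omega> * (ft \<psi> \<omega> / rootS \<omega>)) = 0"
    by (simp add: LIMSEQ_const_iff)
  thus ?thesis by (simp add: mult.commute)
qed

text \<open>The indicator of \<open>B\<close> is approximated by its mollifications, which are
  admissible tests because \<open>closure B\<close> keeps a positive distance from the reflected
  set. Convexity of \<open>B\<close> makes its frontier a null set, which gives convergence almost
  everywhere.\<close>

lemma local_integral_zero:
  fixes B :: "'a set"
  assumes q: "sq_integrable lborel q" and s: "\<And>n. snd ` set (s n) \<subseteq> D"
    and lim: "(\<lambda>n. \<integral>\<omega>. (cmod (rootS \<omega> * trig (s n) \<omega> - q \<omega>))\<^sup>2 \<partial>lborel) \<longlonglongrightarrow> 0"
    and V: "sq_integrable lborel V"
    and dual: "\<And>\<psi>. integrable lborel \<psi> \<Longrightarrow> sq_integrable lborel \<psi> \<Longrightarrow>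
       (LBINT x. V x * \<psi> x) = (LBINT \<omega>. q \<omega> / rootS \<omega> * ft \<psi> \<omega>)"
    and D: "closed D" and B: "convex B" "bounded B" "B \<in> sets borel" and disj: "closure B \<inter> uminus ` D = {}"
  shows "(LBINT x. indicator B x *\<^sub>R V x) = 0"
proof -
  have [measurable]: "V \<in> borel_measurable borel" using sq_integrable_measurable[OF V] by simp
  note [measurable] = B(3)
  define k where "k x = complex_of_real (indicator B x)" for x
  have [measurable]: "k \<in> borel_measurable borel" unfolding k_def by measurable
  have kb: "cmod (k x) \<le> 1" for x by (simp add: k_def)
  have ki: "integrable lborel k"
    unfolding k_def using emeasure_bounded_finite[OF B(2)] B(3) by simp
  obtain r where r: "r > 0" "\<And>x y. x \<in> closure B \<Longrightarrow> y \<in> uminus ` D \<Longrightarrow> r \<le> dist x y"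
    using separate_compact_closed[of "closure B" "uminus ` D"] disj B(2) closed_negations[OF D]
    by (auto simp: compact_closure)
  obtain R0 where R0: "\<And>x. x \<in> B \<Longrightarrow> norm x < R0"
    using B(2) unfolding bounded_pos_less by auto
  define N where "N = nat \<lceil>m\<rceil>"
  have N: "m \<le> real N" unfolding N_def by linarith
  \<comment> \<open>\<open>dN * h\<close> is the distance over which \<open>2 * N\<close> averages
    spread the support. The width \<open>h n\<close> keeps it below \<open>r\<close> while tending
    to zero, and \<open>N \<ge> m\<close> lets \<open>S\<close> dominate the transform.\<close>
  define dN where "dN = real (2 * N) * real DIM('a)"
  have dN0: "dN \<ge> 0" by (simp add: dN_def)
  define h where "h n = r / (dN + 1) * inverse (real (Suc n))" for n
  have h0: "h n > 0" for n using r(1) dN0 by (simp add: h_def)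
  have hlim: "h \<longlonglongrightarrow> 0"
    unfolding h_def using tendsto_mult_right_zero[OF LIMSEQ_inverse_real_of_nat] by blast
  have dNh: "dN * h n < r" for n
  proof -
    have "h n \<le> r / (dN + 1) * 1"
      unfolding h_def using r(1) dN0 by (intro mult_left_mono) (auto simp: field_simps)
    hence "dN * h n \<le> dN * (r / (dN + 1))" using dN0 by (intro mult_left_mono) auto
    also have "\<dots> < r" using r(1) dN0 by (simp add: field_simps)
    finally show ?thesis .
  qed
  define \<psi> where "\<psi> n = mollify (h n) (2 * N) k" for n
  have psi_i: "integrable lborel (\<psi> n)" and psi_b: "cmod (\<psi> n x) \<le> 1" for n x
    unfolding \<psi>_def using mollify_properties[OF h0 ki kb] by auto
  have [measurable]: "\<psi> n \<in> borel_measurable borel" for n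
    using borel_measurable_integrable[OF psi_i[of n]] by simp
  have psi_c: "\<psi> n y = a" if "\<And>z. dist x z < \<rho> \<Longrightarrow> k z = a" "dist x y < \<rho> - dN * h n" for n x y \<rho> a
    unfolding \<psi>_def using that by (intro mollify_local_const[OF h0, of x \<rho>]) (auto simp: dN_def mult.assoc)
  have Vpsi: "(LBINT x. V x * \<psi> n x) = 0" for n
  proof -
    have "(LBINT x. V x * \<psi> n x) = (LBINT \<omega>. q \<omega> / rootS \<omega> * ft (\<psi> n) \<omega>)"
      by (rule dual[OF psi_i sq_integrable_if_bounded[OF psi_i psi_b]])
    also have "\<dots> = 0"
    proof -
      obtain A where A: "\<And>\<omega>. cmod (ft (\<psi> n) \<omega>) \<le> A * (1 + (norm \<omega>)\<^sup>2) powr (- real N)"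
        unfolding \<psi>_def using ft_mollify_bound[OF h0 ki kb] by blast
      have A0: "A \<ge> 0" using order_trans[OF norm_ge_zero A[of 0]] by simp
      have AS: "cmod (ft (\<psi> n) \<omega>) \<le> A / c * S \<omega>" for \<omega>
      proof -
        have "(1 + (norm \<omega>)\<^sup>2) powr (- real N) \<le> (1 + (norm \<omega>)\<^sup>2) powr (- m)"
          using N by (intro powr_mono) auto
        hence "A * (1 + (norm \<omega>)\<^sup>2) powr (- real N) \<le> A * (1 + (norm \<omega>)\<^sup>2) powr (- m)"
          using A0 by (intro mult_left_mono)
        also have "\<dots> = A / c * (c * (1 + (norm \<omega>)\<^sup>2) powr (- m))" using c_pos by simp
        also have "\<dots> \<le> A / c * S \<omega>" using A0 c_pos S_lower[of \<omega>] by (intro mult_left_mono) auto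
        finally show ?thesis using A[of \<omega>] by linarith
      qed
      show ?thesis
      proof (rule limit_pairing_zero[OF q s lim psi_i psi_b AS])
        fix y assume y: "y \<in> D"
        have k0: "k z = 0" if "dist (- y) z < r" for z
        proof -
          have "z \<notin> B" using r(2)[of z "- y"] y that closure_subset by (force simp: dist_commute)
          thus ?thesis by (simp add: k_def)
        qed
        have p0: "\<psi> n z = 0" if "dist (- y) z < r - dN * h n" for z
          by (rule psi_c[OF k0 that])
        have "\<forall>\<^sub>F z in nhds (- y). \<psi> n z = 0"
          unfolding eventually_nhds_metric using p0 dNh[of n]
          by (intro exI[of _ "r - dN * h n"]) (auto simp: dist_commute)
        hence "isCont (\<psi> n) (- y) \<longleftrightarrow> isCont (\<lambda>_. 0 :: complex) (- y)"
          by (rule isCont_cong)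
        thus "isCont (\<psi> n) (- y) \<and> \<psi> n (- y) = 0" using p0[of "- y"] dNh[of n] by simp
      qed
    qed
    finally show ?thesis .
  qed
  have fr: "AE x in lborel. x \<notin> frontier B"
  proof -
    have "frontier B \<in> null_sets lborel"
      using negligible_convex_frontier[OF B(1)] by (auto simp: null_sets_completion_iff negligible_iff_null_sets)
    thus ?thesis by (rule AE_not_in)
  qed
  \<comment> \<open>The mollified indicators are bounded by \<open>1\<close> and live in one common
    ball, so \<open>V\<close> restricted to that ball dominates.\<close>
  have "(\<lambda>n. \<integral>x. V x * \<psi> n x \<partial>lborel) \<longlonglongrightarrow> (LBINT x. V x * k x)"
  proof (rule integral_dominated_convergence[where w = "\<lambda>x. cmod (indicator (ball 0 (R0 + r)) x *\<^sub>R V x)"])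
    show "integrable lborel (\<lambda>x. cmod (indicator (ball 0 (R0 + r)) x *\<^sub>R V x))"
      by (rule integrable_norm[OF integrable_local_sq_integrable[OF V]])
    show "AE x in lborel. norm (V x * \<psi> n x) \<le> cmod (indicator (ball 0 (R0 + r)) x *\<^sub>R V x)" for n
    proof (rule AE_I2)
      fix x
      show "norm (V x * \<psi> n x) \<le> cmod (indicator (ball 0 (R0 + r)) x *\<^sub>R V x)"
      proof (cases "x \<in> ball 0 (R0 + r)")
        case True
        thus ?thesis using psi_b[of n x] by (auto simp: norm_mult intro!: mult_left_le)
      next
        case False
        hence nx: "norm x \<ge> R0 + r" by simp
        have kx: "k z = 0" if "dist x z < r" for z
        proof -
          have "norm x \<le> norm z + dist x z"
            using norm_triangle_ineq[of z "x - z"] by (simp add: dist_norm)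
          hence "z \<notin> B" using R0[of z] nx that by force
          thus ?thesis by (simp add: k_def)
        qed
        have "dist x x < r - dN * h n" unfolding dist_self using dNh[of n] by linarith
        with kx have "\<psi> n x = 0" by (rule psi_c)
        thus ?thesis by simp
      qed
    qed
    show "AE x in lborel. (\<lambda>n. V x * \<psi> n x) \<longlonglongrightarrow> V x * k x"
      using fr
    proof eventually_elim
      case (elim x)
      obtain \<rho> where rho: "\<rho> > 0" "\<And>z. dist x z < \<rho> \<Longrightarrow> k z = k x"
      proof (cases "x \<in> B")
        case True
        hence "x \<in> interior B" using elim closure_subset by (auto simp: frontier_def)
        then obtain e where "e > 0" "ball x e \<subseteq> B" using mem_interior by blast
        thus ?thesis using that[of e] True by (auto simp: k_def subset_eq)
      next
        case False
        hence "x \<in> - closure B" using elim interior_subset by (auto simp: frontier_def)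
        then obtain e where e: "e > 0" "ball x e \<subseteq> - closure B"
          using open_contains_ball[of "- closure B"] by auto
        have "z \<notin> B" if "dist x z < e" for z using e(2) that closure_subset by (force simp: subset_eq)
        thus ?thesis using that[of e] e(1) False by (auto simp: k_def)
      qed
      have "(\<lambda>n. dN * h n) \<longlonglongrightarrow> 0" using tendsto_mult_right_zero[OF hlim] .
      hence "\<forall>\<^sub>F n in sequentially. dN * h n < \<rho>" using rho(1) by (rule order_tendstoD)
      hence "\<forall>\<^sub>F n in sequentially. V x * \<psi> n x = V x * k x"
        by eventually_elim (simp add: psi_c[OF rho(2), of x])
      thus ?case by (rule tendsto_eventually)
    qed
  qed measurable
  hence "(LBINT x. V x * k x) = 0" unfolding Vpsi by (simp add: LIMSEQ_const_iff)
  thus ?thesis by (simp add: k_def scaleR_conv_of_real mult.commute)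
qed

text \<open>\<open>local_integral_zero\<close> asks for sets whose closure misses the reflected
  \<open>D\<close>, hence the cover by countably many closed boxes inside the open complement.
  Intersections of one of them with open boxes are convex, and their integrals determine
  \<open>V\<close> there. The reflection arises because \<open>V\<close> is a forward transform of
  \<open>q / rootS\<close>, where the sought density is an inverse one.\<close>

lemma AE_support:
  assumes q: "sq_integrable lborel q" and s: "\<And>n. snd ` set (s n) \<subseteq> D"
    and lim: "(\<lambda>n. \<integral>\<omega>. (cmod (rootS \<omega> * trig (s n) \<omega> - q \<omega>))\<^sup>2 \<partial>lborel) \<longlonglongrightarrow> 0"
    and V: "sq_integrable lborel V"
    and dual: "\<And>\<psi>. integrable lborel \<psi> \<Longrightarrow> sq_integrable lborel \<psi> \<Longrightarrow>
       (LBINT x. V x * \<psi> x) = (LBINT \<omega>. q \<omega> / rootS \<omega> * ft \<psi> \<omega>)"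
    and D: "closed D"
  shows "AE x in lborel. - x \<notin> D \<longrightarrow> V x = 0"
proof -
  let ?U = "- (uminus ` D)"
  have "open ?U" by (rule open_Compl[OF closed_negations[OF D]])
  then obtain \<D> where DD: "countable \<D>" "\<D> \<subseteq> Pow ?U" "\<And>X. X \<in> \<D> \<Longrightarrow> \<exists>a b. X = cbox a b" "\<Union>\<D> = ?U"
    by (rule open_countable_Union_open_cbox) (rule that)
  have "AE x in lborel. x \<in> X \<longrightarrow> V x = 0" if X: "X \<in> \<D>" for X
  proof -
    obtain a b where ab: "X = cbox a b" using DD(3)[OF X] by blast
    have sub: "cbox a b \<inter> uminus ` D = {}" using DD(2) X ab by auto
    have [measurable]: "V \<in> borel_measurable borel" using sq_integrable_measurable[OF V] by simp
    obtain R where R: "cbox a b \<subseteq> ball 0 R"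
      using bounded_subset_ballD[OF bounded_cbox[of a b]] by blast
    define u where "u x = indicator (cbox a b) x *\<^sub>R V x" for x
    have "integrable lborel (\<lambda>x. indicator (cbox a b) x *\<^sub>R (indicator (ball 0 R) x *\<^sub>R V x))"
      by (intro integrable_mult_indicator integrable_local_sq_integrable V) simp
    moreover have "indicator (cbox a b) x *\<^sub>R (indicator (ball 0 R) x *\<^sub>R V x) = u x" for x
      using R by (auto simp: u_def split: split_indicator)
    ultimately have u: "integrable lborel u" by simp
    have "AE x in lborel. u x = 0"
    proof (rule AE_zero_if_box_integrals_zero[OF u])
      fix c d :: 'a
      have "closure (box c d \<inter> cbox a b) \<subseteq> cbox a b"
        by (intro closure_minimal) auto
      hence "(LBINT x. indicator (box c d \<inter> cbox a b) x *\<^sub>R V x) = 0"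
        using sub by (intro local_integral_zero[OF q s lim V dual D])
          (auto intro: convex_Int bounded_Int)
      thus "(LBINT x. indicator (box c d) x *\<^sub>R u x) = 0"
        by (simp add: u_def indicator_inter_arith)
    qed
    thus ?thesis by eventually_elim (auto simp: u_def ab)
  qed
  hence "AE x in lborel. \<forall>X\<in>\<D>. x \<in> X \<longrightarrow> V x = 0"
    using DD(1) by (subst AE_ball_countable) auto
  thus ?thesis
  proof eventually_elim
    case (elim x)
    show ?case
    proof
      assume "- x \<notin> D"
      hence "x \<in> ?U" by (metis ComplI image_iff minus_minus)
      thus "V x = 0" using elim DD(4) by blast
    qed
  qed
qed

section \<open>The two implications\<close>

lemma integral_equation_imp_sobolev:
  fixes v :: "'a \<Rightarrow> real"
  assumes D: "compact D" and f: "f \<in> native_space K D"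
    and vm: "set_borel_measurable lebesgue D v" and v2: "set_integrable lebesgue D (\<lambda>t. (v t)\<^sup>2)"
    and eq: "\<forall>x\<in>D. f x = (LINT t:D|lebesgue. K (x - t) * v t)"
  shows "canon_ext K D f \<in> sobolev_space (2 * m)"
proof -
  have Db [measurable]: "D \<in> sets borel" using D by (simp add: compact_imp_closed)
  have m: "(\<lambda>x. indicator D x * v x) \<in> borel_measurable lebesgue"
    using vm by (simp add: set_borel_measurable_def)
  obtain v1 where [measurable]: "v1 \<in> borel_measurable lborel" and v1: "AE x in lborel. indicator D x * v x = v1 x"
    using completion_ex_borel_measurable_real[OF m] by blast
  \<comment> \<open>The indicator is applied again because the Borel version \<open>v1\<close>
    vanishes off \<open>D\<close> only almost everywhere, while \<open>canon_ext_eq_conv\<close>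
    asks for it at every point.\<close>
  define w where "w x = complex_of_real (indicator D x * v1 x)" for x
  have [measurable]: "w \<in> borel_measurable borel" unfolding w_def by measurable
  have aeL: "AE x in lebesgue. indicator D x * v x = v1 x" by (rule AE_completion[OF v1])
  have w2: "sq_integrable lborel w"
  proof (rule sq_integrableI_nn)
    have "integrable lebesgue (\<lambda>t. indicator D t * (v t)\<^sup>2)"
      using v2 by (simp add: set_integrable_def)
    hence "(\<integral>\<^sup>+t. ennreal (norm (indicator D t * (v t)\<^sup>2)) \<partial>lebesgue) < \<infinity>"
      by (simp add: integrable_iff_bounded)
    moreover have "(\<integral>\<^sup>+t. ennreal (norm (indicator D t * (v t)\<^sup>2)) \<partial>lebesgue) = (\<integral>\<^sup>+t. ennreal ((cmod (w t))\<^sup>2) \<partial>lborel)"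
    proof (rule nn_integral_lebesgue_borel_AE)
      show "AE t in lborel. ennreal (norm (indicator D t * (v t)\<^sup>2)) = ennreal ((cmod (w t))\<^sup>2)"
        using v1 by eventually_elim (auto simp: w_def split: split_indicator_asm)
    qed
    ultimately show "(\<integral>\<^sup>+t. ennreal ((cmod (w t))\<^sup>2) \<partial>lborel) < \<infinity>" by simp
  qed simp
  \<comment> \<open>On the bounded set \<open>D\<close>, square-integrability implies
    integrability.\<close>
  have w1: "integrable lborel w"
  proof -
    obtain R where R: "D \<subseteq> ball 0 R" using bounded_subset_ballD[OF compact_imp_bounded[OF D]] by blast
    have "indicator (ball 0 R) x *\<^sub>R w x = w x" for x
      using R by (auto simp: w_def split: split_indicator)
    thus ?thesis using integrable_local_sq_integrable[OF w2, of R] by simp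
  qed
  have fw: "complex_of_real (f x) = conv (\<lambda>x. complex_of_real (K x)) w x" if "x \<in> D" for x
  proof -
    have "f x = (\<integral>t. K (x - t) * (indicator D t * v t) \<partial>lebesgue)"
      using eq that by (simp add: set_lebesgue_integral_def mult_ac)
    also have "\<dots> = (\<integral>t. K (x - t) * (indicator D t * v1 t) \<partial>lebesgue)"
    proof (rule integral_cong_AE)
      have [measurable]: "(\<lambda>t. K (x - t)) \<in> borel_measurable lebesgue"
        by (rule measurable_completion) measurable
      show "(\<lambda>t. K (x - t) * (indicator D t * v t)) \<in> borel_measurable lebesgue"
        using m by measurable
      show "(\<lambda>t. K (x - t) * (indicator D t * v1 t)) \<in> borel_measurable lebesgue"
        by (rule measurable_completion) measurable
      show "AE t in lebesgue. K (x - t) * (indicator D t * v t) = K (x - t) * (indicator D t * v1 t)"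
        using aeL by eventually_elim (auto split: split_indicator_asm split_indicator)
    qed
    also have "\<dots> = (LBINT t. K (x - t) * (indicator D t * v1 t))"
      by (rule integral_completion) measurable
    finally have "complex_of_real (f x) = (LBINT t. complex_of_real (K (x - t) * (indicator D t * v1 t)))"
      by (simp only: integral_complex_of_real)
    thus ?thesis by (simp add: conv_def w_def)
  qed
  show ?thesis
    by (rule conv_K_in_sobolev_space[OF w1 w2 canon_ext_eq_conv[OF f w1 w2 _ fw]]) (auto simp: w_def)
qed

lemma sobolev_imp_integral_equation:
  assumes D: "closed D" and f: "f \<in> native_space K D"
    and sob: "canon_ext K D f \<in> sobolev_space (2 * m)"
  shows "\<exists>v. set_borel_measurable lebesgue D v \<and> set_integrable lebesgue D (\<lambda>t. (v t)\<^sup>2) \<and>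
      (\<forall>x\<in>D. f x = (LINT t:D|lebesgue. K (x - t) * v t))"
proof -
  let ?c = "(2 * pi) ^ DIM('a)"
  have Db [measurable]: "D \<in> sets borel" using D by simp
  obtain q s where q: "sq_integrable lborel q" and s: "\<And>n. snd ` set (s n) \<subseteq> D"
    and lim: "(\<lambda>n. \<integral>\<omega>. (cmod (rootS \<omega> * trig (s n) \<omega> - q \<omega>))\<^sup>2 \<partial>lborel) \<longlonglongrightarrow> 0"
    and ce: "\<And>x. complex_of_real (canon_ext K D f x) = synth q x"
    and cf: "\<And>x. x \<in> D \<Longrightarrow> canon_ext K D f x = f x"
    by (rule native_space_spectral[OF f]) (rule that)
  obtain V where V: "sq_integrable lborel V"
    and dual: "\<And>\<psi>. integrable lborel \<psi> \<Longrightarrow> sq_integrable lborel \<psi> \<Longrightarrow>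
       (LBINT x. V x * \<psi> x) = (LBINT \<omega>. q \<omega> / rootS \<omega> * ft \<psi> \<omega>)"
    by (rule L2_fourier_transform_exists[OF sobolev_divide_rootS[OF q ce sob]]) (rule that)
  have [measurable]: "V \<in> borel_measurable borel" using sq_integrable_measurable[OF V] by simp
  have supp: "AE x in lborel. - x \<notin> D \<longrightarrow> V x = 0"
    by (rule AE_support[OF q s lim V dual D])
  have rep: "complex_of_real ?c * synth q x = (LBINT t. indicator D t *\<^sub>R (V (- t) * complex_of_real (K (x - t))))" for x
  proof -
    \<comment> \<open>Testing \<open>V\<close> with a translate of \<open>K\<close> produces
      \<open>S \<omega> * cis (\<omega> \<bullet> x)\<close> on the frequency side, and
      \<open>S\<close> divided by \<open>rootS\<close> restores the integrand of
      \<open>synth q x\<close>.\<close>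
    define \<psi> where "\<psi> t = complex_of_real (K (x + t))" for t
    have [measurable]: "\<psi> \<in> borel_measurable borel" unfolding \<psi>_def by measurable
    have i: "integrable lborel \<psi>"
      unfolding \<psi>_def using lborel_integral_translate(1)[of K x] K_integrable by simp
    have i2: "sq_integrable lborel \<psi>"
      using K_bounded by (intro sq_integrable_if_bounded[OF i]) (auto simp: \<psi>_def)
    have ftpsi: "ft \<psi> \<omega> = complex_of_real (?c * S \<omega>) * cis (\<omega> \<bullet> x)" for \<omega>
    proof -
      have "ft \<psi> \<omega> = (LBINT t. complex_of_real (K (x + t)) * cis (- (\<omega> \<bullet> ((x + t) - x))))"
        unfolding ft_def \<psi>_def by simp
      also have "\<dots> = (LBINT t. complex_of_real (K t) * cis (- (\<omega> \<bullet> (t - x))))"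
        by (rule lborel_integral_translate(2)) measurable
      also have "\<dots> = (LBINT t. complex_of_real (K t) * cis (- (\<omega> \<bullet> t)) * cis (\<omega> \<bullet> x))"
        by (intro Bochner_Integration.integral_cong) (auto simp: mult.assoc cis_mult inner_diff_right)
      also have "\<dots> = ft (\<lambda>x. complex_of_real (K x)) \<omega> * cis (\<omega> \<bullet> x)"
        unfolding ft_def by (rule integral_mult_left_zero)
      finally show ?thesis unfolding ft_K .
    qed
    have "complex_of_real ?c * synth q x = (LBINT \<omega>. q \<omega> / rootS \<omega> * ft \<psi> \<omega>)"
      unfolding synth_def integral_mult_right_zero[symmetric]
    proof (intro Bochner_Integration.integral_cong refl)
      fix \<omega>
      show "complex_of_real ?c * (q \<omega> * (rootS \<omega> * cis (\<omega> \<bullet> x))) = q \<omega> / rootS \<omega> * ft \<psi> \<omega>"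
        unfolding ftpsi of_real_mult rootS_mult_self[symmetric] using rootS_nz[of \<omega>] by (simp del: of_real_power)
    qed
    also have "\<dots> = (LBINT t. V t * \<psi> t)" by (rule dual[OF i i2, symmetric])
    also have "\<dots> = (LBINT t. indicator D (- t) *\<^sub>R (V t * \<psi> t))"
      using supp by (intro integral_cong_AE) (auto split: split_indicator)
    also have "\<dots> = (LBINT t. indicator D (- (0 - t)) *\<^sub>R (V (0 - t) * \<psi> (0 - t)))"
      by (rule lborel_integral_reflect(2)[symmetric]) measurable
    finally show ?thesis by (simp add: \<psi>_def)
  qed
  \<comment> \<open>The reflection undoes the sign left by the forward transform, and
    \<open>?c\<close> is the factor in \<open>ft_K\<close>. Taking the real part is compatible with
    the equation because \<open>f\<close> and \<open>K\<close> are real.\<close>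
  define v where "v t = Re (V (- t)) / ?c" for t
  have [measurable]: "v \<in> borel_measurable borel" unfolding v_def by measurable
  have vi: "integrable lborel (\<lambda>t. (v t)\<^sup>2)"
  proof (rule Bochner_Integration.integrable_bound)
    have "integrable lborel (\<lambda>t. (cmod (V (0 - t)))\<^sup>2)"
      using lborel_integral_reflect(1)[of "\<lambda>t. (cmod (V t))\<^sup>2" 0] sq_integrable_norm2[OF V] by simp
    thus "integrable lborel (\<lambda>t. (cmod (V (- t)))\<^sup>2 / ?c\<^sup>2)"
      by (intro Bochner_Integration.integrable_divide) simp
    show "AE t in lborel. norm ((v t)\<^sup>2) \<le> norm ((cmod (V (- t)))\<^sup>2 / ?c\<^sup>2)"
    proof (rule AE_I2)
      fix t
      have "\<bar>Re (V (- t))\<bar>\<^sup>2 \<le> (cmod (V (- t)))\<^sup>2"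
        by (intro power_mono abs_Re_le_cmod) simp
      hence "(Re (V (- t)))\<^sup>2 / ?c\<^sup>2 \<le> (cmod (V (- t)))\<^sup>2 / ?c\<^sup>2"
        by (intro divide_right_mono) auto
      thus "norm ((v t)\<^sup>2) \<le> norm ((cmod (V (- t)))\<^sup>2 / ?c\<^sup>2)"
        by (simp only: v_def power_divide real_norm_def abs_of_nonneg zero_le_power2 divide_nonneg_nonneg)
    qed
  qed simp
  show ?thesis
  proof (intro exI[of _ v] conjI ballI)
    show "set_borel_measurable lebesgue D v"
      unfolding set_borel_measurable_def by (rule measurable_completion) measurable
    show "set_integrable lebesgue D (\<lambda>t. (v t)\<^sup>2)"
      unfolding set_integrable_def
      by (subst integrable_completion) (measurable, intro integrable_mult_indicator vi, simp)
    fix x assume x: "x \<in> D"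
    let ?F = "\<lambda>t. indicator D t *\<^sub>R (V (- t) * complex_of_real (K (x - t)))"
    have Fi: "integrable lborel ?F"
    proof -
      have "sq_integrable lborel (\<lambda>t. complex_of_real (K (x - t)))"
        using K_bounded lborel_integral_reflect(1)[of K x] K_integrable
        by (intro sq_integrable_if_bounded[where B = "\<integral>\<omega>. S \<omega> \<partial>lborel"]) auto
      moreover have "sq_integrable lborel (\<lambda>t. V (- t))"
        unfolding sq_integrable_def
        using lborel_integral_reflect(1)[of "\<lambda>t. (cmod (V t))\<^sup>2" 0] sq_integrable_norm2[OF V] by simp
      ultimately show ?thesis
        by (intro integrable_mult_indicator sq_integrable_mult_integrable) auto
    qed
    have "?c * f x = Re (complex_of_real ?c * synth q x)"
      using ce[of x, symmetric] cf[OF x] by (simp flip: of_real_mult of_real_power)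
    also have "\<dots> = (LBINT t. Re (?F t))"
      unfolding rep by (rule integral_Re[OF Fi, symmetric])
    also have "\<dots> = (LBINT t. ?c * (indicator D t * (K (x - t) * v t)))"
      by (intro Bochner_Integration.integral_cong) (auto simp: v_def)
    also have "\<dots> = ?c * (LBINT t. indicator D t * (K (x - t) * v t))" by simp
    finally have "f x = (LBINT t. indicator D t * (K (x - t) * v t))" by simp
    also have "\<dots> = (LINT t:D|lebesgue. K (x - t) * v t)"
      unfolding set_lebesgue_integral_def by (subst integral_completion) auto
    finally show "f x = (LINT t:D|lebesgue. K (x - t) * v t)" .
  qed
qed

end

theorem theorem2p2:
  fixes \<Omega> :: "'a::euclidean_space set" and m \<phi> :: real and f :: "'a \<Rightarrow> real"
  assumes "convex \<Omega>" and "compact \<Omega>"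
    and "m > real DIM('a) / 2" and "\<phi> > 0"
    and "f \<in> native_space (matern (m - real DIM('a) / 2) \<phi>) \<Omega>"
  shows "(\<exists>v :: 'a \<Rightarrow> real.
            set_borel_measurable lebesgue \<Omega> v \<and>
            set_integrable lebesgue \<Omega> (\<lambda>t. (v t)\<^sup>2) \<and>
            (\<forall>x\<in>\<Omega>. f x = (LINT t:\<Omega>|lebesgue. matern (m - real DIM('a) / 2) \<phi> (x - t) * v t)))
         \<longleftrightarrow> canon_ext (matern (m - real DIM('a) / 2) \<phi>) \<Omega> f \<in> sobolev_space (2 * m)"
proof -
  define \<nu> where "\<nu> = m - real DIM('a) / 2"
  have nu: "\<nu> > 0" using assms(3) by (simp add: \<nu>_def)
  have m: "m = \<nu> + real DIM('a) / 2" by (simp add: \<nu>_def)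
  obtain c C where "c > 0"
    and lower: "\<And>\<omega>::'a. c * (1 + (norm \<omega>)\<^sup>2) powr (- m) \<le> matern_spectrum \<nu> \<phi> \<omega>"
    and upper: "\<And>\<omega>::'a. matern_spectrum \<nu> \<phi> \<omega> \<le> C * (1 + (norm \<omega>)\<^sup>2) powr (- m)"
    by (rule matern_spectrum_bounds[OF nu assms(4) m]) (rule that)
  interpret spectral_kernel "matern \<nu> \<phi> :: 'a \<Rightarrow> real" "matern_spectrum \<nu> \<phi>" m c C
  proof
    show "m > 0" using assms(3) by (rule le_less_trans[rotated]) simp
    show "matern_spectrum \<nu> \<phi> (- \<omega>) = matern_spectrum \<nu> \<phi> \<omega>" for \<omega> :: 'a
      by (simp add: matern_spectrum_def)
  qed (use matern_ft[OF nu assms(4)] matern_spectrum_ft[OF nu assms(4)] \<open>c > 0\<close> lower upper in auto)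
  note f = assms(5)[folded \<nu>_def]
  show ?thesis
    unfolding \<nu>_def[symmetric]
    using integral_equation_imp_sobolev[OF assms(2) f]
      sobolev_imp_integral_equation[OF compact_imp_closed[OF assms(2)] f] by blast
qed

end
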